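(* Let $k\ge2$, let $H$ be a $k$-complex of maximum degree $\Delta$ and vertex-degeneracy $\mathrm{vdeg}(H)\le\Delta'$, let $c^*$ and $h^*$ be positive integers, and let a valid ensemble of parameters, together with a partial embedding $\phi$ of $H$ and a stack of candidate graphs $\mathcal C^{(0)},\dots,\mathcal C^{(k)}$ giving a good partial embedding ($k$-GPE), be given. For $x\in V(H)\setminus\mathrm{Dom}\,\phi$, let $B_0(x)$ denote the set of vertices $v\in V_x$ such that condition (GPE1) does not hold for the extension $\phi\cup\{x\mapsto v\}$ and the updated candidate graph $\mathcal C^{(0)}_{x\mapsto v}$. For $1\le\ell\le k$, let $B_\ell(x)$ denote the set of vertices $v\in V_x$ such that $\phi\cup\{x\mapsto v\}$ and the updated candidate graphs do not form an $\ell$-GPE. Then for every $1\le\ell\le k$ such that $\ell(4k+1)\le c^*$ and $\ell(4k+1)+k\Delta'\le h^*$, we have $$\big\|B_\ell(x)\setminus B_{\ell-1}(x)\big\|_{\mathcal C^{(\ell-1)}(x)}\le k\Delta^2\varepsilon'_\ell\,\|V_x\|_{\mathcal C^{(\ell-1)}(x)}.$$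
   Context: Basics. Write $x=a\pm b$ for $a-b\le x\le a+b$. A $k$-complex $H$ is a finite vertex set with a down-closed family of subsets (edges, including $\emptyset$) of size at most $k$; $v(H)=|V(H)|$; maximum degree is the maximum number of edges containing a given vertex. A weighted hypergraph $\mathcal G$ on $V$ is a function $g$ from the power set of $V$ to the nonnegative reals (lower-case letters denote weight functions); it is a $k$-graph if $g(e)=1$ whenever $|e|\ge k+1$. $J$-partite means the vertex set is partitioned into parts indexed by $J$; crossing sets meet each part at most once; edges of partite complexes are crossing; $V_f$ ($f\subseteq J$) is the set of crossing $|f|$-sets with one vertex in each $V_j$, $j\in f$. For a $J$-partite complex $R$, $\mathcal G(R)=\mathbb E_\phi\prod_{e\in R}g(\phi(e))$ over uniformly random maps $\phi$ sending each part of $R$ into the corresponding part (product includes $\emptyset$). A density $k$-graph $\mathcal D$ on $J$ is a $k$-graph on vertex set $J$ (one vertex per part), so $\mathcal D(R)=\prod_{e\in R}d(\pi(e))$ with $\pi(e)$ the set of part indices of $e$. The link of $v\in V_i$ is $\mathcal G_v$ on the parts other than $V_i$ with $g_v(e)=g(e)g(e\cup\{v\})$ ($e=\emptyset$ included); likewise for density graphs. For $U\subseteq V_j$, $\|U\|_{\mathcal G}=\mathbb E_{v\in V_j}[\mathbf1_{v\in U}g(v)]$. Regularity. $O^m(\mathbf a)$ is the $m$-partite complex with $\mathbf a_j$ vertices in part $j$ and all crossing sets as edges. For $m$-partite $\mathcal G,\Gamma$ on the same parts, equal on edges of size $<m$ and with $g\le\gamma$ on $m$-edges, $\mathcal G$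 is $(\varepsilon,d)$-regular w.r.t. $\Gamma$ if $\mathcal G(O^m(\mathbf1^m))=(d\pm\varepsilon)\Gamma(O^m(\mathbf1^m))$ and $\mathcal G(O^m(\mathbf2^m))\le(d^{2^m}+\varepsilon)\Gamma(O^m(\mathbf2^m))$. THC (recursive). For a linearly ordered finite $J$ and density $k$-graph $\mathcal P$ on $J$, a $J$-partite $k$-graph $\Gamma$ is an $(\eta,c^* )$-THC graph with density graph $\mathcal P$ if (1) for every $J$-partite $k$-complex $R$ with at most $4$ vertices per part and at most $c^*$ vertices, $\Gamma(R)=(1\pm v(R)\eta)\frac{\gamma(\emptyset)}{p(\emptyset)}\mathcal P(R)$; (2) if $|J|\ge2$ and $x$ is the first element of $J$, there is $V_x'\subseteq V_x$ with $\|V'_x\|_\Gamma\ge(1-\eta)\|V_x\|_\Gamma$ such that for $v\in V_x'$, $\Gamma_v$ is an $(\eta,c^* )$-THC graph on $J\setminus\{x\}$ with density graph $\mathcal P_x$. Stack. $V(H)$ has a fixed linear order, $\phi$ is a partial embedding of $H$ whose domain $\mathrm{Dom}\,\phi\subseteq V(H)$ is an initial segment, and each unembedded $x\in V(H)\setminus\mathrm{Dom}\,\phi$ has a vertex set $V_x$ (pairwise disjoint). A stack of candidate graphs is a sequence $\mathcal C^{(0)}\ge\mathcal C^{(1)}\ge\dots\ge\mathcal C^{(k)}$ (pointwise) of $k$-graphs with parts $\{V_x\}_{x\in V(H)\setminus\mathrm{Dom}\,\phi}$, with weights $c^{(\ell)}$; $\mathcal C^{(\ell)}(e)$ is the restriction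 to $V_e$. Convention: $c^{(\ell)}$ is identically $1$ on $V_f$ if $f\notin H$. Update rule: for $v\in V_x$, the extension $\phi\cup\{x\mapsto v\}$ has the stack of links $\mathcal C^{(\ell)}_{x\mapsto v}:=\mathcal C^{(\ell)}_v$. For $\emptyset\ne e\subseteq V(H)\setminus\mathrm{Dom}\,\phi$, $\overline{\mathcal C}^{(\ell-1)}(e)$ is the subgraph of $\mathcal C^{(\ell-1)}$ induced on $\bigcup_{x\in e}V_x$, and $\widetilde{\mathcal C}^{(\ell)}(e)$ is obtained from it by replacing the weights on $V_e$ by those of $\mathcal C^{(\ell)}$. Hits and degeneracy. $\pi_\phi(e)=|\{x\in\mathrm{Dom}\,\phi:\{x\}\cup e'\in H\text{ for some }\emptyset\ne e'\subseteq e\}|$; $\mathrm{vdeg}(H)=\max_{e\in H}|\{x\in V(H): x\le y\ \forall y\in e,\ \{x\}\cup e'\in H\text{ for some }\emptyset\ne e'\subseteq e\}|$. Ensemble of parameters (for integers $k,c^*,h^*,\Delta$): numbers in $(0,1)$, namely minimum relative densities $\delta_1,\dots,\delta_k$, counting accuracies $\eta_0,\dots,\eta_k$, and regularity parameters $\varepsilon_{\ell,r,h}$ ($\ell,r\in[k]$, $0\le h\le h^*$). Put $\varepsilon'_\ell=\max_{r,h}\varepsilon_{\ell,r,h}$. It is valid if for each $1\le\ell\le k$: (VE1) $\eta_0\le\frac{\eta_\ell}{72(k+1)c^*}\prod_{0<\ell''\le\ell}\delta_{\ell''}^{c^*}$ and, for all $\ell'\in[\ell]$, $\varepsilon'_{\ell'}\le\frac{\eta_\ell\delta_{\ell'}}{72k(k+1)\Delta^2}\prod_{\ell'<\ell''\le\ell}\delta_{\ell''}^{c^*}$;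 (VE2),(VE4) for all $r\in[k]$, $0\le h\le h^*-1$: $\min\{\varepsilon_{\ell,r,h+1},2^{-k}\}\ge2^{2^{k+6}}k^3\big(\varepsilon_{\ell,r,h}^{1/16}+((4k+1)\eta_{\ell-1})^{1/32}\big)\delta_\ell^{-2^{k+1}}$; (VE3) $\varepsilon_{\ell,r+1,h^*}\le\varepsilon_{\ell,r,0}$ for $r\in[k-1]$. GPE. Let density $k$-graphs $\mathcal D^{(0)},\dots,\mathcal D^{(k)}$ on $V(H)$ be given, with weights $d^{(\ell)}(f)\in[0,1]$ for $\ell\ge1$ and $d^{(\ell)}(f)=1$ for $f\notin H$. $\mathcal D^{(\ell)}_\phi$ is obtained from $\mathcal D^{(\ell)}$ by successively taking links of all $x\in\mathrm{Dom}\,\phi$, so $d^{(\ell)}_\phi(e)=\prod_{f\subseteq V(H):\,e\subseteq f,\,f\setminus e\subseteq\mathrm{Dom}\,\phi}d^{(\ell)}(f)$. Given a valid ensemble and $1\le\ell\le k$, $\phi$ with $\mathcal C^{(0)},\dots,\mathcal C^{(\ell)}$ is an $\ell$-GPE if: (GPE1) $\mathcal C^{(0)}$ is an $(\eta_0,c^* )$-THC graph with density graph $\mathcal D^{(0)}_\phi$; (GPE2) for each $1\le\ell'\le\ell$ and $\emptyset\ne e\subseteq V(H)\setminus\mathrm{Dom}\,\phi$, $\widetilde{\mathcal C}^{(\ell')}(e)$ is $(\varepsilon_{\ell',|e|,\pi_\phi(e)},d^{(\ell')}_\phi(e))$-regular w.r.t. $\overline{\mathcal C}^{(\ell'-1)}(e)$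 (this is automatic for $e\notin H$, where both graphs coincide and the density is $1$, so it is a condition only for $e\in H$); (GPE3) for each such $\ell'$ and $e$, $\delta_{\ell'}\le\prod_{f\subseteq V(H):\,e\subseteq f}d^{(\ell')}(f)$. A $k$-GPE is called a good partial embedding. *)

theory Defs
  imports "HOL-Analysis.Analysis"
begin

section \<open>Complexes\<close>

record 'a set_system =
  verts :: "'a set"
  edges :: "'a set set"

definition k_complex :: "nat \<Rightarrow> 'a set_system \<Rightarrow> bool" where
  "k_complex k H \<longleftrightarrow>
     finite (verts H) \<and> {} \<in> edges H \<and>
     (\<forall>e\<in>edges H. e \<subseteq> verts H \<and> card e \<le> k \<and> (\<forall>e'. e' \<subseteq> e \<longrightarrow> e' \<in> edges H))"

definition max_degree :: "'a set_system \<Rightarrow> nat" where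
  "max_degree H = Max ((\<lambda>x. card {e \<in> edges H. x \<in> e}) ` verts H)"

text \<open>\<open>x\<close> hits \<open>e\<close>: some edge consists of \<open>x\<close> together with a nonempty subset of \<open>e\<close>.
  The case \<open>x \<in> e\<close> is allowed.\<close>

definition hits :: "'a set_system \<Rightarrow> 'a \<Rightarrow> 'a set \<Rightarrow> bool" where
  "hits H x e \<longleftrightarrow> (\<exists>e'. e' \<noteq> {} \<and> e' \<subseteq> e \<and> insert x e' \<in> edges H)"

definition vdeg :: "'a::linorder set_system \<Rightarrow> nat" where
  "vdeg H = Max ((\<lambda>e. card {x \<in> verts H. (\<forall>y\<in>e. x \<le> y) \<and> hits H x e}) ` edges H)"

text \<open>The function \<open>\<pi>\<close> assigns to each vertex of \<open>R\<close> the index of its part.\<close>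

definition partite_complex :: "nat \<Rightarrow> 'j set \<Rightarrow> ('r \<Rightarrow> 'j) \<Rightarrow> 'r set_system \<Rightarrow> bool" where
  "partite_complex k J \<pi> R \<longleftrightarrow>
     k_complex k R \<and> \<pi> ` verts R \<subseteq> J \<and> (\<forall>e\<in>edges R. inj_on \<pi> e)"

text \<open>The complex \<open>O(a)\<close> with parts indexed by \<open>J\<close>; its part map is \<^const>\<open>fst\<close>.\<close>

definition full_partite :: "'j set \<Rightarrow> ('j \<Rightarrow> nat) \<Rightarrow> ('j \<times> nat) set_system" where
  "full_partite J a =
     \<lparr> verts = (SIGMA j:J. {..<a j}),
       edges = {e. e \<subseteq> (SIGMA j:J. {..<a j}) \<and> inj_on fst e} \<rparr>"


section \<open>Weighted partite hypergraphs\<close>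

text \<open>A weighted hypergraph is its weight function. In the partite setting only the weights of
  crossing sets are ever used, so all conditions are imposed on these alone. A density graph on
  \<open>J\<close> has the singletons \<open>{j}\<close> as parts, so that its crossing sets are all subsets of \<open>J\<close>.\<close>

definition crossing :: "'j set \<Rightarrow> ('j \<Rightarrow> 'v set) \<Rightarrow> 'v set set" where
  "crossing J V = {e. e \<subseteq> (\<Union>j\<in>J. V j) \<and> finite e \<and> (\<forall>j\<in>J. card (e \<inter> V j) \<le> 1)}"

definition crossing_exact :: "'j set \<Rightarrow> ('j \<Rightarrow> 'v set) \<Rightarrow> 'v set set" where
  "crossing_exact f V = {e. e \<subseteq> (\<Union>j\<in>f. V j) \<and> finite e \<and> (\<forall>j\<in>f. card (e \<inter> V j) = 1)}"

definition k_graph :: "nat \<Rightarrow> 'v set set \<Rightarrow> ('v set \<Rightarrow> real) \<Rightarrow> bool" where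
  "k_graph k A g \<longleftrightarrow> (\<forall>e\<in>A. 0 \<le> g e \<and> (k + 1 \<le> card e \<longrightarrow> g e = 1))"

definition partite_k_graph :: "nat \<Rightarrow> 'j set \<Rightarrow> ('j \<Rightarrow> 'v set) \<Rightarrow> ('v set \<Rightarrow> real) \<Rightarrow> bool" where
  "partite_k_graph k J V g \<longleftrightarrow> k_graph k (crossing J V) g"

definition density_k_graph :: "nat \<Rightarrow> 'j set \<Rightarrow> ('j set \<Rightarrow> real) \<Rightarrow> bool" where
  "density_k_graph k J p \<longleftrightarrow> k_graph k (Pow J) p"

definition hom_density :: "('j \<Rightarrow> 'v set) \<Rightarrow> ('v set \<Rightarrow> real) \<Rightarrow> ('r \<Rightarrow> 'j) \<Rightarrow> 'r set_system \<Rightarrow> real" where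
  "hom_density V g \<pi> R =
     (\<Sum>\<psi> \<in> (\<Pi>\<^sub>E x\<in>verts R. V (\<pi> x)). \<Prod>e\<in>edges R. g (\<psi> ` e))
       / real (card (\<Pi>\<^sub>E x\<in>verts R. V (\<pi> x)))"

definition density_value :: "('j set \<Rightarrow> real) \<Rightarrow> ('r \<Rightarrow> 'j) \<Rightarrow> 'r set_system \<Rightarrow> real" where
  "density_value p \<pi> R = (\<Prod>e\<in>edges R. p (\<pi> ` e))"

definition link :: "'v \<Rightarrow> ('v set \<Rightarrow> real) \<Rightarrow> 'v set \<Rightarrow> real" where
  "link v g e = g e * g (insert v e)"

text \<open>The second argument is the part over which the expectation is taken.\<close>

definition wnorm :: "('v set \<Rightarrow> real) \<Rightarrow> 'v set \<Rightarrow> 'v set \<Rightarrow> real" where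
  "wnorm g W U = (\<Sum>v\<in>W. indicator U v * g {v}) / real (card W)"

text \<open>The index set \<open>J\<close> has \<open>m = card J\<close> elements.\<close>

definition regular_wrt ::
  "'j set \<Rightarrow> ('j \<Rightarrow> 'v set) \<Rightarrow> real \<Rightarrow> real \<Rightarrow> ('v set \<Rightarrow> real) \<Rightarrow> ('v set \<Rightarrow> real) \<Rightarrow> bool" where
  "regular_wrt J V \<epsilon> d g \<gamma> \<longleftrightarrow>
     (\<forall>e\<in>crossing J V. card e < card J \<longrightarrow> g e = \<gamma> e) \<and>
     (\<forall>e\<in>crossing J V. card e = card J \<longrightarrow> g e \<le> \<gamma> e) \<and>
     (d - \<epsilon>) * hom_density V \<gamma> fst (full_partite J (\<lambda>_. 1)) \<le> hom_density V g fst (full_partite J (\<lambda>_. 1)) \<and>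
     hom_density V g fst (full_partite J (\<lambda>_. 1)) \<le> (d + \<epsilon>) * hom_density V \<gamma> fst (full_partite J (\<lambda>_. 1)) \<and>
     hom_density V g fst (full_partite J (\<lambda>_. 2))
       \<le> (d ^ (2 ^ card J) + \<epsilon>) * hom_density V \<gamma> fst (full_partite J (\<lambda>_. 2))"


section \<open>THC graphs\<close>

text \<open>Up to isomorphism every finite complex has vertices in \<^typ>\<open>nat\<close>, so it suffices to let
  \<open>R\<close> range over those.\<close>

definition counts_like ::
  "nat \<Rightarrow> real \<Rightarrow> nat \<Rightarrow> ('j \<Rightarrow> 'v set) \<Rightarrow> 'j set \<Rightarrow> ('v set \<Rightarrow> real) \<Rightarrow> ('j set \<Rightarrow> real) \<Rightarrow> bool" where
  "counts_like k \<eta> c V J \<gamma> p \<longleftrightarrow>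
     (\<forall>(R :: nat set_system) \<pi>.
        partite_complex k J \<pi> R \<and> (\<forall>j\<in>J. card {x \<in> verts R. \<pi> x = j} \<le> 4) \<and> card (verts R) \<le> c \<longrightarrow>
        (1 - real (card (verts R)) * \<eta>) * (\<gamma> {} / p {} * density_value p \<pi> R) \<le> hom_density V \<gamma> \<pi> R \<and>
        hom_density V \<gamma> \<pi> R \<le> (1 + real (card (verts R)) * \<eta>) * (\<gamma> {} / p {} * density_value p \<pi> R))"

text \<open>The recursion removes an element of the finite set \<open>J\<close>, hence the inductive predicate is
  the only one satisfying the recursive characterisation.\<close>

inductive thc ::
  "nat \<Rightarrow> real \<Rightarrow> nat \<Rightarrow> ('j::linorder \<Rightarrow> 'v set) \<Rightarrow> 'j set \<Rightarrow> ('v set \<Rightarrow> real) \<Rightarrow> ('j set \<Rightarrow> real) \<Rightarrow> bool"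
  for k \<eta> c V where
  thcI: "\<lbrakk>finite J; partite_k_graph k J V \<gamma>; density_k_graph k J p;
     counts_like k \<eta> c V J \<gamma> p;
     card J \<ge> 2 \<longrightarrow>
       (\<exists>V'. V' \<subseteq> V (Min J) \<and>
          wnorm \<gamma> (V (Min J)) V' \<ge> (1 - \<eta>) * wnorm \<gamma> (V (Min J)) (V (Min J)) \<and>
          (\<forall>v\<in>V'. thc k \<eta> c V (J - {Min J}) (link v \<gamma>) (link (Min J) p)))\<rbrakk>
   \<Longrightarrow> thc k \<eta> c V J \<gamma> p"


section \<open>Partial embeddings and stacks of candidate graphs\<close>

text \<open>None of the notions below depends on the values of a partial embedding; the images of the
  embedded vertices enter only through the candidate graphs.\<close>

definition partial_embedding :: "'a::linorder set_system \<Rightarrow> ('a \<rightharpoonup> 'v) \<Rightarrow> bool" where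
  "partial_embedding H \<phi> \<longleftrightarrow>
     dom \<phi> \<subseteq> verts H \<and> (\<forall>x\<in>dom \<phi>. \<forall>y\<in>verts H. y \<le> x \<longrightarrow> y \<in> dom \<phi>)"

definition candidate_stack ::
  "nat \<Rightarrow> 'a set_system \<Rightarrow> ('a \<rightharpoonup> 'v) \<Rightarrow> ('a \<Rightarrow> 'v set) \<Rightarrow> (nat \<Rightarrow> 'v set \<Rightarrow> real) \<Rightarrow> bool" where
  "candidate_stack k H \<phi> V C \<longleftrightarrow>
     (let J = verts H - dom \<phi> in
       (\<forall>x\<in>J. finite (V x) \<and> V x \<noteq> {}) \<and> disjoint_family_on V J \<and>
       (\<forall>l\<le>k. partite_k_graph k J V (C l)) \<and>
       (\<forall>l<k. \<forall>e\<in>crossing J V. C (Suc l) e \<le> C l e) \<and>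
       (\<forall>l\<le>k. \<forall>f. f \<subseteq> J \<and> f \<notin> edges H \<longrightarrow> (\<forall>e\<in>crossing_exact f V. C l e = 1)))"

text \<open>\<open>replace_top V e g h\<close> is \<open>h\<close> with the weights on \<open>V\<^sub>e\<close> replaced by those of \<open>g\<close>.\<close>

definition replace_top ::
  "('a \<Rightarrow> 'v set) \<Rightarrow> 'a set \<Rightarrow> ('v set \<Rightarrow> real) \<Rightarrow> ('v set \<Rightarrow> real) \<Rightarrow> 'v set \<Rightarrow> real" where
  "replace_top V e g h u = (if u \<in> crossing_exact e V then g u else h u)"

definition hit_count :: "'a set_system \<Rightarrow> 'a set \<Rightarrow> 'a set \<Rightarrow> nat" where
  "hit_count H S e = card {x \<in> S. hits H x e}"


section \<open>Ensembles of parameters\<close>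

record ensemble =
  min_dens :: "nat \<Rightarrow> real"
  accuracy :: "nat \<Rightarrow> real"
  reg :: "nat \<Rightarrow> nat \<Rightarrow> nat \<Rightarrow> real"

definition reg_max :: "nat \<Rightarrow> nat \<Rightarrow> ensemble \<Rightarrow> nat \<Rightarrow> real" where
  "reg_max k h P l = Max ((\<lambda>(r, i). reg P l r i) ` ({1..k} \<times> {0..h}))"

text \<open>The second inequality is cleared of its denominator, so that it says nothing when the
  maximum degree \<open>\<Delta>\<close> is \<open>0\<close>.\<close>

definition valid_ensemble :: "nat \<Rightarrow> nat \<Rightarrow> nat \<Rightarrow> nat \<Rightarrow> ensemble \<Rightarrow> bool" where
  "valid_ensemble k c h \<Delta> P \<longleftrightarrow>
     (\<forall>l\<in>{1..k}. 0 < min_dens P l \<and> min_dens P l < 1) \<and>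
     (\<forall>l\<in>{0..k}. 0 < accuracy P l \<and> accuracy P l < 1) \<and>
     (\<forall>l\<in>{1..k}. \<forall>r\<in>{1..k}. \<forall>i\<in>{0..h}. 0 < reg P l r i \<and> reg P l r i < 1) \<and>
     (\<forall>l\<in>{1..k}.
        accuracy P 0 \<le> accuracy P l / (72 * (real k + 1) * real c)
                         * (\<Prod>l''\<in>{0<..l}. min_dens P l'' ^ c) \<and>
        (\<forall>l'\<in>{1..l}.
           reg_max k h P l' * (72 * real k * (real k + 1) * real \<Delta> ^ 2)
             \<le> accuracy P l * min_dens P l' * (\<Prod>l''\<in>{l'<..l}. min_dens P l'' ^ c)) \<and>
        (\<forall>r\<in>{1..k}. \<forall>i<h.
           min (reg P l r (i + 1)) (1 / 2 ^ k)
             \<ge> 2 ^ (2 ^ (k + 6)) * real k ^ 3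
                 * (reg P l r i powr (1 / 16)
                    + ((4 * real k + 1) * accuracy P (l - 1)) powr (1 / 32))
                 / min_dens P l ^ (2 ^ (k + 1))) \<and>
        (\<forall>r\<in>{1..k - 1}. reg P l (r + 1) h \<le> reg P l r 0))"


section \<open>Good partial embeddings\<close>

definition density_stack :: "nat \<Rightarrow> 'a set_system \<Rightarrow> (nat \<Rightarrow> 'a set \<Rightarrow> real) \<Rightarrow> bool" where
  "density_stack k H D \<longleftrightarrow>
     (\<forall>l\<le>k. density_k_graph k (verts H) (D l)) \<and>
     (\<forall>l\<in>{1..k}. \<forall>f. f \<subseteq> verts H \<longrightarrow> 0 \<le> D l f \<and> D l f \<le> 1) \<and>
     (\<forall>l\<le>k. \<forall>f. f \<subseteq> verts H \<and> f \<notin> edges H \<longrightarrow> D l f = 1)"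

definition density_after :: "'a set_system \<Rightarrow> 'a set \<Rightarrow> ('a set \<Rightarrow> real) \<Rightarrow> 'a set \<Rightarrow> real" where
  "density_after H S d e = (\<Prod>f\<in>{f. f \<subseteq> verts H \<and> e \<subseteq> f \<and> f - e \<subseteq> S}. d f)"

lemma density_after_empty:
  assumes "e \<subseteq> verts H"
  shows "density_after H {} d e = d e"
proof -
  have "{f. f \<subseteq> verts H \<and> e \<subseteq> f \<and> f - e \<subseteq> {}} = {e}"
    using assms by auto
  then show ?thesis
    by (simp add: density_after_def)
qed

lemma density_after_insert:
  assumes "finite (verts H)" "x \<in> verts H" "x \<notin> S" "x \<notin> e"
  shows "density_after H (insert x S) d e = link x (density_after H S d) e"
proof -
  let ?A = "{f. f \<subseteq> verts H \<and> e \<subseteq> f \<and> f - e \<subseteq> S}"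
  let ?B = "{f. f \<subseteq> verts H \<and> insert x e \<subseteq> f \<and> f - insert x e \<subseteq> S}"
  have "{f. f \<subseteq> verts H \<and> e \<subseteq> f \<and> f - e \<subseteq> insert x S} = ?A \<union> ?B"
    using assms by blast
  moreover have "?A \<inter> ?B = {}"
    using assms by blast
  moreover have "finite ?A" "finite ?B"
    using assms(1) by (auto intro: finite_subset[of _ "Pow (verts H)"])
  ultimately show ?thesis
    by (simp add: density_after_def link_def prod.union_disjoint)
qed

text \<open>The regularity condition is stated for \<open>e \<in> edges H\<close>: for other \<open>e\<close> both graphs coincide and
  the density is \<open>1\<close>, while \<open>card e\<close> need not be an admissible index. For \<open>l = 0\<close> only the
  THC condition remains.\<close>

definition gpe ::
  "nat \<Rightarrow> nat \<Rightarrow> 'a::linorder set_system \<Rightarrow> ensemble \<Rightarrow> (nat \<Rightarrow> 'a set \<Rightarrow> real) \<Rightarrow> ('a \<Rightarrow> 'v set)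
    \<Rightarrow> ('a \<rightharpoonup> 'v) \<Rightarrow> (nat \<Rightarrow> 'v set \<Rightarrow> real) \<Rightarrow> nat \<Rightarrow> bool" where
  "gpe k c H P D V \<phi> C l \<longleftrightarrow>
     (let J = verts H - dom \<phi> in
       thc k (accuracy P 0) c V J (C 0) (density_after H (dom \<phi>) (D 0)) \<and>
       (\<forall>l'\<in>{1..l}. \<forall>e\<in>edges H. e \<noteq> {} \<and> e \<subseteq> J \<longrightarrow>
          regular_wrt e V (reg P l' (card e) (hit_count H (dom \<phi>) e))
            (density_after H (dom \<phi>) (D l') e)
            (replace_top V e (C l') (C (l' - 1))) (C (l' - 1))) \<and>
       (\<forall>l'\<in>{1..l}. \<forall>e. e \<noteq> {} \<and> e \<subseteq> J \<longrightarrow>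
          min_dens P l' \<le> (\<Prod>f\<in>{f. f \<subseteq> verts H \<and> e \<subseteq> f}. D l' f)))"

text \<open>Vertices whose choice as the image of \<open>x\<close> destroys the \<open>l\<close>-GPE property; for \<open>l = 0\<close>, the
  THC condition.\<close>

definition bad_vertices ::
  "nat \<Rightarrow> nat \<Rightarrow> 'a::linorder set_system \<Rightarrow> ensemble \<Rightarrow> (nat \<Rightarrow> 'a set \<Rightarrow> real) \<Rightarrow> ('a \<Rightarrow> 'v set)
    \<Rightarrow> ('a \<rightharpoonup> 'v) \<Rightarrow> (nat \<Rightarrow> 'v set \<Rightarrow> real) \<Rightarrow> 'a \<Rightarrow> nat \<Rightarrow> 'v set" where
  "bad_vertices k c H P D V \<phi> C x l =
     {v \<in> V x. \<not> gpe k c H P D V (\<phi>(x \<mapsto> v)) (\<lambda>i. link v (C i)) l}"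

end

theory Submission
  imports Defs
begin

text \<open>
  Only full partite complexes with at most two vertices in each part are ever counted. Adding \<open>n\<close>
  copies of a vertex in part \<open>i\<close> to such a complex multiplies the weight of a tuple by the \<open>n\<close>-th
  power of one function of the tuple, so counts are log-convex in the number of copies, and a count
  that behaves like \<open>\<rho>\<^sup>n\<close> for \<open>n = 0, 1, 2\<close> forces that function to be close to \<open>\<rho>\<close> in mean
  square.

  Starting from the counts that the THC condition gives for \<open>C 0\<close>, this passes counts from one
  level of the stack to the next: for a single type of edges the octahedron condition and
  log-convexity determine all counts, and several types are handled by averaging out one part after
  the other. No vertex is embedded, so neither links of THC graphs nor complexes with more than two
  vertices per part are needed.

  If \<open>x\<close> hits \<open>e\<close>, the edges of the link of \<open>v\<close> on \<open>e\<close> carry the weights of level \<open>l\<close> on the types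
  \<open>e\<close> and \<open>e \<union> {x}\<close>. The mean over \<open>v\<close> of the octahedron count of the link is at most its expected
  value, while for most \<open>v\<close> convexity bounds it from below by the edge density to the power
  \<open>2 ^ card e\<close>. Hence both are close to their expected values for most \<open>v\<close>, which is regularity of
  the link. If \<open>x\<close> does not hit \<open>e\<close>, taking the link only rescales all weights. At most \<open>\<Delta>\<^sup>2\<close> edges
  are hit by \<open>x\<close>.
\<close>

section \<open>Weighted moments\<close>

lemma weighted_cauchy_schwarz:
  fixes w f g :: "'t \<Rightarrow> real"
  assumes "\<And>t. t \<in> T \<Longrightarrow> 0 \<le> w t"
  shows "(\<Sum>t\<in>T. w t * (f t * g t))\<^sup>2 \<le> (\<Sum>t\<in>T. w t * (f t)\<^sup>2) * (\<Sum>t\<in>T. w t * (g t)\<^sup>2)"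
proof -
  have "(\<Sum>t\<in>T. w t * (f t * g t)) = (\<Sum>t\<in>T. (sqrt (w t) * f t) * (sqrt (w t) * g t))"
    by (intro sum.cong) (use assms in \<open>auto simp: algebra_simps\<close>)
  moreover have "(\<Sum>t\<in>T. w t * (f t)\<^sup>2) = (\<Sum>t\<in>T. (sqrt (w t) * f t)\<^sup>2)" for f
    by (intro sum.cong) (use assms in \<open>auto simp: power_mult_distrib\<close>)
  ultimately show ?thesis
    using Cauchy_Schwarz_ineq_sum[of "\<lambda>t. sqrt (w t) * f t" "\<lambda>t. sqrt (w t) * g t" T] by simp
qed

lemma second_moment_concentration:
  fixes w F :: "'t \<Rightarrow> real"
  assumes w: "\<And>t. t \<in> T \<Longrightarrow> 0 \<le> w t" and F: "\<And>t. t \<in> T \<Longrightarrow> 0 \<le> F t"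
    and par: "0 \<le> M" "0 \<le> \<rho>" "0 \<le> D" "D \<le> 1" "0 \<le> E" "E \<le> 1" "0 \<le> \<xi>" "\<xi> \<le> 1"
    and m0: "(\<Sum>t\<in>T. w t) \<le> (1 + \<xi>) * M"
    and m1: "(\<Sum>t\<in>T. w t * F t) \<ge> (D - E) * \<rho> * M"
    and m2: "(\<Sum>t\<in>T. w t * (F t)\<^sup>2) \<le> (D\<^sup>2 + E) * \<rho>\<^sup>2 * M"
    and n: "n = 1 \<or> n = 2"
  shows "(\<Sum>t\<in>T. w t * \<bar>F t ^ n - (D * \<rho>) ^ n\<bar>) \<le> 5 * sqrt (E + \<xi>) * \<rho> ^ n * M"
proof -
  define R where "R = D * \<rho>"
  have R: "0 \<le> R" "R \<le> \<rho>"
    using par by (auto simp: R_def mult_left_le_one_le)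
  have dev: "(\<Sum>t\<in>T. w t * (F t - R)\<^sup>2) \<le> (3 * E + \<xi>) * \<rho>\<^sup>2 * M"
  proof -
    have "(\<Sum>t\<in>T. w t * (F t - R)\<^sup>2) =
       (\<Sum>t\<in>T. w t * (F t)\<^sup>2) - 2 * R * (\<Sum>t\<in>T. w t * F t) + R\<^sup>2 * (\<Sum>t\<in>T. w t)"
      by (simp add: power2_eq_square algebra_simps sum.distrib sum_distrib_left sum_subtractf)
    also have "\<dots> \<le> (D\<^sup>2 + E) * \<rho>\<^sup>2 * M - 2 * R * ((D - E) * \<rho> * M) + R\<^sup>2 * ((1 + \<xi>) * M)"
      using m0 m1 m2 R by (intro add_mono diff_mono mult_left_mono) auto
    also have "\<dots> = (E + 2 * D * E + D\<^sup>2 * \<xi>) * \<rho>\<^sup>2 * M"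
      by (simp add: R_def power2_eq_square algebra_simps)
    also have "\<dots> \<le> (E + 2 * 1 * E + 1 * \<xi>) * \<rho>\<^sup>2 * M"
      using par by (intro mult_right_mono add_mono) (auto simp: mult_left_le_one_le power_le_one)
    finally show ?thesis by (simp add: algebra_simps)
  qed
  define G where "G t = (if n = 1 then 1 else F t + R)" for t
  have fac: "\<bar>F t ^ n - R ^ n\<bar> = \<bar>F t - R\<bar> * G t" if "t \<in> T" for t
  proof -
    have "(F t)\<^sup>2 - R\<^sup>2 = (F t - R) * (F t + R)"
      by (simp add: power2_eq_square algebra_simps)
    then show ?thesis
      using n F[OF that] R by (auto simp: G_def abs_mult)
  qed
  have G2: "(\<Sum>t\<in>T. w t * (G t)\<^sup>2) \<le> 8 * (\<rho> ^ (n - 1))\<^sup>2 * M"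
  proof (cases "n = 1")
    case True
    have "(\<Sum>t\<in>T. w t) \<le> 2 * M"
      using m0 mult_right_mono[of "1 + \<xi>" 2 M] par by linarith
    then show ?thesis using True par by (simp add: G_def)
  next
    case False
    then have n2: "n = 2" using n by auto
    have "(\<Sum>t\<in>T. w t * (G t)\<^sup>2) \<le> (\<Sum>t\<in>T. 2 * (w t * (F t)\<^sup>2) + 2 * R\<^sup>2 * w t)"
    proof (rule sum_mono)
      fix t assume t: "t \<in> T"
      have "(F t + R)\<^sup>2 \<le> 2 * (F t)\<^sup>2 + 2 * R\<^sup>2"
        using sum_squares_bound[of "F t" R] by (simp add: power2_sum)
      from mult_left_mono[OF this w[OF t]] False
      show "w t * (G t)\<^sup>2 \<le> 2 * (w t * (F t)\<^sup>2) + 2 * R\<^sup>2 * w t"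
        by (simp add: G_def algebra_simps)
    qed
    also have "\<dots> = 2 * (\<Sum>t\<in>T. w t * (F t)\<^sup>2) + 2 * R\<^sup>2 * (\<Sum>t\<in>T. w t)"
      by (simp add: sum.distrib sum_distrib_left)
    also have "\<dots> \<le> 2 * ((D\<^sup>2 + E) * \<rho>\<^sup>2 * M) + 2 * R\<^sup>2 * ((1 + \<xi>) * M)"
      using m0 m2 by (intro add_mono mult_left_mono) auto
    also have "\<dots> = (2 * D\<^sup>2 + 2 * E + 2 * D\<^sup>2 * (1 + \<xi>)) * (\<rho>\<^sup>2 * M)"
      by (simp add: R_def power2_eq_square algebra_simps)
    also have "\<dots> \<le> (2 * 1 + 2 * 1 + 2 * 1 * (1 + 1)) * (\<rho>\<^sup>2 * M)"
      using par by (intro mult_right_mono add_mono mult_mono) (auto simp: power_le_one)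
    finally show ?thesis using n2 by simp
  qed
  have "(\<Sum>t\<in>T. w t * \<bar>F t ^ n - R ^ n\<bar>)\<^sup>2 = (\<Sum>t\<in>T. w t * (\<bar>F t - R\<bar> * G t))\<^sup>2"
    using fac by simp
  also have "\<dots> \<le> (\<Sum>t\<in>T. w t * \<bar>F t - R\<bar>\<^sup>2) * (\<Sum>t\<in>T. w t * (G t)\<^sup>2)"
    by (rule weighted_cauchy_schwarz) (use w in auto)
  also have "\<dots> \<le> ((3 * E + \<xi>) * \<rho>\<^sup>2 * M) * (8 * (\<rho> ^ (n - 1))\<^sup>2 * M)"
    using dev G2 w par by (intro mult_mono) (auto intro!: sum_nonneg)
  also have "\<dots> = 8 * (3 * E + \<xi>) * (\<rho> ^ n * M)\<^sup>2"
    using n by (auto simp: power2_eq_square algebra_simps)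
  also have "\<dots> \<le> 25 * (E + \<xi>) * (\<rho> ^ n * M)\<^sup>2"
    using par by (intro mult_right_mono) auto
  also have "\<dots> = (5 * sqrt (E + \<xi>) * \<rho> ^ n * M)\<^sup>2"
    using par by (simp add: power_mult_distrib)
  finally show ?thesis
    unfolding R_def[symmetric] by (rule power2_le_imp_le) (use par in auto)
qed

lemma log_convex_concentration:
  fixes X0 X1 X2 :: "'t \<Rightarrow> real"
  assumes nn: "\<And>t. t \<in> T \<Longrightarrow> 0 \<le> X0 t \<and> 0 \<le> X1 t \<and> 0 \<le> X2 t"
    and lc: "\<And>t. t \<in> T \<Longrightarrow> (X1 t)\<^sup>2 \<le> X0 t * X2 t"
    and par: "0 \<le> M" "0 \<le> \<rho>" "0 \<le> \<xi>" "\<xi> \<le> 1"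
    and m0: "\<bar>(\<Sum>t\<in>T. X0 t) - M\<bar> \<le> \<xi> * M"
    and m1: "\<bar>(\<Sum>t\<in>T. X1 t) - \<rho> * M\<bar> \<le> \<xi> * (\<rho> * M)"
    and m2: "\<bar>(\<Sum>t\<in>T. X2 t) - \<rho>\<^sup>2 * M\<bar> \<le> \<xi> * (\<rho>\<^sup>2 * M)"
  shows "(\<Sum>t\<in>T. \<bar>X1 t - \<rho> * X0 t\<bar>) \<le> 20 * sqrt \<xi> * \<rho> * M"
    and "(\<Sum>t\<in>T. \<bar>X2 t - \<rho>\<^sup>2 * X0 t\<bar>) \<le> 20 * sqrt \<xi> * \<rho>\<^sup>2 * M"
proof -
  define F where "F t = X1 t / X0 t" for t
  have F1: "X0 t * F t = X1 t" and F2: "X0 t * (F t)\<^sup>2 \<le> X2 t" and F0: "0 \<le> F t" if "t \<in> T" for t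
  proof -
    show "X0 t * F t = X1 t"
      using lc[OF that] by (auto simp: F_def)
    show "X0 t * (F t)\<^sup>2 \<le> X2 t"
      using lc[OF that] nn[OF that] by (auto simp: F_def power_divide power2_eq_square field_simps)
    show "0 \<le> F t" using nn[OF that] by (simp add: F_def)
  qed
  have conc: "(\<Sum>t\<in>T. X0 t * \<bar>F t ^ n - (1 * \<rho>) ^ n\<bar>) \<le> 5 * sqrt (\<xi> + \<xi>) * \<rho> ^ n * M"
    if "n = 1 \<or> n = 2" for n
  proof (rule second_moment_concentration)
    show "(\<Sum>t\<in>T. X0 t) \<le> (1 + \<xi>) * M" using m0 by (simp add: algebra_simps)
    show "(\<Sum>t\<in>T. X0 t * F t) \<ge> (1 - \<xi>) * \<rho> * M"
    proof -
      have "(\<Sum>t\<in>T. X0 t * F t) = (\<Sum>t\<in>T. X1 t)" by (intro sum.cong refl F1)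
      then show ?thesis using m1 by (simp add: algebra_simps)
    qed
    have "(\<Sum>t\<in>T. X0 t * (F t)\<^sup>2) \<le> (\<Sum>t\<in>T. X2 t)"
      by (intro sum_mono F2)
    then show "(\<Sum>t\<in>T. X0 t * (F t)\<^sup>2) \<le> (1\<^sup>2 + \<xi>) * \<rho>\<^sup>2 * M"
      using m2 by (simp add: algebra_simps)
  qed (use nn F0 par that in auto)
  have s2: "sqrt (\<xi> + \<xi>) \<le> 3/2 * sqrt \<xi>"
    by (rule real_le_lsqrt) (use par in \<open>auto simp: power_mult_distrib power2_eq_square\<close>)
  have xs: "\<xi> \<le> sqrt \<xi>"
    using par by (intro real_le_rsqrt) (auto simp: power2_eq_square mult_left_le)
  have A: "(\<Sum>t\<in>T. X0 t * \<bar>F t ^ n - \<rho> ^ n\<bar>) \<le> 15/2 * sqrt \<xi> * (\<rho> ^ n * M)" if "n = 1 \<or> n = 2" for n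
  proof -
    have "5 * sqrt (\<xi> + \<xi>) * (\<rho> ^ n * M) \<le> 5 * (3/2 * sqrt \<xi>) * (\<rho> ^ n * M)"
      using s2 par by (intro mult_right_mono) auto
    with conc[OF that] show ?thesis by (simp add: algebra_simps)
  qed
  have "\<bar>X1 t - \<rho> * X0 t\<bar> = X0 t * \<bar>F t ^ 1 - \<rho> ^ 1\<bar>" if "t \<in> T" for t
  proof -
    have "X1 t - \<rho> * X0 t = X0 t * (F t - \<rho>)" using F1[OF that] by (simp add: algebra_simps)
    then show ?thesis using nn[OF that] by (simp add: abs_mult)
  qed
  then have "(\<Sum>t\<in>T. \<bar>X1 t - \<rho> * X0 t\<bar>) \<le> 15/2 * sqrt \<xi> * (\<rho> * M)"
    using A[of 1] by simp
  also have "\<dots> \<le> 20 * sqrt \<xi> * (\<rho> * M)" using par by (intro mult_right_mono) auto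
  finally show "(\<Sum>t\<in>T. \<bar>X1 t - \<rho> * X0 t\<bar>) \<le> 20 * sqrt \<xi> * \<rho> * M" by (simp add: algebra_simps)
  have B: "\<bar>X2 t - \<rho>\<^sup>2 * X0 t\<bar> \<le> X2 t - \<rho>\<^sup>2 * X0 t + 2 * (X0 t * \<bar>(F t)\<^sup>2 - \<rho>\<^sup>2\<bar>)" if "t \<in> T" for t
  proof -
    have "X0 t * \<bar>(F t)\<^sup>2 - \<rho>\<^sup>2\<bar> = \<bar>X0 t * (F t)\<^sup>2 - \<rho>\<^sup>2 * X0 t\<bar>"
    proof -
      have "X0 t * (F t)\<^sup>2 - \<rho>\<^sup>2 * X0 t = X0 t * ((F t)\<^sup>2 - \<rho>\<^sup>2)" by (simp add: algebra_simps)
      then show ?thesis using nn[OF that] by (simp add: abs_mult)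
    qed
    then show ?thesis using F2[OF that] by linarith
  qed
  have "(\<Sum>t\<in>T. \<bar>X2 t - \<rho>\<^sup>2 * X0 t\<bar>) \<le> (\<Sum>t\<in>T. X2 t) - \<rho>\<^sup>2 * (\<Sum>t\<in>T. X0 t) + 2 * (\<Sum>t\<in>T. X0 t * \<bar>(F t)\<^sup>2 - \<rho>\<^sup>2\<bar>)"
    using sum_mono[OF B] by (simp add: sum.distrib sum_subtractf sum_distrib_left)
  also have "\<dots> \<le> (\<rho>\<^sup>2 * M + \<xi> * (\<rho>\<^sup>2 * M)) - \<rho>\<^sup>2 * (M - \<xi> * M) + 2 * (15/2 * sqrt \<xi> * (\<rho>\<^sup>2 * M))"
    using m0 m2 A[of 2] by (intro add_mono diff_mono mult_left_mono) auto
  also have "\<dots> = (2 * \<xi> + 15 * sqrt \<xi>) * (\<rho>\<^sup>2 * M)" by (simp add: algebra_simps)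
  also have "\<dots> \<le> (20 * sqrt \<xi>) * (\<rho>\<^sup>2 * M)"
    using xs par by (intro mult_right_mono) (auto intro: add_mono)
  finally show "(\<Sum>t\<in>T. \<bar>X2 t - \<rho>\<^sup>2 * X0 t\<bar>) \<le> 20 * sqrt \<xi> * \<rho>\<^sup>2 * M" by (simp add: algebra_simps)
qed

section \<open>Counts of full partite complexes\<close>

text \<open>A vertex of a partite complex is a position \<open>(j, s)\<close>, the \<open>s\<close>-th vertex in part \<open>j\<close>. The edges of
  the full complex on a set of positions are its \<open>faces\<close>.\<close>

definition faces :: "('j \<times> nat) set \<Rightarrow> ('j \<times> nat) set set" where
  "faces X = {e. e \<subseteq> X \<and> inj_on fst e}"

definition tuples :: "('j \<Rightarrow> 'v set) \<Rightarrow> ('j \<times> nat) set \<Rightarrow> ('j \<times> nat \<Rightarrow> 'v) set" where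
  "tuples V X = (\<Pi>\<^sub>E z\<in>X. V (fst z))"

definition weight :: "('v set \<Rightarrow> real) \<Rightarrow> ('j \<times> nat) set \<Rightarrow> ('j \<times> nat \<Rightarrow> 'v) \<Rightarrow> real" where
  "weight h X t = (\<Prod>e\<in>faces X. h (t ` e))"

definition cnt :: "('j \<Rightarrow> 'v set) \<Rightarrow> ('v set \<Rightarrow> real) \<Rightarrow> ('j \<times> nat) set \<Rightarrow> real" where
  "cnt V h X = (\<Sum>t\<in>tuples V X. weight h X t) / real (card (tuples V X))"

definition positions :: "'j set \<Rightarrow> ('j \<Rightarrow> nat) \<Rightarrow> ('j \<times> nat) set" where
  "positions J a = (SIGMA j:J. {..<a j})"

definition extension :: "('v set \<Rightarrow> real) \<Rightarrow> ('j \<times> nat) set \<Rightarrow> ('j \<times> nat \<Rightarrow> 'v) \<Rightarrow> 'v \<Rightarrow> real" where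
  "extension h X t v = (\<Prod>e\<in>faces X. h (insert v (t ` e)))"

definition fibre :: "('j \<Rightarrow> 'v set) \<Rightarrow> ('v set \<Rightarrow> real) \<Rightarrow> ('j \<times> nat) set \<Rightarrow> 'j \<Rightarrow> ('j \<times> nat \<Rightarrow> 'v) \<Rightarrow> real" where
  "fibre V h X i t = (\<Sum>v\<in>V i. extension h X t v) / real (card (V i))"

lemma hom_density_full_partite:
  "hom_density V h fst (full_partite J a) = cnt V h (positions J a)"
  by (simp add: hom_density_def full_partite_def cnt_def weight_def tuples_def positions_def faces_def)

lemma finite_faces: "finite X \<Longrightarrow> finite (faces X)"
  unfolding faces_def by (rule finite_subset[of _ "Pow X"]) auto

lemma faces_insert:
  "faces (insert y X) = faces X \<union> insert y ` faces {z \<in> X. fst z \<noteq> fst y}"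
proof (intro set_eqI iffI)
  fix e assume e: "e \<in> faces (insert y X)"
  show "e \<in> faces X \<union> insert y ` faces {z \<in> X. fst z \<noteq> fst y}"
  proof (cases "y \<in> e")
    case True
    have "fst z \<noteq> fst y" if "z \<in> e - {y}" for z
      using e True that unfolding faces_def by (auto dest: inj_onD)
    then have "e - {y} \<in> faces {z \<in> X. fst z \<noteq> fst y}"
      using e by (auto simp: faces_def intro: inj_on_subset)
    moreover have "e = insert y (e - {y})" using True by auto
    ultimately show ?thesis by blast
  next
    case False
    then show ?thesis using e by (auto simp: faces_def)
  qed
next
  fix e assume "e \<in> faces X \<union> insert y ` faces {z \<in> X. fst z \<noteq> fst y}"
  then show "e \<in> faces (insert y X)"
    by (auto simp: faces_def)
qed

lemma weight_insert:
  assumes "finite X" "y \<notin> X"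
  shows "weight h (insert y X) (t(y := v)) = weight h X t * extension h {z \<in> X. fst z \<noteq> fst y} t v"
proof -
  let ?Y = "{z \<in> X. fst z \<noteq> fst y}"
  have img: "(t(y := v)) ` e = t ` e" if "e \<subseteq> X" for e
    using that assms by (intro image_cong) auto
  have disj: "faces X \<inter> insert y ` faces ?Y = {}"
    using assms by (auto simp: faces_def)
  have inj: "inj_on (insert y) (faces ?Y)"
    using assms by (intro inj_onI) (auto simp: faces_def)
  have "weight h (insert y X) (t(y := v)) =
      (\<Prod>e\<in>faces X. h ((t(y := v)) ` e)) * (\<Prod>e\<in>insert y ` faces ?Y. h ((t(y := v)) ` e))"
    unfolding weight_def faces_insert
    by (intro prod.union_disjoint disj finite_imageI finite_faces) (use assms in auto)
  also have "(\<Prod>e\<in>faces X. h ((t(y := v)) ` e)) = weight h X t"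
    unfolding weight_def by (intro prod.cong) (auto simp: faces_def img simp del: fun_upd_apply)
  also have "(\<Prod>e\<in>insert y ` faces ?Y. h ((t(y := v)) ` e)) = (\<Prod>e\<in>faces ?Y. h ((t(y := v)) ` insert y e))"
    using inj by (simp add: prod.reindex)
  also have "\<dots> = extension h ?Y t v"
    unfolding extension_def
  proof (intro prod.cong refl)
    fix e assume "e \<in> faces ?Y"
    then have "e \<subseteq> X" by (auto simp: faces_def)
    then show "h ((t(y := v)) ` insert y e) = h (insert v (t ` e))"
      using img[of e] by (simp add: image_insert del: fun_upd_apply) simp
  qed
  finally show ?thesis .
qed

lemma sum_tuples_insert:
  assumes "y \<notin> X"
  shows "(\<Sum>\<psi>\<in>tuples V (insert y X). f \<psi>) = (\<Sum>t\<in>tuples V X. \<Sum>v\<in>V (fst y). f (t(y := v)))"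
proof -
  have "tuples V (insert y X) = (\<lambda>(v, t). t(y := v)) ` (V (fst y) \<times> tuples V X)"
    by (simp add: tuples_def PiE_insert_eq)
  moreover have "inj_on (\<lambda>(v, t). t(y := v)) (V (fst y) \<times> tuples V X)"
    unfolding tuples_def by (rule inj_combinator) (use assms in auto)
  ultimately have "(\<Sum>\<psi>\<in>tuples V (insert y X). f \<psi>) = (\<Sum>(v, t)\<in>V (fst y) \<times> tuples V X. f (t(y := v)))"
    by (simp add: sum.reindex case_prod_unfold)
  also have "\<dots> = (\<Sum>v\<in>V (fst y). \<Sum>t\<in>tuples V X. f (t(y := v)))"
    by (simp add: sum.cartesian_product)
  finally show ?thesis by (simp add: sum.swap[of _ "tuples V X"])
qed

lemma card_tuples_insert:
  assumes "finite X" "y \<notin> X"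
  shows "card (tuples V (insert y X)) = card (V (fst y)) * card (tuples V X)"
  using assms by (simp add: tuples_def card_PiE)

lemma extension_upd:
  assumes "y \<notin> X"
  shows "extension h X (t(y := u)) v = extension h X t v"
  unfolding extension_def
proof (intro prod.cong refl)
  fix e assume "e \<in> faces X"
  then have "(t(y := u)) ` e = t ` e"
    using assms by (intro image_cong) (auto simp: faces_def)
  then show "h (insert v ((t(y := u)) ` e)) = h (insert v (t ` e))" by simp
qed

lemma count_copies_aux:
  assumes "finite X" "i \<notin> fst ` X"
  shows "(\<Sum>\<psi>\<in>tuples V (X \<union> {i} \<times> {..<n}). weight h (X \<union> {i} \<times> {..<n}) \<psi> * fibre V h X i \<psi> ^ m)
           / real (card (tuples V (X \<union> {i} \<times> {..<n})))
       = (\<Sum>t\<in>tuples V X. weight h X t * fibre V h X i t ^ (n + m)) / real (card (tuples V X))"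
proof (induction n arbitrary: m)
  case 0
  then show ?case by simp
next
  case (Suc n)
  let ?Y = "X \<union> {i} \<times> {..<n}"
  have ins: "X \<union> {i} \<times> {..<Suc n} = insert (i, n) ?Y" by auto
  have notin: "(i, n) \<notin> ?Y" "(i, n) \<notin> X" using assms by force+
  have fin: "finite ?Y" using assms by auto
  have part: "{z \<in> ?Y. fst z \<noteq> fst (i, n)} = X" using assms by force
  have "(\<Sum>\<psi>\<in>tuples V (insert (i, n) ?Y). weight h (insert (i, n) ?Y) \<psi> * fibre V h X i \<psi> ^ m)
      = (\<Sum>t\<in>tuples V ?Y. \<Sum>v\<in>V i. weight h ?Y t * extension h X t v * fibre V h X i t ^ m)"
    using notin fin part
    by (simp add: sum_tuples_insert weight_insert fibre_def extension_upd del: fun_upd_apply Un_insert_left)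
  also have "\<dots> = (\<Sum>t\<in>tuples V ?Y. weight h ?Y t * fibre V h X i t ^ m * (\<Sum>v\<in>V i. extension h X t v))"
    by (simp add: sum_distrib_left sum_distrib_right mult_ac)
  finally have *: "(\<Sum>\<psi>\<in>tuples V (insert (i, n) ?Y). weight h (insert (i, n) ?Y) \<psi> * fibre V h X i \<psi> ^ m)
      = (\<Sum>t\<in>tuples V ?Y. weight h ?Y t * fibre V h X i t ^ m * (\<Sum>v\<in>V i. extension h X t v))" .
  have "(\<Sum>\<psi>\<in>tuples V (insert (i, n) ?Y). weight h (insert (i, n) ?Y) \<psi> * fibre V h X i \<psi> ^ m)
          / real (card (tuples V (insert (i, n) ?Y)))
      = (\<Sum>t\<in>tuples V ?Y. weight h ?Y t * fibre V h X i t ^ Suc m) / real (card (tuples V ?Y))"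
  proof -
    have "weight h ?Y t * fibre V h X i t ^ Suc m
        = weight h ?Y t * fibre V h X i t ^ m * (\<Sum>v\<in>V i. extension h X t v) / real (card (V i))" for t
      by (simp add: fibre_def)
    then show ?thesis
      unfolding * using notin fin by (simp add: card_tuples_insert sum_divide_distrib)
  qed
  then show ?case
    using Suc.IH[of "Suc m"] unfolding ins by simp
qed

lemma count_copies:
  assumes "finite X" "i \<notin> fst ` X"
  shows "cnt V h (X \<union> {i} \<times> {..<n})
       = (\<Sum>t\<in>tuples V X. weight h X t / real (card (tuples V X)) * fibre V h X i t ^ n)"
  using count_copies_aux[OF assms, where n = n and m = 0] by (simp add: cnt_def sum_divide_distrib)

lemma positions_upd:
  "i \<in> J \<Longrightarrow> positions J (b(i := n)) = positions J (b(i := 0)) \<union> {i} \<times> {..<n}"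
  unfolding positions_def by (intro set_eqI) (auto split: if_splits)

lemma part_notin_positions: "i \<notin> fst ` positions J (b(i := 0))"
  unfolding positions_def by force

lemma fst_positions: "fst ` positions J a \<subseteq> J"
  by (auto simp: positions_def)

lemma finite_positions: "finite J \<Longrightarrow> finite (positions J a)"
  by (simp add: positions_def)

lemma count_positions_upd:
  fixes b :: "'j \<Rightarrow> nat"
  assumes "finite J" "i \<in> J"
  defines "X \<equiv> positions J (b(i := 0))"
  shows "cnt V h (positions J (b(i := n)))
       = (\<Sum>t\<in>tuples V X. weight h X t / real (card (tuples V X)) * fibre V h X i t ^ n)"
  unfolding X_def
  by (subst positions_upd[OF assms(2)], rule count_copies)
    (use assms(1) in \<open>auto intro: finite_positions simp: part_notin_positions\<close>)

locale parts =
  fixes J :: "'j set" and V :: "'j \<Rightarrow> 'v set"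
  assumes finJ: "finite J"
    and finV: "\<And>j. j \<in> J \<Longrightarrow> finite (V j)"
    and neV: "\<And>j. j \<in> J \<Longrightarrow> V j \<noteq> {}"
    and disjV: "disjoint_family_on V J"
begin

lemma card_V_pos: "j \<in> J \<Longrightarrow> 0 < card (V j)"
  using finV neV by (simp add: card_gt_0_iff)

lemma V_unique: "v \<in> V i \<Longrightarrow> v \<in> V j \<Longrightarrow> i \<in> J \<Longrightarrow> j \<in> J \<Longrightarrow> i = j"
  using disjV by (auto simp: disjoint_family_on_def)

lemma tuple_mem: "t \<in> tuples V X \<Longrightarrow> z \<in> X \<Longrightarrow> t z \<in> V (fst z)"
  by (auto simp: tuples_def)

definition type_of :: "'v set \<Rightarrow> 'j set" where
  "type_of u = {j \<in> J. u \<inter> V j \<noteq> {}}"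

lemma type_of_image:
  assumes "t \<in> tuples V X" "fst ` X \<subseteq> J" "e \<subseteq> X"
  shows "type_of (t ` e) = fst ` e"
proof (intro set_eqI iffI)
  fix j assume "j \<in> type_of (t ` e)"
  then obtain z where z: "z \<in> e" "t z \<in> V j" "j \<in> J" by (auto simp: type_of_def)
  have "t z \<in> V (fst z)" using assms z by (auto intro: tuple_mem)
  then have "j = fst z" using V_unique[OF z(2) _ z(3)] assms z by blast
  then show "j \<in> fst ` e" using z by auto
next
  fix j assume "j \<in> fst ` e"
  then obtain z where z: "z \<in> e" "j = fst z" by auto
  then have "t z \<in> V j" "j \<in> J" using assms by (auto intro: tuple_mem)
  then show "j \<in> type_of (t ` e)" using z by (auto simp: type_of_def)
qed

lemma type_of_insert:
  assumes "v \<in> V i" "i \<in> J"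
  shows "type_of (insert v u) = insert i (type_of u)"
  using assms V_unique by (auto simp: type_of_def)

lemma image_crossing:
  assumes "finite X" "t \<in> tuples V X" "fst ` X \<subseteq> J" "e \<in> faces X"
  shows "t ` e \<in> crossing J V"
proof -
  have e: "e \<subseteq> X" "inj_on fst e" "finite e"
    using assms finite_subset by (auto simp: faces_def)
  have "card (t ` e \<inter> V j) \<le> 1" if "j \<in> J" for j
  proof -
    have "z = z'" if "z \<in> e" "z' \<in> e" "t z \<in> V j" "t z' \<in> V j" for z z'
    proof -
      have "fst z = j" "fst z' = j"
        using V_unique[OF that(3) tuple_mem[OF assms(2)] \<open>j \<in> J\<close>] V_unique[OF that(4) tuple_mem[OF assms(2)] \<open>j \<in> J\<close>]
          that e assms(3) by (metis image_subset_iff subsetD)+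
      then show ?thesis using e(2) that by (auto dest: inj_onD)
    qed
    then have "\<exists>w. t ` e \<inter> V j \<subseteq> {w}" by blast
    then show ?thesis by (metis card.empty card_mono finite.emptyI finite.insertI is_singletonI is_singleton_altdef)
  qed
  moreover have "t ` e \<subseteq> (\<Union>j\<in>J. V j)"
    using e(1) assms(3) tuple_mem[OF assms(2)] by blast
  ultimately show ?thesis using e by (auto simp: crossing_def)
qed

lemma insert_crossing:
  assumes "finite X" "t \<in> tuples V X" "fst ` X \<subseteq> J" "e \<in> faces X" "i \<in> J" "i \<notin> fst ` X" "v \<in> V i"
  shows "insert v (t ` e) \<in> crossing J V"
proof -
  let ?y = "(i, 0::nat)"
  have y: "?y \<notin> X" using assms by force
  have e: "e \<subseteq> X" using assms by (auto simp: faces_def)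
  have "t(?y := v) \<in> tuples V (insert ?y X)"
    using assms by (simp add: tuples_def PiE_fun_upd)
  moreover have "insert ?y e \<in> faces (insert ?y X)"
    using assms by (auto simp: faces_def inj_on_def)
  ultimately have "(t(?y := v)) ` insert ?y e \<in> crossing J V"
    using assms by (intro image_crossing[of "insert ?y X"]) auto
  moreover have "(t(?y := v)) ` insert ?y e = insert v (t ` e)"
    using y e by auto
  ultimately show ?thesis by simp
qed

lemma weight_nonneg:
  assumes "\<And>u. u \<in> crossing J V \<Longrightarrow> 0 \<le> h u" "finite X" "fst ` X \<subseteq> J" "t \<in> tuples V X"
  shows "0 \<le> weight h X t"
  unfolding weight_def using assms image_crossing by (intro prod_nonneg) blast

lemma fibre_nonneg:
  assumes "\<And>u. u \<in> crossing J V \<Longrightarrow> 0 \<le> h u" "finite X" "fst ` X \<subseteq> J" "t \<in> tuples V X" "i \<in> J" "i \<notin> fst ` X"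
  shows "0 \<le> fibre V h X i t"
  unfolding fibre_def extension_def
  using assms insert_crossing by (intro divide_nonneg_nonneg sum_nonneg prod_nonneg) auto

lemma count_nonneg:
  assumes "\<And>u. u \<in> crossing J V \<Longrightarrow> 0 \<le> h u" "finite X" "fst ` X \<subseteq> J"
  shows "0 \<le> cnt V h X"
  unfolding cnt_def using weight_nonneg[OF assms] by (simp add: sum_nonneg)

lemma count_mono:
  assumes "\<And>u. u \<in> crossing J V \<Longrightarrow> 0 \<le> h u \<and> h u \<le> h' u" "finite X" "fst ` X \<subseteq> J"
  shows "cnt V h X \<le> cnt V h' X"
  unfolding cnt_def weight_def
  using assms image_crossing by (intro divide_right_mono sum_mono prod_mono) auto

lemma count_log_convex:
  assumes "\<And>u. u \<in> crossing J V \<Longrightarrow> 0 \<le> h u" "i \<in> J"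
  shows "(cnt V h (positions J (b(i := 1))))\<^sup>2
       \<le> cnt V h (positions J (b(i := 0))) * cnt V h (positions J (b(i := 2)))"
proof -
  let ?X = "positions J (b(i := 0))"
  have X: "finite ?X" "fst ` ?X \<subseteq> J" "i \<notin> fst ` ?X"
    using finJ by (auto intro: finite_positions fst_positions part_notin_positions simp: positions_def)
  have "(\<Sum>t\<in>tuples V ?X. weight h ?X t / real (card (tuples V ?X)) * (1 * fibre V h ?X i t))\<^sup>2
      \<le> (\<Sum>t\<in>tuples V ?X. weight h ?X t / real (card (tuples V ?X)) * 1\<^sup>2) *
        (\<Sum>t\<in>tuples V ?X. weight h ?X t / real (card (tuples V ?X)) * (fibre V h ?X i t)\<^sup>2)"
    by (rule weighted_cauchy_schwarz) (use weight_nonneg[OF assms(1) X(1,2)] in auto)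
  then show ?thesis
    unfolding count_positions_upd[OF finJ assms(2)] by simp
qed

end

section \<open>Counts relative to a multiplicative model\<close>

definition mon :: "('j \<Rightarrow> nat) \<Rightarrow> 'j set \<Rightarrow> nat" where
  "mon a f = (\<Prod>i\<in>f. a i)"

definition dens_prod :: "('j set \<Rightarrow> real) \<Rightarrow> 'j set set \<Rightarrow> ('j \<Rightarrow> nat) \<Rightarrow> real" where
  "dens_prod d U a = (\<Prod>f\<in>U. d f ^ mon a f)"

lemma mon_upd_in: "finite f \<Longrightarrow> i \<in> f \<Longrightarrow> mon (b(i := n)) f = n * mon (b(i := 1)) f"
  by (simp add: mon_def prod.remove[of f i])

lemma mon_upd_notin: "i \<notin> f \<Longrightarrow> mon (b(i := n)) f = mon b f"
  unfolding mon_def by (intro prod.cong) auto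

lemma mon_zero: "finite f \<Longrightarrow> i \<in> f \<Longrightarrow> a i = 0 \<Longrightarrow> mon a f = 0"
  by (auto simp: mon_def)

lemma dens_prod_upd:
  assumes "finite U" "\<And>f. f \<in> U \<Longrightarrow> finite f"
  shows "dens_prod d U (b(i := n)) =
     dens_prod d {f \<in> U. i \<in> f} (b(i := 1)) ^ n * dens_prod d {f \<in> U. i \<notin> f} b"
proof -
  have "dens_prod d U (b(i := n)) =
      dens_prod d {f \<in> U. i \<in> f} (b(i := n)) * dens_prod d {f \<in> U. i \<notin> f} (b(i := n))"
    unfolding dens_prod_def using assms
    by (subst prod.union_disjoint[symmetric]) (auto intro!: prod.cong)
  also have "dens_prod d {f \<in> U. i \<in> f} (b(i := n)) = dens_prod d {f \<in> U. i \<in> f} (b(i := 1)) ^ n"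
    unfolding dens_prod_def prod_power_distrib using assms
    by (intro prod.cong refl) (auto simp: mon_upd_in[of _ i b n] power_mult[symmetric] mult.commute)
  also have "dens_prod d {f \<in> U. i \<notin> f} (b(i := n)) = dens_prod d {f \<in> U. i \<notin> f} b"
    unfolding dens_prod_def by (intro prod.cong) (auto simp: mon_upd_notin)
  finally show ?thesis .
qed

lemma dens_prod_bounds:
  assumes "\<And>f. f \<in> U \<Longrightarrow> 0 \<le> d f \<and> d f \<le> 1"
  shows "0 \<le> dens_prod d U a" "dens_prod d U a \<le> 1"
  unfolding dens_prod_def using assms by (auto intro!: prod_nonneg prod_le_1 power_le_one)

locale modelled = parts J V for J :: "'j set" and V :: "'j \<Rightarrow> 'v set" +
  fixes \<kappa> :: real and p :: "'j set \<Rightarrow> real"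
  assumes kappa_pos: "0 < \<kappa>" and p_pos: "\<And>f. f \<subseteq> J \<Longrightarrow> f \<noteq> {} \<Longrightarrow> 0 < p f"
begin

definition types :: "'j set set" where "types = Pow J - {{}}"

definition model :: "('j \<Rightarrow> nat) \<Rightarrow> real" where
  "model a = \<kappa> * dens_prod p types a"

definition nrm :: "('v set \<Rightarrow> real) \<Rightarrow> ('j \<Rightarrow> nat) \<Rightarrow> real" where
  "nrm h a = cnt V h (positions J a) / model a"

lemma finite_types: "finite types" "f \<in> types \<Longrightarrow> finite f"
  using finJ by (auto simp: types_def intro: finite_subset)

lemma model_pos: "0 < model a"
  unfolding model_def dens_prod_def
  by (intro mult_pos_pos kappa_pos prod_pos ballI zero_less_power p_pos) (auto simp: types_def)

definition slope :: "'j \<Rightarrow> ('j \<Rightarrow> nat) \<Rightarrow> real" where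
  "slope i b = dens_prod p {f \<in> types. i \<in> f} (b(i := 1))"

lemma slope_pos: "0 < slope i b"
  unfolding slope_def dens_prod_def
  by (intro prod_pos ballI zero_less_power p_pos) (auto simp: types_def)

lemma model_upd: "model (b(i := n)) = slope i b ^ n * model (b(i := 0))"
  unfolding model_def using dens_prod_upd[OF finite_types(1), of p b i]
  by (simp add: finite_types slope_def)

lemma nrm_nonneg: "(\<And>u. u \<in> crossing J V \<Longrightarrow> 0 \<le> h u) \<Longrightarrow> 0 \<le> nrm h a"
  unfolding nrm_def using model_pos[of a] finJ
  by (intro divide_nonneg_pos count_nonneg) (auto simp: finite_positions positions_def)

lemma nrm_log_convex:
  assumes "\<And>u. u \<in> crossing J V \<Longrightarrow> 0 \<le> h u" "i \<in> J"
  shows "(nrm h (b(i := 1)))\<^sup>2 \<le> nrm h (b(i := 0)) * nrm h (b(i := 2))"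
proof -
  let ?m = "model (b(i := 0))" and ?s = "slope i b"
  have "(nrm h (b(i := 1)))\<^sup>2 = (cnt V h (positions J (b(i := 1))))\<^sup>2 / (?s * ?m)\<^sup>2"
    by (simp only: nrm_def model_upd[of b i 1] power_divide power_one_right)
  also have "\<dots> \<le> (cnt V h (positions J (b(i := 0))) * cnt V h (positions J (b(i := 2)))) / (?s * ?m)\<^sup>2"
    by (rule divide_right_mono[OF count_log_convex[OF assms] zero_le_power2])
  also have "\<dots> = nrm h (b(i := 0)) * nrm h (b(i := 2))"
    by (simp add: nrm_def model_upd[of b i 2] power2_eq_square)
  finally show ?thesis .
qed

lemma nrm_doubling:
  assumes h: "\<And>u. u \<in> crossing J V \<Longrightarrow> 0 \<le> h u" and \<tau>: "0 \<le> \<tau>"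
    and S: "S \<subseteq> J" "\<And>i. i \<in> S \<Longrightarrow> a i = 1" and a2: "\<And>i. a i \<le> 2"
    and ub: "\<And>i b. i \<in> S \<Longrightarrow> b i = 0 \<Longrightarrow> (\<And>j. b j \<le> 2) \<Longrightarrow> nrm h b \<le> 1 + \<tau>"
  shows "nrm h a ^ 2 ^ card S \<le> (1 + \<tau>) ^ 2 ^ card S * nrm h (\<lambda>j. if j \<in> S then 2 else a j)"
proof -
  have "finite S" using S finJ finite_subset by auto
  then have "(1 + \<tau>) * nrm h a ^ 2 ^ card S \<le> (1 + \<tau>) ^ 2 ^ card S * nrm h (\<lambda>j. if j \<in> S then 2 else a j)"
    using S ub
  proof (induction S)
    case empty
    then show ?case by simp
  next
    case (insert i S)
    let ?a = "\<lambda>j. if j \<in> S then 2 else a j"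
    let ?q = "2 ^ card S :: nat"
    have IH: "(1 + \<tau>) * nrm h a ^ ?q \<le> (1 + \<tau>) ^ ?q * nrm h ?a"
      using insert.prems by (intro insert.IH) auto
    have a1: "?a(i := 1) = ?a" using insert by auto
    have a2': "?a(i := 2) = (\<lambda>j. if j \<in> insert i S then 2 else a j)" by auto
    have "nrm h (?a(i := 0)) \<le> 1 + \<tau>"
      using a2 by (intro insert.prems(3)[of i]) auto
    then have "nrm h (?a(i := 0)) * nrm h (?a(i := 2)) \<le> (1 + \<tau>) * nrm h (?a(i := 2))"
      by (rule mult_right_mono) (rule nrm_nonneg[OF h])
    moreover have "(nrm h (?a(i := 1)))\<^sup>2 \<le> nrm h (?a(i := 0)) * nrm h (?a(i := 2))"
      using insert.prems(1) by (intro nrm_log_convex h) auto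
    ultimately have sq: "(nrm h ?a)\<^sup>2 \<le> (1 + \<tau>) * nrm h (?a(i := 2))"
      unfolding a1 by linarith
    have "(1 + \<tau>) * ((1 + \<tau>) * nrm h a ^ (2 * ?q)) = ((1 + \<tau>) * nrm h a ^ ?q)\<^sup>2"
      by (simp add: power_even_eq power_mult_distrib power2_eq_square)
    also have "\<dots> \<le> ((1 + \<tau>) ^ ?q * nrm h ?a)\<^sup>2"
      using IH \<tau> nrm_nonneg[OF h] by (intro power_mono) auto
    also have "\<dots> = (1 + \<tau>) ^ (2 * ?q) * (nrm h ?a)\<^sup>2"
      by (simp add: power_mult_distrib power_even_eq)
    also have "\<dots> \<le> (1 + \<tau>) ^ (2 * ?q) * ((1 + \<tau>) * nrm h (?a(i := 2)))"
      using sq \<tau> by (intro mult_left_mono) auto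
    finally have "(1 + \<tau>) * nrm h a ^ (2 * ?q) \<le> (1 + \<tau>) ^ (2 * ?q) * nrm h (?a(i := 2))"
    proof -
      assume *: "(1 + \<tau>) * ((1 + \<tau>) * nrm h a ^ (2 * ?q)) \<le> (1 + \<tau>) ^ (2 * ?q) * ((1 + \<tau>) * nrm h (?a(i := 2)))"
      have "(1 + \<tau>) * ((1 + \<tau>) * nrm h a ^ (2 * ?q)) \<le> (1 + \<tau>) * ((1 + \<tau>) ^ (2 * ?q) * nrm h (?a(i := 2)))"
        by (rule order.trans[OF *]) (simp only: mult.left_commute order.refl)
      then show ?thesis
        using \<tau> by (subst (asm) mult_le_cancel_left_pos) auto
    qed
    then show ?case
      unfolding a2' using insert by simp
  qed
  moreover have "nrm h a ^ 2 ^ card S \<le> (1 + \<tau>) * nrm h a ^ 2 ^ card S"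
    using \<tau> nrm_nonneg[OF h] by (simp add: algebra_simps)
  ultimately show ?thesis by linarith
qed

end

definition (in parts) hyb :: "'j set set \<Rightarrow> ('v set \<Rightarrow> real) \<Rightarrow> ('v set \<Rightarrow> real) \<Rightarrow> 'v set \<Rightarrow> real" where
  "hyb U g \<gamma> u = (if type_of u \<in> U then g u else \<gamma> u)"

locale weighted_pair = modelled J V \<kappa> p
  for J :: "'j set" and V :: "'j \<Rightarrow> 'v set" and \<kappa> :: real and p :: "'j set \<Rightarrow> real" +
  fixes g \<gamma> :: "'v set \<Rightarrow> real"
  assumes g_le: "\<And>u. u \<in> crossing J V \<Longrightarrow> 0 \<le> g u \<and> g u \<le> \<gamma> u"
begin

abbreviation "hy U \<equiv> hyb U g \<gamma>"

lemma hy_nonneg: "u \<in> crossing J V \<Longrightarrow> 0 \<le> hy U u"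
  and hy_le: "u \<in> crossing J V \<Longrightarrow> hy U u \<le> \<gamma> u"
  using g_le[of u] by (auto simp: hyb_def)

lemma weight_hy_cong:
  assumes "fst ` X \<subseteq> J" "t \<in> tuples V X" "\<And>e. e \<in> faces X \<Longrightarrow> fst ` e \<in> U \<longleftrightarrow> fst ` e \<in> U'"
  shows "weight (hy U) X t = weight (hy U') X t"
  unfolding weight_def hyb_def using assms type_of_image[OF assms(2,1)]
  by (intro prod.cong) (auto simp: faces_def)

lemma fibre_hy_cong:
  assumes "fst ` X \<subseteq> J" "t \<in> tuples V X" "i \<in> J"
    "\<And>e. e \<in> faces X \<Longrightarrow> insert i (fst ` e) \<in> U \<longleftrightarrow> insert i (fst ` e) \<in> U'"
  shows "fibre V (hy U) X i t = fibre V (hy U') X i t"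
  unfolding fibre_def extension_def hyb_def using assms type_of_image[OF assms(2,1)]
  by (intro arg_cong2[of _ _ _ _ "(/)"] sum.cong prod.cong refl)
     (auto simp: faces_def type_of_insert)

lemma nrm_hy_cong:
  assumes "\<And>f. f \<subseteq> J \<Longrightarrow> (\<And>i. i \<in> f \<Longrightarrow> 0 < a i) \<Longrightarrow> f \<in> U \<longleftrightarrow> f \<in> U'"
  shows "nrm (hy U) a = nrm (hy U') a"
proof -
  have "fst ` e \<in> U \<longleftrightarrow> fst ` e \<in> U'" if "e \<in> faces (positions J a)" for e
    using that by (intro assms) (auto simp: faces_def positions_def)
  then show ?thesis
    unfolding nrm_def cnt_def
    by (intro arg_cong2[of _ _ _ _ "(/)"] sum.cong refl weight_hy_cong fst_positions) auto
qed

lemma hyb_empty: "hyb {} g \<gamma> = \<gamma>"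
  by (simp add: hyb_def fun_eq_iff)

lemma nrm_step:
  assumes i: "i \<in> J" and b: "b i = 0"
    and par: "0 \<le> D" "D \<le> 1" "0 \<le> E" "E \<le> 1" "0 \<le> \<xi>" "\<xi> \<le> 1"
    and m0: "nrm \<gamma> b \<le> 1 + \<xi>"
    and m1: "nrm (hy {f \<in> U. i \<in> f}) (b(i := 1)) \<ge> D - E"
    and m2: "nrm (hy {f \<in> U. i \<in> f}) (b(i := 2)) \<le> D\<^sup>2 + E"
    and n: "n = 1 \<or> n = 2"
  shows "\<bar>nrm (hy U) (b(i := n)) - D ^ n * nrm (hy {f \<in> U. i \<notin> f}) b\<bar> \<le> 5 * sqrt (E + \<xi>)"
proof -
  let ?Ui = "{f \<in> U. i \<in> f}" and ?Un = "{f \<in> U. i \<notin> f}"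
  define X where "X = positions J b"
  have b0: "b(i := 0) = b" using b by auto
  have X: "finite X" "fst ` X \<subseteq> J" "i \<notin> fst ` X"
    using b finJ by (auto simp: X_def positions_def)
  define T where "T = tuples V X"
  define w where "w t = weight \<gamma> X t / real (card T)" for t
  define w' where "w' t = weight (hy U) X t / real (card T)" for t
  define F where "F t = fibre V (hy U) X i t" for t
  have type_i: "i \<notin> fst ` e" if "e \<in> faces X" for e
    using X that by (auto simp: faces_def)
  have w0: "0 \<le> w t" "0 \<le> w' t" "w' t \<le> w t" "0 \<le> F t" if "t \<in> T" for t
  proof -
    show "0 \<le> w t" unfolding w_def using that X g_le
      by (intro divide_nonneg_nonneg weight_nonneg) (force simp: T_def)+
    show "0 \<le> w' t" unfolding w'_def using that X hy_nonneg
      by (intro divide_nonneg_nonneg weight_nonneg) (auto simp: T_def)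
    show "w' t \<le> w t" unfolding w_def w'_def weight_def
      using that X image_crossing hy_nonneg hy_le
      by (intro divide_right_mono prod_mono) (auto simp: T_def)
    show "0 \<le> F t" unfolding F_def using that X hy_nonneg i
      by (intro fibre_nonneg) (auto simp: T_def)
  qed
  have cnt: "cnt V (hy U) (positions J (b(i := n))) = (\<Sum>t\<in>T. w' t * F t ^ n)" for n
    using count_positions_upd[OF finJ i, of V "hy U" b n] unfolding b0
    by (simp add: w'_def F_def T_def X_def)
  have cnt_i: "cnt V (hy ?Ui) (positions J (b(i := n))) = (\<Sum>t\<in>T. w t * F t ^ n)" for n
  proof -
    have "weight (hy ?Ui) X t = weight (hy {}) X t" if "t \<in> T" for t
      using that X type_i by (intro weight_hy_cong) (auto simp: T_def)
    moreover have "fibre V (hy ?Ui) X i t = F t" if "t \<in> T" for t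
      unfolding F_def using that X i by (intro fibre_hy_cong) (auto simp: T_def)
    ultimately show ?thesis
      using count_positions_upd[OF finJ i, of V "hy ?Ui" b n] unfolding b0
      by (simp add: w_def T_def X_def hyb_empty)
  qed
  have cnt_0: "cnt V \<gamma> (positions J b) = (\<Sum>t\<in>T. w t)"
    by (simp add: cnt_def X_def T_def w_def sum_divide_distrib)
  have cnt_n: "cnt V (hy ?Un) (positions J b) = (\<Sum>t\<in>T. w' t)"
  proof -
    have "weight (hy ?Un) X t = weight (hy U) X t" if "t \<in> T" for t
      using that X type_i by (intro weight_hy_cong) (auto simp: T_def)
    then show ?thesis
      by (simp add: cnt_def X_def T_def w'_def sum_divide_distrib)
  qed
  define M where "M = model b"
  define \<rho> where "\<rho> = slope i b"
  have M: "0 < M" "0 < \<rho>" by (simp_all add: M_def \<rho>_def model_pos slope_pos)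
  have mod: "model (b(i := n)) = \<rho> ^ n * M" for n
    using model_upd[of b i n] b0 by (simp add: M_def \<rho>_def)
  have conc: "(\<Sum>t\<in>T. w t * \<bar>F t ^ n - (D * \<rho>) ^ n\<bar>) \<le> 5 * sqrt (E + \<xi>) * \<rho> ^ n * M"
  proof (rule second_moment_concentration)
    show "(\<Sum>t\<in>T. w t) \<le> (1 + \<xi>) * M"
      using m0 M by (simp add: nrm_def cnt_0 M_def[symmetric] field_simps)
    show "(\<Sum>t\<in>T. w t * F t) \<ge> (D - E) * \<rho> * M"
      using m1 M cnt_i[of 1] mod[of 1] by (simp add: nrm_def field_simps)
    show "(\<Sum>t\<in>T. w t * (F t)\<^sup>2) \<le> (D\<^sup>2 + E) * \<rho>\<^sup>2 * M"
      using m2 M cnt_i[of 2] mod[of 2] by (simp add: nrm_def field_simps)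
  qed (use w0 par n M in auto)
  have "\<bar>nrm (hy U) (b(i := n)) - D ^ n * nrm (hy ?Un) b\<bar>
      = \<bar>(\<Sum>t\<in>T. w' t * F t ^ n) / (\<rho> ^ n * M) - D ^ n * ((\<Sum>t\<in>T. w' t) / M)\<bar>"
    by (simp add: nrm_def cnt cnt_n mod M_def)
  also have "\<dots> = \<bar>(\<Sum>t\<in>T. w' t * F t ^ n) - (D * \<rho>) ^ n * (\<Sum>t\<in>T. w' t)\<bar> / (\<rho> ^ n * M)"
    using M by (simp add: field_simps power_mult_distrib abs_divide[symmetric] flip: abs_mult)
  also have "\<dots> \<le> 5 * sqrt (E + \<xi>)"
  proof -
    have "\<bar>(\<Sum>t\<in>T. w' t * F t ^ n) - (D * \<rho>) ^ n * (\<Sum>t\<in>T. w' t)\<bar>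
        = \<bar>\<Sum>t\<in>T. w' t * (F t ^ n - (D * \<rho>) ^ n)\<bar>"
      by (simp add: algebra_simps sum_subtractf sum_distrib_left sum_distrib_right)
    also have "\<dots> \<le> (\<Sum>t\<in>T. \<bar>w' t * (F t ^ n - (D * \<rho>) ^ n)\<bar>)" by (rule sum_abs)
    also have "\<dots> \<le> (\<Sum>t\<in>T. w t * \<bar>F t ^ n - (D * \<rho>) ^ n\<bar>)"
      by (intro sum_mono) (use w0 in \<open>auto simp: abs_mult intro!: mult_right_mono\<close>)
    finally show ?thesis using conc M by (simp add: divide_le_eq mult.assoc)
  qed
  finally show ?thesis .
qed

end

section \<open>Replacing the weights of some types\<close>

lemma one_plus_power_le:
  fixes \<zeta> :: real
  assumes "0 \<le> \<zeta>" "real n * \<zeta> \<le> 1"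
  shows "(1 + \<zeta>) ^ n \<le> 1 + 2 * real n * \<zeta>"
proof -
  have "(1 + \<zeta>) ^ n \<le> exp \<zeta> ^ n"
    using assms by (intro power_mono) auto
  also have "\<dots> = exp (real n * \<zeta>)" by (simp add: exp_of_nat_mult)
  also have "\<dots> \<le> 1 + real n * \<zeta> + (real n * \<zeta>)\<^sup>2"
    using assms by (intro exp_bound) auto
  also have "(real n * \<zeta>)\<^sup>2 \<le> real n * \<zeta>"
    using assms by (simp add: power2_eq_square mult_left_le)
  finally show ?thesis by (simp add: algebra_simps)
qed

lemma power_root_lower:
  fixes x y d \<zeta> :: real
  assumes "y ^ n \<le> (1 + \<zeta>) ^ n * x" "d - 2 * \<zeta> \<le> y" "0 \<le> y" "0 \<le> d" "d \<le> 1"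
    and "0 \<le> \<zeta>" "real n * \<zeta> \<le> 1" "0 \<le> x" "x \<le> 2"
  shows "d ^ n \<le> x + 6 * real n * \<zeta>"
proof -
  have "(1 + \<zeta>) ^ n * x \<le> (1 + 2 * real n * \<zeta>) * x"
    using assms one_plus_power_le by (intro mult_right_mono) auto
  also have "\<dots> \<le> x + 2 * real n * \<zeta> * 2"
    using assms mult_left_mono[of x 2 "2 * real n * \<zeta>"] by (simp add: algebra_simps)
  finally have y: "y ^ n \<le> x + 4 * real n * \<zeta>" using assms by simp
  have "d ^ n \<le> y ^ n + real n * (2 * \<zeta>)"
  proof (cases "d \<le> y")
    case True
    then show ?thesis using assms power_mono[of d y n] by (simp add: add_increasing2)
  next
    case False
    have "norm (d ^ n - y ^ n) \<le> real n * norm (d - y)"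
      using assms False by (intro norm_power_diff) auto
    also have "\<dots> \<le> real n * (2 * \<zeta>)"
      using assms False by (intro mult_left_mono) auto
    finally show ?thesis by simp
  qed
  with y show ?thesis by simp
qed

lemma power_root_upper:
  fixes x z w \<zeta> :: real
  assumes "x ^ m \<le> (1 + \<zeta>) ^ m * w" "w \<le> z ^ m + 3 * \<zeta>" "0 \<le> w" "w \<le> 2" "0 < z"
    and "0 \<le> \<zeta>" "real m * \<zeta> \<le> 1" "1 \<le> m"
  shows "x \<le> z + 7 * real m * \<zeta> / z ^ (m - 1)"
proof (cases "x \<le> z")
  case True
  then show ?thesis using assms by (simp add: add_increasing2)
next
  case False
  have m: "m = Suc (m - 1)" using assms by simp
  have "z ^ m + z ^ (m - 1) * (x - z) = z ^ (m - 1) * x"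
    by (subst (1) m) (simp add: algebra_simps)
  also have "\<dots> \<le> x ^ (m - 1) * x"
    using False assms by (intro mult_right_mono power_mono) auto
  also have "\<dots> = x ^ m" by (subst (2) m) simp
  also have "\<dots> \<le> (1 + 2 * real m * \<zeta>) * w"
    using assms one_plus_power_le[of \<zeta> m] mult_right_mono[of "(1 + \<zeta>) ^ m" "1 + 2 * real m * \<zeta>" w] by linarith
  also have "\<dots> \<le> w + 2 * real m * \<zeta> * 2"
    using assms mult_left_mono[of w 2 "2 * real m * \<zeta>"] by (simp add: algebra_simps)
  also have "\<dots> \<le> z ^ m + 7 * real m * \<zeta>"
    using assms(2,6,8) mult_right_mono[of 1 "real m" \<zeta>] by (simp add: algebra_simps)
  finally have "z ^ (m - 1) * (x - z) \<le> 7 * real m * \<zeta>" by simp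
  then show ?thesis using assms by (simp add: field_simps)
qed

context weighted_pair
begin

lemma nrm_hy_nonneg: "0 \<le> nrm (hy U) a"
  by (rule nrm_nonneg) (rule hy_nonneg)

definition uni :: "'j set \<Rightarrow> nat \<Rightarrow> 'j \<Rightarrow> nat" where
  "uni f n = (\<lambda>i. if i \<in> f then n else 0)"

lemma nrm_single_type:
  assumes f: "f \<in> types" and Q: "2 ^ card f \<le> Q"
    and low: "(d - \<epsilon>) * nrm \<gamma> (uni f 1) \<le> nrm (hy {f}) (uni f 1)"
    and up: "nrm (hy {f}) (uni f 2) \<le> (d ^ 2 ^ card f + \<epsilon>) * nrm \<gamma> (uni f 2)"
    and \<gamma>1: "\<And>a. (\<And>i. a i \<le> 2) \<Longrightarrow> \<bar>nrm \<gamma> a - 1\<bar> \<le> \<zeta>"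
    and par: "0 \<le> \<epsilon>" "\<epsilon> \<le> \<zeta>" "0 < \<delta>" "\<delta> \<le> d" "d \<le> 1" "real Q * \<zeta> \<le> 1"
    and a: "\<And>i. i \<in> f \<Longrightarrow> a i = 1 \<or> a i = 2" "\<And>i. i \<notin> f \<Longrightarrow> a i = 0"
  shows "\<bar>nrm (hy {f}) a - d ^ mon a f\<bar> \<le> 7 * real Q * \<zeta> / \<delta> ^ Q"
proof -
  define S1 where "S1 = {i \<in> f. a i = 1}"
  define S2 where "S2 = {i \<in> f. a i = 2}"
  define n where "n = (2::nat) ^ card S2"
  define m where "m = (2::nat) ^ card S1"
  have finf: "finite f" "f \<subseteq> J" "f \<noteq> {}" using f finite_types by (auto simp: types_def)
  have un: "f = S1 \<union> S2" "S1 \<inter> S2 = {}" using a by (auto simp: S1_def S2_def)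
  have fin: "finite S1" "finite S2" using finf by (auto simp: S1_def S2_def)
  have nm: "n * m = 2 ^ card f"
    unfolding n_def m_def using un fin by (simp add: card_Un_disjoint power_add)
  have Q1: "1 \<le> Q" using Q by (meson one_le_numeral one_le_power order.trans)
  have n1: "1 \<le> n" "1 \<le> m" by (auto simp: n_def m_def)
  have nQ: "n \<le> Q" "m \<le> Q"
    using nm Q n1 by (metis mult_le_mono mult.right_neutral mult_1 order.trans order_refl)+
  have \<zeta>: "0 \<le> \<zeta>" using par by linarith
  have "1 * \<zeta> \<le> real Q * \<zeta>" using Q1 \<zeta> by (intro mult_right_mono) auto
  then have \<zeta>1: "\<zeta> \<le> 1" using par by linarith
  have nz: "real n * \<zeta> \<le> 1" "real m * \<zeta> \<le> 1"
    using nQ \<zeta> par(6) mult_right_mono[of "real n" "real Q" \<zeta>] mult_right_mono[of "real m" "real Q" \<zeta>] by auto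
  have a2: "a i \<le> 2" for i using a(1)[of i] a(2)[of i] by (cases "i \<in> f") auto
  have mon: "mon a f = n"
  proof -
    have "mon a f = (\<Prod>i\<in>S1. a i) * (\<Prod>i\<in>S2. a i)"
      unfolding mon_def using un fin by (metis prod.union_disjoint)
    then show ?thesis by (simp add: S1_def S2_def n_def)
  qed
  have ub: "nrm (hy {f}) b \<le> 1 + \<zeta>" if "i \<in> f" "b i = 0" "\<And>j. b j \<le> 2" for i b
  proof -
    have "nrm (hy {f}) b = nrm (hy {}) b"
      by (rule nrm_hy_cong) (use that in force)
    then show ?thesis using \<gamma>1[of b] that by (simp add: hyb_empty abs_le_iff)
  qed
  have le: "nrm (hy {f}) b \<le> nrm \<gamma> b" for b
    unfolding nrm_def using hy_nonneg hy_le model_pos[of b] finJ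
    by (intro divide_right_mono count_mono) (auto simp: finite_positions positions_def)
  have le2: "nrm (hy {f}) b \<le> 2" if "\<And>j. b j \<le> 2" for b
    using le[of b] \<gamma>1[of b] that \<zeta>1 by force
  have uni: "\<bar>nrm \<gamma> (uni f 1) - 1\<bar> \<le> \<zeta>" "\<bar>nrm \<gamma> (uni f 2) - 1\<bar> \<le> \<zeta>"
    by (rule \<gamma>1, simp add: uni_def)+
  have lower: "d ^ n \<le> nrm (hy {f}) a + 6 * real n * \<zeta>"
  proof (rule power_root_lower)
    have "nrm (hy {f}) (uni f 1) ^ 2 ^ card S2
        \<le> (1 + \<zeta>) ^ 2 ^ card S2 * nrm (hy {f}) (\<lambda>j. if j \<in> S2 then 2 else uni f 1 j)"
      by (rule nrm_doubling) (use hy_nonneg \<zeta> finf ub in \<open>auto simp: S2_def uni_def\<close>)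
    also have "(\<lambda>j. if j \<in> S2 then 2 else uni f 1 j) = a"
      using a by (fastforce simp: S2_def uni_def)
    finally show "nrm (hy {f}) (uni f 1) ^ n \<le> (1 + \<zeta>) ^ n * nrm (hy {f}) a" by (simp add: n_def)
    show "d - 2 * \<zeta> \<le> nrm (hy {f}) (uni f 1)"
    proof (cases "d \<le> \<epsilon>")
      case True
      then show ?thesis using par \<zeta> nrm_hy_nonneg[of "{f}" "uni f 1"] by linarith
    next
      case False
      have "d - 2 * \<zeta> \<le> (d - \<epsilon>) * (1 - \<zeta>)"
      proof -
        have "(d - \<epsilon>) * \<zeta> \<le> 1 * \<zeta>" using par \<zeta> by (intro mult_right_mono) auto
        then show ?thesis using par by (simp add: algebra_simps)
      qed
      also have "\<dots> \<le> (d - \<epsilon>) * nrm \<gamma> (uni f 1)"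
        using False uni by (intro mult_left_mono) auto
      finally show ?thesis using low by linarith
    qed
  qed (use par \<zeta> nz le2[OF a2] nrm_hy_nonneg in auto)
  have upper: "nrm (hy {f}) a \<le> d ^ n + 7 * real m * \<zeta> / (d ^ n) ^ (m - 1)"
  proof (rule power_root_upper)
    have "nrm (hy {f}) a ^ 2 ^ card S1
        \<le> (1 + \<zeta>) ^ 2 ^ card S1 * nrm (hy {f}) (\<lambda>j. if j \<in> S1 then 2 else a j)"
      by (rule nrm_doubling) (use hy_nonneg \<zeta> finf ub a2 in \<open>auto simp: S1_def\<close>)
    also have "(\<lambda>j. if j \<in> S1 then 2 else a j) = uni f 2"
      using a by (fastforce simp: S1_def uni_def)
    finally show "nrm (hy {f}) a ^ m \<le> (1 + \<zeta>) ^ m * nrm (hy {f}) (uni f 2)" by (simp add: m_def)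
    have "nrm (hy {f}) (uni f 2) \<le> (d ^ 2 ^ card f + \<epsilon>) * (1 + \<zeta>)"
      by (rule order.trans[OF up mult_left_mono]) (use uni par in auto)
    also have "\<dots> = d ^ 2 ^ card f + \<epsilon> + (d ^ 2 ^ card f + \<epsilon>) * \<zeta>" by (simp add: algebra_simps)
    also have "(d ^ 2 ^ card f + \<epsilon>) * \<zeta> \<le> (1 + 1) * \<zeta>"
      using par \<zeta> \<zeta>1 by (intro mult_right_mono add_mono power_le_one) auto
    finally show "nrm (hy {f}) (uni f 2) \<le> (d ^ n) ^ m + 3 * \<zeta>"
      using par nm by (simp add: power_mult[symmetric])
  qed (use par \<zeta> nz n1 nrm_hy_nonneg le2 in \<open>auto simp: uni_def\<close>)
  have "7 * real m * \<zeta> / (d ^ n) ^ (m - 1) \<le> 7 * real Q * \<zeta> / \<delta> ^ Q"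
  proof (rule frac_le)
    have "n * (m - 1) \<le> Q" using nm Q by (simp add: diff_mult_distrib2)
    then have "\<delta> ^ Q \<le> \<delta> ^ (n * (m - 1))"
      using par by (intro power_decreasing) auto
    also have "\<dots> \<le> d ^ (n * (m - 1))" using par by (intro power_mono) auto
    finally show "\<delta> ^ Q \<le> (d ^ n) ^ (m - 1)" by (simp add: power_mult)
  qed (use nQ \<zeta> par in \<open>auto intro!: mult_right_mono\<close>)
  moreover have "6 * real n * \<zeta> \<le> 7 * real Q * \<zeta> / \<delta> ^ Q"
  proof -
    have "6 * real n * \<zeta> / 1 \<le> 7 * real Q * \<zeta> / \<delta> ^ Q"
      by (rule frac_le) (use nQ \<zeta> par power_le_one[of \<delta> Q] in \<open>auto intro!: mult_right_mono\<close>)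
    then show ?thesis by simp
  qed
  ultimately show ?thesis using lower upper unfolding mon by linarith
qed

text \<open>Induction over the set \<open>I\<close> of indices common to all types in \<open>U\<close>. Averaging out a part \<open>i\<close> outside
  \<open>I\<close> involves the types containing \<open>i\<close>, all of which contain \<open>insert i I\<close>, and leaves the types
  without \<open>i\<close> on a complex with one part fewer. If no such part is left, \<open>I\<close> is the only type that
  matters.\<close>

lemma nrm_all_types:
  fixes E :: "nat \<Rightarrow> real"
  assumes single: "\<And>f a. f \<in> types \<Longrightarrow> (\<And>i. i \<in> f \<Longrightarrow> a i = 1 \<or> a i = 2) \<Longrightarrow> (\<And>i. i \<notin> f \<Longrightarrow> a i = 0)
      \<Longrightarrow> \<bar>nrm (hy {f}) a - d f ^ mon a f\<bar> \<le> Eb"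
    and \<gamma>1: "\<And>a. (\<And>i. a i \<le> 2) \<Longrightarrow> \<bar>nrm \<gamma> a - 1\<bar> \<le> \<xi>"
    and d: "\<And>f. f \<in> types \<Longrightarrow> 0 \<le> d f \<and> d f \<le> 1"
    and par: "0 \<le> \<xi>" "\<xi> \<le> 1" "\<xi> \<le> Eb" "\<And>s. 0 \<le> E s" "\<And>s. s < card J \<Longrightarrow> E s \<le> 1"
    and E: "Eb \<le> E 0" "\<And>s. s < card J \<Longrightarrow> Eb + real (card J) * (5 * sqrt (E s + \<xi>)) \<le> E (Suc s)"
    and U: "U \<subseteq> types" "I \<subseteq> J" "\<And>f. f \<in> U \<Longrightarrow> I \<subseteq> f"
    and a: "\<And>i. a i \<le> 2" "\<And>i. i \<notin> J \<Longrightarrow> a i = 0"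
  shows "\<bar>nrm (hy U) a - dens_prod d U a\<bar> \<le> E (card (J - I))"
  using U a
proof (induction "card (J - I)" arbitrary: I U a)
  case 0
  have "J - I = {}" using 0 finJ by simp
  then have IJ: "I = J" using 0 by auto
  have U: "U \<subseteq> {J}" using 0 IJ by (auto simp: types_def)
  show ?case
  proof (cases "U = {J} \<and> (\<forall>i\<in>J. 0 < a i)")
    case True
    have "\<bar>nrm (hy {J}) a - d J ^ mon a J\<bar> \<le> Eb"
    proof (rule single)
      show "a i = 1 \<or> a i = 2" if "i \<in> J" for i using True that 0(5)[of i] by force
    qed (use True 0 in auto)
    then show ?thesis using True IJ E by (simp add: dens_prod_def)
  next
    case False
    then have "nrm (hy U) a = nrm (hy {}) a"
      using U False by (intro nrm_hy_cong) blast
    moreover have "dens_prod d U a = 1"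
      using False U mon_zero[OF finJ, of _ a] by (auto simp: dens_prod_def subset_singleton_iff)
    ultimately show ?thesis using \<gamma>1[of a] 0 par E IJ by (simp add: hyb_empty)
  qed
next
  case (Suc s)
  note outer_IH = Suc.hyps(1) and card_JI = Suc.hyps(2) and I_sub = Suc.prems(2)
  let ?c = "5 * sqrt (E s + \<xi>)"
  have fin: "finite (J - I)" using finJ by auto
  have s: "s < card J"
    using Suc.hyps(2) card_mono[OF finJ, of "J - I"] by auto
  have "\<bar>nrm (hy U) a - dens_prod d U a\<bar> \<le> Eb + real (card {i \<in> J - I. 0 < a i}) * ?c"
    using Suc.prems(1,3,4,5)
  proof (induction "card {i \<in> J - I. 0 < a i}" arbitrary: U a)
    case 0
    have "finite {i \<in> J - I. 0 < a i}" by (rule finite_subset[OF _ fin]) auto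
    then have none: "{i \<in> J - I. 0 < a i} = {}" using 0(1) by (metis card_0_eq)
    have z: "a i = 0" if "i \<in> J - I" for i
    proof (rule ccontr)
      assume "a i \<noteq> 0"
      with that have "i \<in> {i \<in> J - I. 0 < a i}" by simp
      then show False unfolding none by simp
    qed
    have eqI: "f = I" if "f \<in> U" "\<And>i. i \<in> f \<Longrightarrow> 0 < a i" for f
    proof -
      have "f \<subseteq> J" "I \<subseteq> f" using that 0(2,3) by (auto simp: types_def)
      moreover have "i \<in> I" if "i \<in> f" for i
        using z[of i] \<open>f \<subseteq> J\<close> \<open>\<And>i. i \<in> f \<Longrightarrow> 0 < a i\<close>[OF that] that by auto
      ultimately show ?thesis by blast
    qed
    show ?case
    proof (cases "I \<in> U \<and> (\<forall>i\<in>I. 0 < a i)")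
      case True
      have I: "I \<in> types" using True 0 by auto
      have "\<bar>nrm (hy {I}) a - d I ^ mon a I\<bar> \<le> Eb"
      proof (rule single[OF I])
        show "a i = 1 \<or> a i = 2" if "i \<in> I" for i using True that 0(4)[of i] by force
        show "a i = 0" if "i \<notin> I" for i using that z 0(5) by (cases "i \<in> J") auto
      qed
      moreover have "nrm (hy U) a = nrm (hy {I}) a"
        using eqI True by (intro nrm_hy_cong) auto
      moreover have "dens_prod d U a = d I ^ mon a I"
      proof -
        have "dens_prod d U a = (\<Prod>f\<in>{I}. d f ^ mon a f)"
          unfolding dens_prod_def
        proof (rule prod.mono_neutral_right)
          show "\<forall>f\<in>U - {I}. d f ^ mon a f = 1"
          proof
            fix f assume f: "f \<in> U - {I}"
            then obtain i where "i \<in> f" "a i = 0" using eqI by blast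
            then show "d f ^ mon a f = 1" using f 0 finite_types mon_zero[of f i a] by auto
          qed
        qed (use True 0 finite_types finite_subset in auto)
        then show ?thesis by simp
      qed
      ultimately show ?thesis using 0(1) by simp
    next
      case False
      have "nrm (hy U) a = nrm (hy {}) a"
        using eqI False by (intro nrm_hy_cong) (metis empty_iff)
      moreover have "dens_prod d U a = 1"
        unfolding dens_prod_def
      proof (rule prod.neutral, rule ballI)
        fix f assume f: "f \<in> U"
        then obtain i where "i \<in> f" "a i = 0" using eqI False by blast
        then show "d f ^ mon a f = 1" using f 0 finite_types mon_zero[of f i a] by auto
      qed
      ultimately show ?thesis using \<gamma>1[of a] 0 par by (simp add: hyb_empty)
    qed
  next
    case (Suc m)
    have "{i \<in> J - I. 0 < a i} \<noteq> {}" using Suc.hyps(2) by (metis card.empty nat.distinct(1))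
    then obtain i where i: "i \<in> J" "i \<notin> I" "0 < a i" by auto
    define b where "b = a(i := 0)"
    define n where "n = a i"
    have n: "n = 1 \<or> n = 2" using i Suc.prems(3)[of i] by (auto simp: n_def)
    have ab: "a = b(i := n)" "b i = 0" by (auto simp: b_def n_def)
    let ?Ui = "{f \<in> U. i \<in> f}" and ?Un = "{f \<in> U. i \<notin> f}"
    define D where "D = dens_prod d ?Ui (b(i := 1))"
    have finU: "finite U" "\<And>f. f \<in> U \<Longrightarrow> finite f"
      using Suc.prems(1) finite_types finite_subset by auto
    have D: "0 \<le> D" "D \<le> 1"
      unfolding D_def using Suc.prems(1) d by (intro dens_prod_bounds; blast)+
    have b2: "b j \<le> 2" "j \<notin> J \<Longrightarrow> b j = 0" for j using Suc.prems by (auto simp: b_def)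
    have cardI: "s = card (J - insert i I)"
    proof -
      have "card (J - I) = card (insert i (J - insert i I))"
        using i by (intro arg_cong[of _ _ card]) auto
      also have "\<dots> = Suc (card (J - insert i I))"
        using finJ by (intro card_insert_disjoint) auto
      finally show ?thesis using card_JI by simp
    qed
    have outer: "\<bar>nrm (hy ?Ui) (b(i := m)) - dens_prod d ?Ui (b(i := m))\<bar> \<le> E s" if "m \<le> 2" for m
      unfolding cardI
    proof (rule outer_IH[OF cardI])
      show "insert i I \<subseteq> f" if "f \<in> ?Ui" for f using that Suc.prems(2) by auto
    qed (use Suc.prems(1) i I_sub b2 that in auto)
    have D2: "dens_prod d ?Ui (b(i := 2)) = D\<^sup>2"
    proof -
      have "{f \<in> ?Ui. i \<in> f} = ?Ui" "{f \<in> ?Ui. i \<notin> f} = {}" by auto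
      then show ?thesis
        using dens_prod_upd[of ?Ui d b i 2] finU by (simp add: D_def dens_prod_def[of d "{}"])
    qed
    have step: "\<bar>nrm (hy U) a - D ^ n * nrm (hy ?Un) b\<bar> \<le> ?c"
      unfolding ab(1)
    proof (rule nrm_step)
      show "nrm \<gamma> b \<le> 1 + \<xi>" using \<gamma>1[of b] b2 by (simp add: abs_le_iff)
      show "D - E s \<le> nrm (hy ?Ui) (b(i := 1))" using outer[of 1] by (simp add: D_def)
      show "nrm (hy ?Ui) (b(i := 2)) \<le> D\<^sup>2 + E s" using outer[of 2] D2 by simp
    qed (use i ab D par s n in auto)
    have "{j \<in> J - I. 0 < a j} = insert i {j \<in> J - I. 0 < b j}"
      using i by (auto simp: b_def)
    moreover have "finite {j \<in> J - I. 0 < b j}" by (rule finite_subset[OF _ fin]) auto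
    ultimately have cm: "m = card {j \<in> J - I. 0 < b j}"
      using Suc.hyps(2) ab(2) by (simp only: card_insert_disjoint) simp
    have inner: "\<bar>nrm (hy ?Un) b - dens_prod d ?Un b\<bar> \<le> Eb + real m * ?c"
      unfolding cm using Suc.prems b2 by (intro Suc.hyps(1)[OF cm]) auto
    have "D ^ n * \<bar>nrm (hy ?Un) b - dens_prod d ?Un b\<bar> \<le> 1 * (Eb + real m * ?c)"
      using D inner by (intro mult_mono power_le_one) auto
    then have "\<bar>D ^ n * nrm (hy ?Un) b - D ^ n * dens_prod d ?Un b\<bar> \<le> Eb + real m * ?c"
      using D by (simp add: abs_mult flip: right_diff_distrib)
    moreover have "dens_prod d U a = D ^ n * dens_prod d ?Un b"
      unfolding ab(1) D_def using dens_prod_upd[OF finU, of d b i n] by simp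
    ultimately have "\<bar>nrm (hy U) a - dens_prod d U a\<bar> \<le> ?c + (Eb + real m * ?c)"
      using step by linarith
    also have "\<dots> = Eb + real (Suc m) * ?c" by (simp add: algebra_simps)
    finally show ?case unfolding Suc.hyps(2)[symmetric] .
  qed
  also have "\<dots> \<le> Eb + real (card J) * ?c"
    using card_mono[OF finJ, of "{i \<in> J - I. 0 < a i}"] par by (intro add_left_mono mult_right_mono) auto
  also have "\<dots> \<le> E (Suc s)" using E(2)[OF s] .
  finally show ?case using Suc.hyps(2) by simp
qed

end

section \<open>Regularity of links\<close>

lemma power_tangent:
  fixes y D :: real
  assumes "0 \<le> y" "0 \<le> D"
  shows "D ^ (n + 2) + real (n + 2) * D ^ (n + 1) * (y - D) + D ^ n * (y - D)\<^sup>2 \<le> y ^ (n + 2)"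
proof (induction n)
  case 0
  show ?case by (simp add: power2_eq_square algebra_simps)
next
  case (Suc n)
  have "D ^ (Suc n + 2) + real (Suc n + 2) * D ^ (Suc n + 1) * (y - D) + D ^ Suc n * (y - D)\<^sup>2
      \<le> y * (D ^ (n + 2) + real (n + 2) * D ^ (n + 1) * (y - D) + D ^ n * (y - D)\<^sup>2)"
  proof -
    have "y * (D ^ (n + 2) + real (n + 2) * D ^ (n + 1) * (y - D) + D ^ n * (y - D)\<^sup>2)
        - (D ^ (Suc n + 2) + real (Suc n + 2) * D ^ (Suc n + 1) * (y - D) + D ^ Suc n * (y - D)\<^sup>2)
        = real (n + 1) * (D ^ (n + 1) * (y - D)\<^sup>2) + y * (D ^ n * (y - D)\<^sup>2)"
      by (simp add: power2_eq_square algebra_simps)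
    also have "\<dots> \<ge> 0" using assms by simp
    finally show ?thesis by simp
  qed
  also have "\<dots> \<le> y * y ^ (n + 2)" using Suc assms by (intro mult_left_mono) auto
  finally show ?case by simp
qed

lemma abs_mult_minus:
  fixes M y :: real
  assumes "0 < M"
  shows "\<bar>y * M - M\<bar> = \<bar>y - 1\<bar> * M"
proof -
  have "y * M - M = (y - 1) * M" by (simp add: algebra_simps)
  then show ?thesis using assms by (simp only: abs_mult abs_of_pos)
qed

lemma abs_divide_minus:
  fixes M y :: real
  assumes "0 < M"
  shows "\<bar>y / M - 1\<bar> = \<bar>y - M\<bar> / M"
proof -
  have "y / M - 1 = (y - M) / M" using assms by (simp add: diff_divide_distrib)
  then show ?thesis using assms by (simp only: abs_divide abs_of_pos)
qed

locale vertex_link = weighted_pair "insert x e" V \<kappa> p g \<gamma>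
  for x :: 'j and e :: "'j set" and V :: "'j \<Rightarrow> 'v set" and \<kappa> :: real
    and p :: "'j set \<Rightarrow> real" and g \<gamma> :: "'v set \<Rightarrow> real" +
  assumes x_notin: "x \<notin> e" and e_ne: "e \<noteq> {}"
begin

lemma fin_e: "finite e" using finJ by simp

definition link_p :: "'j set \<Rightarrow> real" where "link_p f = p f * p (insert x f)"

definition link_model :: "('j \<Rightarrow> nat) \<Rightarrow> real" where
  "link_model b = dens_prod link_p (Pow e - {{}}) b"

definition root_weight :: "'v \<Rightarrow> real" where "root_weight v = \<gamma> {} * \<gamma> {v}"

lemma modelled_link: "0 < m \<Longrightarrow> modelled e V m link_p"
  by unfold_locales
    (use fin_e finV neV disjV in \<open>auto simp: disjoint_family_on_def link_p_def intro!: mult_pos_pos p_pos\<close>)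

lemma positions_root: "b x = 0 \<Longrightarrow> positions (insert x e) b = positions e b"
  using x_notin by (auto simp: positions_def)

lemma weight_link: "finite X \<Longrightarrow> weight (link v h) X t = weight h X t * extension h X t v"
  by (simp add: weight_def extension_def link_def prod.distrib)

lemma cnt_root:
  assumes "b x = 0"
  shows "cnt V h (positions (insert x e) (b(x := 1)))
       = (\<Sum>v\<in>V x. cnt V (link v h) (positions e b)) / real (card (V x))"
proof -
  let ?X = "positions e b"
  have fin: "finite ?X" using fin_e by (rule finite_positions)
  have b0: "b(x := 0) = b" using assms by auto
  have "cnt V h (positions (insert x e) (b(x := 1)))
      = (\<Sum>t\<in>tuples V ?X. weight h ?X t / real (card (tuples V ?X)) * fibre V h ?X x t)"
    using count_positions_upd[OF finJ, of x V h b 1] positions_root[of b, OF assms] by (simp add: b0)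
  also have "\<dots> = (\<Sum>t\<in>tuples V ?X. \<Sum>v\<in>V x. weight (link v h) ?X t / real (card (tuples V ?X)) / real (card (V x)))"
    using fin by (simp add: fibre_def weight_link sum_divide_distrib sum_distrib_left)
  also have "\<dots> = (\<Sum>v\<in>V x. cnt V (link v h) ?X) / real (card (V x))"
    by (subst sum.swap) (simp add: cnt_def sum_divide_distrib)
  finally show ?thesis .
qed

lemma model_root:
  assumes "b x = 0"
  shows "model (b(x := 1)) = \<kappa> * p {x} * link_model b"
proof -
  have fin: "finite (Pow e)" using fin_e by simp
  have T: "types = (Pow e - {{}}) \<union> insert x ` Pow e"
  proof -
    have "f \<in> insert x ` Pow e" if "f \<subseteq> insert x e" "\<not> f \<subseteq> e" for f
    proof -
      have "f = insert x (f - {x})" "f - {x} \<subseteq> e" using that by auto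
      then show ?thesis by blast
    qed
    then show ?thesis by (auto simp: types_def)
  qed
  have inj: "inj_on (insert x) (Pow e)"
    using x_notin by (intro inj_onI) (metis Diff_insert_absorb PowD insert_absorb insert_ident subsetD)
  have m1: "mon (b(x := 1)) f = mon b f" if "f \<subseteq> e" for f
    using that x_notin by (intro mon_upd_notin) auto
  have m2: "mon (b(x := 1)) (insert x f) = mon b f" if "f \<subseteq> e" for f
  proof -
    have "finite f" "x \<notin> f" using that x_notin fin_e finite_subset by auto
    then show ?thesis using m1[OF that] by (simp add: mon_def)
  qed
  have "dens_prod p types (b(x := 1))
      = dens_prod p (Pow e - {{}}) (b(x := 1)) * dens_prod p (insert x ` Pow e) (b(x := 1))"
    unfolding dens_prod_def T using fin x_notin by (intro prod.union_disjoint) auto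
  also have "dens_prod p (Pow e - {{}}) (b(x := 1)) = dens_prod p (Pow e - {{}}) b"
    unfolding dens_prod_def by (intro prod.cong) (use m1 in auto)
  also have "dens_prod p (insert x ` Pow e) (b(x := 1)) = (\<Prod>f\<in>Pow e. p (insert x f) ^ mon b f)"
    unfolding dens_prod_def using inj m2 by (simp add: prod.reindex)
  also have "\<dots> = p {x} * (\<Prod>f\<in>Pow e - {{}}. p (insert x f) ^ mon b f)"
    using fin by (subst prod.remove[of _ "{}"]) (auto simp: mon_def)
  finally have "dens_prod p types (b(x := 1)) = p {x} * link_model b"
    by (simp add: link_model_def dens_prod_def link_p_def power_mult_distrib prod.distrib mult_ac del: fun_upd_apply)
  then show ?thesis by (simp only: model_def mult.assoc)
qed

lemma link_model_pos: "0 < link_model b"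
  unfolding link_model_def dens_prod_def link_p_def
  by (intro prod_pos ballI zero_less_power mult_pos_pos p_pos) auto

lemma crossing_link:
  assumes "v \<in> V x" "u \<in> crossing e V"
  shows "u \<in> crossing (insert x e) V" "insert v u \<in> crossing (insert x e) V"
proof -
  have disj: "V j \<inter> V x = {}" if "j \<in> e" for j
    using disjV that x_notin by (auto simp: disjoint_family_on_def)
  have u: "finite u" "u \<subseteq> (\<Union>j\<in>e. V j)" "\<And>j. j \<in> e \<Longrightarrow> card (u \<inter> V j) \<le> 1"
    using assms(2) by (auto simp: crossing_def)
  have ux: "u \<inter> V x = {}" using u(2) disj by blast
  then have vx: "insert v u \<inter> V x = {v}" using assms(1) by auto
  have "insert v u \<inter> V j = u \<inter> V j" if "j \<in> e" for j
    using disj[OF that] assms(1) by auto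
  then have "card (insert v u \<inter> V j) \<le> 1" if "j \<in> insert x e" for j
    using that u(3) vx by (cases "j = x") auto
  then show "insert v u \<in> crossing (insert x e) V"
    using assms(1) u(1,2) unfolding crossing_def by blast
  show "u \<in> crossing (insert x e) V"
    using u ux by (auto simp: crossing_def)
qed

lemma link_hy:
  assumes "v \<in> V x" "u \<in> crossing e V"
  shows "0 \<le> link v (hy U) u" "link v (hy U) u \<le> link v \<gamma> u"
proof -
  note c = crossing_link[OF assms]
  show "0 \<le> link v (hy U) u"
    unfolding link_def using c by (intro mult_nonneg_nonneg hy_nonneg)
  have "0 \<le> \<gamma> u" using c(1) hy_nonneg[of u "{}"] by (simp add: hyb_empty)
  then show "link v (hy U) u \<le> link v \<gamma> u"
    unfolding link_def using c by (intro mult_mono hy_le hy_nonneg)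
qed

definition ratio :: "('v set \<Rightarrow> real) \<Rightarrow> 'v \<Rightarrow> ('j \<Rightarrow> nat) \<Rightarrow> real" where
  "ratio h v b = cnt V (link v h) (positions e b) / link_model b"

lemma ratio_cong: "(\<And>i. i \<in> e \<Longrightarrow> b i = b' i) \<Longrightarrow> ratio h v b = ratio h v b'"
proof -
  assume eq: "\<And>i. i \<in> e \<Longrightarrow> b i = b' i"
  have "positions e b = positions e b'" using eq by (auto simp: positions_def)
  moreover have "link_model b = link_model b'"
    unfolding link_model_def dens_prod_def mon_def
    using eq by (intro prod.cong refl arg_cong2[of _ _ _ _ power]) auto
  ultimately show ?thesis by (simp add: ratio_def)
qed

lemma ratio_zero:
  assumes "\<And>i. i \<in> e \<Longrightarrow> b i = 0"
  shows "ratio \<gamma> v b = root_weight v"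
proof -
  have "positions e b = {}" using assms by (auto simp: positions_def)
  moreover have "mon b f = 0" if f: "f \<in> Pow e - {{}}" for f
  proof -
    obtain i where "i \<in> f" using f by auto
    then show ?thesis using f assms fin_e finite_subset by (intro mon_zero[of f i b]) auto
  qed
  then have "link_model b = 1"
    by (simp add: link_model_def dens_prod_def)
  moreover have "faces ({} :: ('j \<times> nat) set) = {{}}" by (auto simp: faces_def)
  ultimately show ?thesis
    by (simp add: ratio_def cnt_def tuples_def weight_def link_def root_weight_def)
qed

lemma mean_ratio:
  assumes "b x = 0"
  shows "(\<Sum>v\<in>V x. ratio h v b) / real (card (V x)) = nrm h (b(x := 1)) * (\<kappa> * p {x})"
proof -
  have "(\<Sum>v\<in>V x. ratio h v b) / real (card (V x)) = cnt V h (positions (insert x e) (b(x := 1))) / link_model b"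
    unfolding cnt_root[of b, OF assms] ratio_def by (simp add: sum_divide_distrib mult.commute)
  also have "\<dots> = nrm h (b(x := 1)) * (\<kappa> * p {x})"
    unfolding nrm_def model_root[of b, OF assms] using kappa_pos p_pos[of "{x}"] by simp
  finally show ?thesis .
qed

lemma ratio_nonneg: "v \<in> V x \<Longrightarrow> 0 \<le> ratio (hy U) v b"
  and ratio_mono: "v \<in> V x \<Longrightarrow> ratio (hy U) v b \<le> ratio \<gamma> v b"
proof -
  interpret E: modelled e V 1 link_p by (rule modelled_link) simp
  have X: "finite (positions e b)" "fst ` positions e b \<subseteq> e"
    using fin_e by (auto simp: finite_positions positions_def)
  show "0 \<le> ratio (hy U) v b" if "v \<in> V x"
    unfolding ratio_def using link_model_pos[of b] link_hy[OF that]
    by (intro divide_nonneg_pos E.count_nonneg X) auto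
  show "ratio (hy U) v b \<le> ratio \<gamma> v b" if "v \<in> V x"
    unfolding ratio_def using link_model_pos[of b] link_hy[OF that]
    by (intro divide_right_mono E.count_mono X) auto
qed

lemma ratio_log_convex:
  assumes "v \<in> V x" "i \<in> e"
  shows "(ratio (hy U) v (b(i := 1)))\<^sup>2 \<le> ratio (hy U) v (b(i := 0)) * ratio (hy U) v (b(i := 2))"
proof -
  interpret E: modelled e V 1 link_p by (rule modelled_link) simp
  have "E.nrm (link v (hy U)) b = ratio (hy U) v b" for b
    by (simp add: E.nrm_def E.model_def E.types_def ratio_def link_model_def)
  then show ?thesis
    using E.nrm_log_convex[of "link v (hy U)" i b] link_hy[OF assms(1)] assms(2) by simp
qed

lemma ratio_concentration:
  assumes \<gamma>1: "\<And>a. (\<And>i. a i \<le> 2) \<Longrightarrow> \<bar>nrm \<gamma> a - 1\<bar> \<le> \<xi>" and \<xi>: "0 \<le> \<xi>" "\<xi> \<le> 1"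
    and b: "\<And>i. b i \<le> 2" "b x = 0"
  shows "(\<Sum>v\<in>V x. \<bar>ratio \<gamma> v b - root_weight v\<bar>) / real (card (V x))
    \<le> 20 * real (card {i \<in> e. 0 < b i}) * sqrt \<xi> * (\<kappa> * p {x})"
  using b
proof (induction "card {i \<in> e. 0 < b i}" arbitrary: b)
  case 0
  have "finite {i \<in> e. 0 < b i}" using fin_e by simp
  with 0(1) have none: "{i \<in> e. 0 < b i} = {}" by (metis card_0_eq)
  have z: "b i = 0" if "i \<in> e" for i
  proof (rule ccontr)
    assume "b i \<noteq> 0"
    then have "i \<in> {i \<in> e. 0 < b i}" using that by simp
    then show False unfolding none by simp
  qed
  have "ratio \<gamma> v b = root_weight v" for v
    by (rule ratio_zero) (rule z)
  then show ?case using \<xi> kappa_pos p_pos[of "{x}"] by simp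
next
  case (Suc m)
  let ?N = "real (card (V x))" and ?M = "\<kappa> * p {x}"
  have M: "0 < ?M" using kappa_pos p_pos[of "{x}"] by simp
  have "{i \<in> e. 0 < b i} \<noteq> {}" using Suc.hyps(2) by (metis card.empty nat.distinct(1))
  then obtain i where i: "i \<in> e" "0 < b i" by auto
  have ix: "i \<noteq> x" using i x_notin by auto
  define a where "a = b(i := 0)"
  define n where "n = b i"
  have n: "n = 1 \<or> n = 2" using i Suc.prems(1)[of i] by (auto simp: n_def)
  have ab: "b = a(i := n)" "a(i := 0) = a" by (auto simp: a_def n_def)
  have a: "a j \<le> 2" "a x = 0" for j using Suc.prems ix by (auto simp: a_def)
  define X where "X n v = ratio \<gamma> v (a(i := n)) / ?N" for n v
  have nn: "0 \<le> ratio \<gamma> v c" if "v \<in> V x" for v c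
    using ratio_nonneg[OF that, of "{}"] by (simp add: hyb_empty)
  have lc: "(X 1 v)\<^sup>2 \<le> X 0 v * X 2 v" if "v \<in> V x" for v
    using ratio_log_convex[OF that i(1), of "{}" a]
    by (simp add: X_def hyb_empty power_divide power2_eq_square divide_right_mono)
  have mean: "\<bar>(\<Sum>v\<in>V x. X n v) - ?M\<bar> \<le> \<xi> * ?M" if "n \<le> 2" for n
  proof -
    have "(\<Sum>v\<in>V x. X n v) = nrm \<gamma> ((a(i := n))(x := 1)) * ?M"
      unfolding X_def sum_divide_distrib[symmetric] by (rule mean_ratio) (use a ix in simp)
    moreover have "\<bar>nrm \<gamma> ((a(i := n))(x := 1)) - 1\<bar> \<le> \<xi>"
      by (rule \<gamma>1) (use a that in simp)
    then have "\<bar>nrm \<gamma> ((a(i := n))(x := 1)) - 1\<bar> * ?M \<le> \<xi> * ?M"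
      using M by (intro mult_right_mono) auto
    ultimately show ?thesis by (simp only: abs_mult_minus[OF M])
  qed
  have "(\<Sum>v\<in>V x. \<bar>X n v - X 0 v\<bar>) \<le> 20 * sqrt \<xi> * ?M"
    using n log_convex_concentration[of "V x" "X 0" "X 1" "X 2" ?M 1 \<xi>] nn lc \<xi> M
      mean[of 0] mean[of 1] mean[of 2]
    by (auto simp: X_def)
  then have A: "(\<Sum>v\<in>V x. \<bar>ratio \<gamma> v b - ratio \<gamma> v a\<bar>) / ?N \<le> 20 * sqrt \<xi> * ?M"
    by (simp add: X_def sum_divide_distrib ab(1)[symmetric] ab(2) diff_divide_distrib[symmetric])
  have "{j \<in> e. 0 < b j} = insert i {j \<in> e. 0 < a j}" using i by (auto simp: a_def)
  moreover have "finite {j \<in> e. 0 < a j}" "i \<notin> {j \<in> e. 0 < a j}" using fin_e by (auto simp: a_def)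
  ultimately have cm: "m = card {j \<in> e. 0 < a j}"
    using Suc.hyps(2) by (simp only: card_insert_disjoint) simp
  have B: "(\<Sum>v\<in>V x. \<bar>ratio \<gamma> v a - root_weight v\<bar>) / ?N \<le> 20 * real m * sqrt \<xi> * ?M"
    unfolding cm by (rule Suc.hyps(1)[OF cm]) (use a in auto)
  have "(\<Sum>v\<in>V x. \<bar>ratio \<gamma> v b - root_weight v\<bar>) / ?N
      \<le> (\<Sum>v\<in>V x. \<bar>ratio \<gamma> v b - ratio \<gamma> v a\<bar>) / ?N + (\<Sum>v\<in>V x. \<bar>ratio \<gamma> v a - root_weight v\<bar>) / ?N"
    unfolding add_divide_distrib[symmetric] sum.distrib[symmetric]
    by (intro divide_right_mono sum_mono) auto
  also have "\<dots> \<le> 20 * real (Suc m) * sqrt \<xi> * ?M"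
    using A B by (simp add: algebra_simps)
  finally show ?case unfolding Suc.hyps(2)[symmetric] .
qed

end

lemma convexity_defect:
  fixes \<alpha> \<beta> \<tau> D :: real
  assumes "0 \<le> \<alpha>" "0 \<le> \<beta>" "\<beta> \<le> 2" "0 \<le> \<tau>" "real q * \<tau> \<le> 1" "0 \<le> D" "2 \<le> q"
    and "\<alpha> ^ q \<le> (1 + \<tau>) ^ q * \<beta>"
  shows "D ^ (q - 2) * (\<alpha> - D)\<^sup>2 \<le> \<beta> + 4 * real q * \<tau> - D ^ q - real q * D ^ (q - 1) * (\<alpha> - D)"
proof -
  have "(1 + \<tau>) ^ q * \<beta> \<le> (1 + 2 * real q * \<tau>) * \<beta>"
    using assms one_plus_power_le by (intro mult_right_mono) auto
  also have "\<dots> \<le> \<beta> + 2 * real q * \<tau> * 2"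
    using assms mult_left_mono[of \<beta> 2 "2 * real q * \<tau>"] by (simp add: algebra_simps)
  finally have up: "\<alpha> ^ q \<le> \<beta> + 4 * real q * \<tau>" using assms by simp
  obtain n where n: "q = n + 2" using assms(7) by (metis add.commute le_Suc_ex)
  show ?thesis
    using power_tangent[OF assms(1,6), of n] up unfolding n by simp
qed

context vertex_link
begin

context
  fixes d d' \<epsilon> \<epsilon>' \<sigma> \<delta> \<eta> L :: real
  assumes \<gamma>1: "\<And>a. (\<And>i. a i \<le> 2) \<Longrightarrow> \<bar>nrm \<gamma> a - 1\<bar> \<le> \<sigma> ^ 16"
    and e_low: "(d - \<epsilon>) * nrm \<gamma> (uni e 1) \<le> nrm (hy {e}) (uni e 1)"
    and e_up: "nrm (hy {e}) (uni e 2) \<le> (d ^ 2 ^ card e + \<epsilon>) * nrm \<gamma> (uni e 2)"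
    and xe_low: "(d' - \<epsilon>') * nrm \<gamma> (uni (insert x e) 1) \<le> nrm (hy {insert x e}) (uni (insert x e) 1)"
    and xe_up: "nrm (hy {insert x e}) (uni (insert x e) 2)
        \<le> (d' ^ 2 ^ card (insert x e) + \<epsilon>') * nrm \<gamma> (uni (insert x e) 2)"
    and eps: "0 \<le> \<epsilon>" "\<epsilon> \<le> \<sigma> ^ 16" "0 \<le> \<epsilon>'" "\<epsilon>' \<le> \<sigma> ^ 16"
    and dens: "0 < \<delta>" "\<delta> \<le> d * d'" "0 \<le> d" "d \<le> 1" "0 \<le> d'" "d' \<le> 1"
    and \<sigma>0: "0 < \<sigma>" and \<eta>: "0 < \<eta>" "\<eta> \<le> 1"
    and small: "L * \<sigma> \<le> \<delta> ^ 2 ^ (card e + 1) * \<eta>"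
    and L: "100 * (real (card e) + 1) * 6 ^ card e \<le> L"
begin

abbreviation (input) "D \<equiv> d * d'"
abbreviation (input) "q \<equiv> (2::nat) ^ card e"
abbreviation (input) "U \<equiv> {e, insert x e}"

lemma card_e: "1 \<le> card e"
  using e_ne fin_e by (simp add: Suc_le_eq card_gt_0_iff)

lemma \<delta>_le: "\<delta> \<le> d" "\<delta> \<le> d'" "\<delta> \<le> 1" "D \<le> 1"
  using dens mult_right_le_one_le[of d d'] mult_left_le_one_le[of d' d] by linarith+

lemma L_bounds: "100 * real q \<le> L" "20 * real (card e) * 3 ^ card e \<le> L"
proof -
  have "(1::real) \<le> 3 ^ card e" "(1::real) \<le> 2 ^ card e" by simp_all
  then have six: "(2::real) ^ card e \<le> 6 ^ card e" "(3::real) ^ card e \<le> 6 ^ card e"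
    by (auto intro: power_mono)
  have "100 * real q \<le> 100 * (real (card e) + 1) * 6 ^ card e"
    using six by (intro mult_mono) auto
  then show "100 * real q \<le> L" using L by linarith
  have "20 * real (card e) * 3 ^ card e \<le> 100 * (real (card e) + 1) * 6 ^ card e"
    using six by (intro mult_mono) auto
  then show "20 * real (card e) * 3 ^ card e \<le> L" using L by linarith
qed

lemma \<sigma>_bounds: "L * \<sigma> \<le> \<eta>" "L * \<sigma> \<le> \<delta> ^ 2 ^ (card e + 1)" "\<sigma> \<le> 1 / 100" "100 * real q * \<sigma> \<le> 1"
  "20 * real (card e) * 3 ^ card e * \<sigma> \<le> 1" "0 < L"
proof -
  have d1: "\<delta> ^ 2 ^ (card e + 1) \<le> 1" using dens \<delta>_le by (intro power_le_one) auto
  show A: "L * \<sigma> \<le> \<eta>"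
    using order.trans[OF small mult_right_mono[OF d1]] \<eta> by simp
  show "L * \<sigma> \<le> \<delta> ^ 2 ^ (card e + 1)"
  proof -
    have "\<delta> ^ 2 ^ (card e + 1) * \<eta> \<le> \<delta> ^ 2 ^ (card e + 1) * 1"
      using \<eta> dens by (intro mult_left_mono) auto
    from order.trans[OF small this] show ?thesis by (simp only: mult_1_right)
  qed
  have "100 * 1 \<le> 100 * real q" by simp
  then have "100 \<le> L" using L_bounds(1) by linarith
  then show "0 < L" by simp
  have "100 * \<sigma> \<le> L * \<sigma>" using \<open>100 \<le> L\<close> \<sigma>0 by (intro mult_right_mono) auto
  then show "\<sigma> \<le> 1 / 100" using A \<eta> by simp
  show "100 * real q * \<sigma> \<le> 1"
    using A \<eta> mult_right_mono[OF L_bounds(1), of \<sigma>] \<sigma>0 by linarith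
  show "20 * real (card e) * 3 ^ card e * \<sigma> \<le> 1"
    using A \<eta> mult_right_mono[OF L_bounds(2), of \<sigma>] \<sigma>0 by linarith
qed

lemma \<sigma>_pow: "i \<le> j \<Longrightarrow> \<sigma> ^ j \<le> \<sigma> ^ i"
  using \<sigma>0 \<sigma>_bounds(3) by (intro power_decreasing) auto

lemma single_error: "7 * real ((2::nat) ^ (card e + 1)) * \<sigma> ^ 16 / \<delta> ^ (2 ^ (card e + 1)) \<le> \<sigma> ^ 15"
proof -
  have "7 * real ((2::nat) ^ (card e + 1)) \<le> 100 * real q" by simp
  then have "7 * real ((2::nat) ^ (card e + 1)) * \<sigma> \<le> L * \<sigma>"
    using L_bounds(1) \<sigma>0 by (intro mult_right_mono) linarith+
  then have "7 * real ((2::nat) ^ (card e + 1)) * \<sigma> \<le> \<delta> ^ 2 ^ (card e + 1)"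
    using \<sigma>_bounds(2) by linarith
  then have "(7 * real ((2::nat) ^ (card e + 1)) * \<sigma>) * \<sigma> ^ 15 \<le> \<delta> ^ 2 ^ (card e + 1) * \<sigma> ^ 15"
    using \<sigma>0 by (intro mult_right_mono) auto
  also have "(7 * real ((2::nat) ^ (card e + 1)) * \<sigma>) * \<sigma> ^ 15 = 7 * real ((2::nat) ^ (card e + 1)) * \<sigma> ^ 16"
    by (simp add: power_Suc[symmetric] mult.assoc del: power_Suc)
  finally show ?thesis
    using dens(1) by (simp add: divide_le_eq mult.commute)
qed

lemma mean_link:
  assumes n: "n = 1 \<or> n = 2"
  shows "\<bar>nrm (hy U) ((uni e n)(x := 1)) - D ^ (n ^ card e)\<bar> \<le> 9 * \<sigma> ^ 7"
proof -
  let ?J = "insert x e" and ?Q = "(2::nat) ^ (card e + 1)" and ?b = "uni e n"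
  have Q\<sigma>: "real ?Q * \<sigma> ^ 16 \<le> 1"
  proof -
    have "real ?Q * \<sigma> ^ 16 \<le> real ?Q * \<sigma> ^ 1"
      using \<sigma>_pow[of 1 16] by (intro mult_left_mono) auto
    moreover have "real ?Q * \<sigma> \<le> 100 * real q * \<sigma>" using \<sigma>0 by (intro mult_right_mono) auto
    ultimately show ?thesis using \<sigma>_bounds(4) unfolding power_one_right by linarith
  qed
  have b: "?b x = 0" using x_notin by (simp add: uni_def)
  have J: "?J \<in> types" "e \<in> types" using e_ne by (auto simp: types_def)
  have monJ: "mon (?b(x := m)) ?J = m * n ^ card e" for m
  proof -
    have "(\<Prod>i\<in>e. (?b(x := m)) i) = (\<Prod>i\<in>e. n)"
      using x_notin by (intro prod.cong) (auto simp: uni_def)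
    then show ?thesis using x_notin fin_e by (simp add: mon_def)
  qed
  have xe: "\<bar>nrm (hy {?J}) (?b(x := m)) - d' ^ (m * n ^ card e)\<bar> \<le> \<sigma> ^ 15" if "m = 1 \<or> m = 2" for m
  proof -
    have "\<bar>nrm (hy {?J}) (?b(x := m)) - d' ^ mon (?b(x := m)) ?J\<bar> \<le> 7 * real ?Q * \<sigma> ^ 16 / \<delta> ^ ?Q"
    proof (rule nrm_single_type[OF J(1) _ xe_low xe_up \<gamma>1 _ _ _ _ _ Q\<sigma>])
      show "2 ^ card ?J \<le> ?Q" using x_notin fin_e by simp
    qed (use eps dens \<delta>_le n that in \<open>auto simp: uni_def\<close>)
    then show ?thesis using single_error unfolding monJ by linarith
  qed
  have e1: "\<bar>nrm (hy {e}) ?b - d ^ (n ^ card e)\<bar> \<le> \<sigma> ^ 15"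
  proof -
    have "\<bar>nrm (hy {e}) ?b - d ^ mon ?b e\<bar> \<le> 7 * real ?Q * \<sigma> ^ 16 / \<delta> ^ ?Q"
      by (rule nrm_single_type[OF J(2) _ e_low e_up \<gamma>1 _ _ _ _ _ Q\<sigma>])
        (use eps dens \<delta>_le n in \<open>auto simp: uni_def\<close>)
    moreover have "mon ?b e = n ^ card e" by (simp add: mon_def uni_def)
    ultimately show ?thesis using order.trans[OF _ single_error] by simp
  qed
  define D1 where "D1 = d' ^ (n ^ card e)"
  have D1: "0 \<le> D1" "D1 \<le> 1" using dens by (auto simp: D1_def power_le_one)
  have Ui: "{f \<in> U. x \<in> f} = {?J}" "{f \<in> U. x \<notin> f} = {e}" using x_notin by auto
  have s1: "\<sigma> ^ 15 \<le> 1" "\<sigma> ^ 16 \<le> 1" using \<sigma>_pow[of 0] by auto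
  have "\<bar>nrm (hy U) (?b(x := 1)) - D1 ^ 1 * nrm (hy {f \<in> U. x \<notin> f}) ?b\<bar> \<le> 5 * sqrt (\<sigma> ^ 15 + \<sigma> ^ 16)"
  proof (rule nrm_step)
    have "?b i \<le> 2" for i using n by (auto simp: uni_def)
    then show "nrm \<gamma> ?b \<le> 1 + \<sigma> ^ 16" using \<gamma>1[of ?b] by (simp add: abs_le_iff)
    show "D1 - \<sigma> ^ 15 \<le> nrm (hy {f \<in> U. x \<in> f}) (?b(x := 1))"
      using xe[of 1] unfolding Ui by (simp add: D1_def)
    show "nrm (hy {f \<in> U. x \<in> f}) (?b(x := 2)) \<le> D1\<^sup>2 + \<sigma> ^ 15"
      using xe[of 2] unfolding Ui by (simp add: D1_def power_even_eq)
  qed (use b D1 s1 \<sigma>0 in auto)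
  moreover have "5 * sqrt (\<sigma> ^ 15 + \<sigma> ^ 16) \<le> 8 * \<sigma> ^ 7"
  proof -
    have "\<sigma> ^ 15 + \<sigma> ^ 16 \<le> 2 * \<sigma> ^ 14" using \<sigma>_pow[of 14 15] \<sigma>_pow[of 14 16] by simp
    also have "\<dots> \<le> (8 / 5 * \<sigma> ^ 7)\<^sup>2"
      using \<sigma>0 by (simp add: power_mult_distrib power_mult[symmetric] power2_eq_square)
    finally have "sqrt (\<sigma> ^ 15 + \<sigma> ^ 16) \<le> 8 / 5 * \<sigma> ^ 7"
      using \<sigma>0 by (intro real_le_lsqrt) auto
    then show ?thesis by simp
  qed
  moreover have "\<bar>D1 * nrm (hy {e}) ?b - D1 * d ^ (n ^ card e)\<bar> \<le> \<sigma> ^ 7"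
  proof -
    have "\<bar>D1 * nrm (hy {e}) ?b - D1 * d ^ (n ^ card e)\<bar> = D1 * \<bar>nrm (hy {e}) ?b - d ^ (n ^ card e)\<bar>"
      using D1 by (simp add: abs_mult flip: right_diff_distrib)
    also have "\<dots> \<le> 1 * \<sigma> ^ 15" using D1 e1 by (intro mult_mono) auto
    also have "\<dots> \<le> \<sigma> ^ 7" using \<sigma>_pow[of 7 15] by simp
    finally show ?thesis .
  qed
  moreover have "D ^ (n ^ card e) = D1 * d ^ (n ^ card e)"
    by (simp add: D1_def power_mult_distrib mult.commute)
  ultimately show ?thesis unfolding Ui by simp
qed

definition good :: "'v set" where
  "good = {v \<in> V x. \<forall>b. (\<forall>i. b i \<le> 2) \<longrightarrow> \<bar>ratio \<gamma> v b - root_weight v\<bar> \<le> \<sigma> ^ 4 * root_weight v}"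

abbreviation (input) "mass \<equiv> real (card (V x)) * (\<kappa> * p {x})"

lemma mass_pos: "0 < mass"
  using card_V_pos[of x] kappa_pos p_pos[of "{x}"] by simp

lemma sum_ratio: "b x = 0 \<Longrightarrow> (\<Sum>v\<in>V x. ratio h v b) = nrm h (b(x := 1)) * mass"
  using mean_ratio[of b h] card_V_pos[of x] by (simp add: field_simps)

lemma root_weight_nonneg: "v \<in> V x \<Longrightarrow> 0 \<le> root_weight v"
  using ratio_nonneg[of v "{}" "\<lambda>_. 0"] ratio_zero[of "\<lambda>_. 0" v] by (simp add: hyb_empty)

lemma sum_root_weight: "\<bar>(\<Sum>v\<in>V x. root_weight v) - mass\<bar> \<le> \<sigma> ^ 16 * mass"
proof -
  have "(\<Sum>v\<in>V x. root_weight v) = nrm \<gamma> ((\<lambda>_. 0)(x := 1)) * mass"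
    using sum_ratio[of "\<lambda>_. 0" \<gamma>] ratio_zero[of "\<lambda>_. 0"] by simp
  moreover have "\<bar>nrm \<gamma> ((\<lambda>_. 0)(x := 1)) - 1\<bar> \<le> \<sigma> ^ 16" by (rule \<gamma>1) simp
  then have "\<bar>nrm \<gamma> ((\<lambda>_. 0)(x := 1)) - 1\<bar> * mass \<le> \<sigma> ^ 16 * mass"
    using mass_pos by (intro mult_right_mono) auto
  ultimately show ?thesis by (simp only: abs_mult_minus[OF mass_pos])
qed

lemma sum_ratio_deviation:
  assumes "\<And>i. b i \<le> 2" "b x = 0"
  shows "(\<Sum>v\<in>V x. \<bar>ratio \<gamma> v b - root_weight v\<bar>) \<le> 20 * real (card e) * \<sigma> ^ 8 * mass"
proof -
  have "(\<Sum>v\<in>V x. \<bar>ratio \<gamma> v b - root_weight v\<bar>) / real (card (V x))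
    \<le> 20 * real (card {i \<in> e. 0 < b i}) * sqrt (\<sigma> ^ 16) * (\<kappa> * p {x})"
    by (rule ratio_concentration) (use \<gamma>1 \<sigma>0 \<sigma>_pow[of 0 16] assms in auto)
  also have "\<dots> \<le> 20 * real (card e) * \<sigma> ^ 8 * (\<kappa> * p {x})"
  proof -
    have "sqrt (\<sigma> ^ 16) = \<sigma> ^ 8" using \<sigma>0 by (intro real_sqrt_unique) (auto simp flip: power_mult)
    moreover have "card {i \<in> e. 0 < b i} \<le> card e" using fin_e by (intro card_mono) auto
    ultimately show ?thesis
      using \<sigma>0 kappa_pos p_pos[of "{x}"] by (auto intro!: mult_right_mono)
  qed
  finally show ?thesis using card_V_pos[of x] by (simp add: field_simps)
qed

lemma sum_not_good: "(\<Sum>v\<in>V x - good. root_weight v) \<le> \<sigma> ^ 3 * mass"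
proof -
  define ext where "ext s = (\<lambda>i. if i \<in> e then s i else (0::nat))" for s
  let ?S = "PiE e (\<lambda>_. {..2::nat})"
  let ?dev = "\<lambda>v s. \<bar>ratio \<gamma> v (ext s) - root_weight v\<bar>"
  have finS: "finite ?S" and cardS: "card ?S = 3 ^ card e"
    using fin_e by (auto simp: finite_PiE card_PiE)
  have fV: "finite (V x)" using finV by simp
  have pt: "\<sigma> ^ 4 * root_weight v \<le> (\<Sum>s\<in>?S. ?dev v s)" if v: "v \<in> V x - good" for v
  proof -
    obtain b where b: "\<And>i. b i \<le> 2" "\<sigma> ^ 4 * root_weight v < \<bar>ratio \<gamma> v b - root_weight v\<bar>"
      using v by (auto simp: good_def not_le)
    have s: "restrict b e \<in> ?S" using b(1) by auto
    have "ratio \<gamma> v b = ratio \<gamma> v (ext (restrict b e))"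
      by (rule ratio_cong) (simp add: ext_def)
    then have "\<sigma> ^ 4 * root_weight v \<le> ?dev v (restrict b e)" using b by simp
    also have "\<dots> \<le> (\<Sum>s\<in>?S. ?dev v s)"
      using member_le_sum[OF s, of "?dev v"] finS by auto
    finally show ?thesis .
  qed
  have "\<sigma> ^ 4 * (\<Sum>v\<in>V x - good. root_weight v) \<le> (\<Sum>v\<in>V x - good. \<Sum>s\<in>?S. ?dev v s)"
    unfolding sum_distrib_left using pt by (rule sum_mono)
  also have "\<dots> \<le> (\<Sum>v\<in>V x. \<Sum>s\<in>?S. ?dev v s)"
    using fV by (intro sum_mono2) (auto intro!: sum_nonneg)
  also have "\<dots> = (\<Sum>s\<in>?S. \<Sum>v\<in>V x. ?dev v s)" by (rule sum.swap)
  also have "\<dots> \<le> (\<Sum>s\<in>?S. 20 * real (card e) * \<sigma> ^ 8 * mass)"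
    using x_notin by (intro sum_mono sum_ratio_deviation) (auto simp: ext_def PiE_def Pi_def)
  also have "\<dots> = (20 * real (card e) * 3 ^ card e * \<sigma>) * (\<sigma> ^ 7 * mass)"
    using cardS by (simp add: power_numeral_reduce mult_ac)
  also have "\<dots> \<le> 1 * (\<sigma> ^ 7 * mass)"
    using \<sigma>_bounds(5) mass_pos \<sigma>0 by (intro mult_right_mono) auto
  also have "\<dots> = \<sigma> ^ 4 * (\<sigma> ^ 3 * mass)" by (simp flip: power_add)
  finally show ?thesis by (rule mult_left_le_imp_le) (use \<sigma>0 in simp)
qed

text \<open>The excess of the octahedron count of a link over the tangent of \<open>y ^ q\<close> at the expected
  density, scaled by the weight of the root.\<close>

definition defect :: "'v \<Rightarrow> real" where
  "defect v = ratio (hy U) v (uni e 2) + 4 * real q * \<sigma> ^ 4 * root_weight v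
     - D ^ q * root_weight v
     - real q * D ^ (q - 1) * (ratio (hy U) v (uni e 1) - D * root_weight v)"

lemma good_link_doubling:
  assumes v: "v \<in> good" and m: "0 < root_weight v"
  shows "(ratio (hy U) v (uni e 1) / root_weight v) ^ q
      \<le> (1 + \<sigma> ^ 4) ^ q * (ratio (hy U) v (uni e 2) / root_weight v)"
proof -
  interpret E: modelled e V "root_weight v" link_p by (rule modelled_link[OF m])
  have vV: "v \<in> V x" using v by (simp add: good_def)
  have nrm: "E.nrm (link v h) b = ratio h v b / root_weight v" for h b
    by (simp add: E.nrm_def E.model_def E.types_def ratio_def link_model_def)
  have "E.nrm (link v (hy U)) (uni e 1) ^ 2 ^ card e
      \<le> (1 + \<sigma> ^ 4) ^ 2 ^ card e * E.nrm (link v (hy U)) (\<lambda>j. if j \<in> e then 2 else uni e 1 j)"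
  proof (rule E.nrm_doubling)
    fix i b assume b: "\<And>j::'j. b j \<le> (2::nat)"
    have "ratio (hy U) v b \<le> ratio \<gamma> v b" by (rule ratio_mono[OF vV])
    moreover have "\<bar>ratio \<gamma> v b - root_weight v\<bar> \<le> \<sigma> ^ 4 * root_weight v"
      using v b by (auto simp: good_def)
    ultimately show "E.nrm (link v (hy U)) b \<le> 1 + \<sigma> ^ 4"
      unfolding nrm using m by (simp add: divide_le_eq algebra_simps)
  qed (use link_hy[OF vV] \<sigma>0 in \<open>auto simp: uni_def\<close>)
  moreover have "(\<lambda>j. if j \<in> e then 2 else uni e 1 j) = uni e 2" by (auto simp: uni_def)
  ultimately show ?thesis by (simp add: nrm)
qed

lemma \<tau>_bounds: "0 \<le> \<sigma> ^ 4" "\<sigma> ^ 4 \<le> 1 / 100" "real q * \<sigma> ^ 4 \<le> 1"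
proof -
  show "0 \<le> \<sigma> ^ 4" using \<sigma>0 by simp
  show "\<sigma> ^ 4 \<le> 1 / 100" using \<sigma>_pow[of 1 4] \<sigma>_bounds(3) by simp
  have "real q * \<sigma> ^ 4 \<le> real q * \<sigma>" using \<sigma>_pow[of 1 4] by (intro mult_left_mono) auto
  moreover have "real q * \<sigma> \<le> 100 * real q * \<sigma>" using \<sigma>0 by (intro mult_right_mono) auto
  ultimately show "real q * \<sigma> ^ 4 \<le> 1" using \<sigma>_bounds(4) by linarith
qed

lemma q2: "2 \<le> q"
  using card_e power_increasing[of 1 "card e" "2::nat"] by simp

lemma uni_le: "uni e 1 i \<le> 2" "uni e 2 i \<le> 2" and uni_x: "uni e n x = 0"
  using x_notin by (auto simp: uni_def)

lemma good_dev:
  assumes "v \<in> good"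
  shows "\<bar>ratio \<gamma> v (uni e 1) - root_weight v\<bar> \<le> \<sigma> ^ 4 * root_weight v"
    and "\<bar>ratio \<gamma> v (uni e 2) - root_weight v\<bar> \<le> \<sigma> ^ 4 * root_weight v"
  using assms uni_le by (auto simp: good_def)

lemma good_zero:
  assumes "v \<in> good" "root_weight v = 0"
  shows "ratio \<gamma> v (uni e 1) = 0" "ratio \<gamma> v (uni e 2) = 0"
    "ratio (hy U) v (uni e 1) = 0" "ratio (hy U) v (uni e 2) = 0"
proof -
  have vV: "v \<in> V x" using assms by (simp add: good_def)
  show g: "ratio \<gamma> v (uni e 1) = 0" "ratio \<gamma> v (uni e 2) = 0"
    using good_dev[OF assms(1)] assms(2) by auto
  show "ratio (hy U) v (uni e 1) = 0" "ratio (hy U) v (uni e 2) = 0"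
    using ratio_nonneg[OF vV, of U] ratio_mono[OF vV, of U] g by (metis order_antisym)+
qed

lemma defect_normalised:
  assumes v: "v \<in> good" and m: "0 < root_weight v"
  defines "\<alpha> \<equiv> ratio (hy U) v (uni e 1) / root_weight v"
    and "\<beta> \<equiv> ratio (hy U) v (uni e 2) / root_weight v"
  shows "defect v = (\<beta> + 4 * real q * \<sigma> ^ 4 - D ^ q - real q * D ^ (q - 1) * (\<alpha> - D)) * root_weight v"
    and "D ^ (q - 2) * (\<alpha> - D)\<^sup>2 \<le> \<beta> + 4 * real q * \<sigma> ^ 4 - D ^ q - real q * D ^ (q - 1) * (\<alpha> - D)"
proof -
  have vV: "v \<in> V x" using v by (simp add: good_def)
  have a: "\<alpha> * root_weight v = ratio (hy U) v (uni e 1)" and b: "\<beta> * root_weight v = ratio (hy U) v (uni e 2)"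
    using m by (auto simp: \<alpha>_def \<beta>_def)
  show "defect v = (\<beta> + 4 * real q * \<sigma> ^ 4 - D ^ q - real q * D ^ (q - 1) * (\<alpha> - D)) * root_weight v"
    unfolding defect_def a[symmetric] b[symmetric] by (simp add: algebra_simps)
  have "ratio (hy U) v (uni e 2) \<le> ratio \<gamma> v (uni e 2)" by (rule ratio_mono[OF vV])
  also have "\<dots> \<le> 2 * root_weight v"
    using good_dev(2)[OF v] mult_right_mono[OF \<tau>_bounds(2), of "root_weight v"] m by linarith
  finally have "\<beta> \<le> 2" using m by (simp add: \<beta>_def divide_le_eq)
  moreover have "0 \<le> \<alpha>" "0 \<le> \<beta>" using m ratio_nonneg[OF vV] by (auto simp: \<alpha>_def \<beta>_def)
  ultimately show "D ^ (q - 2) * (\<alpha> - D)\<^sup>2 \<le> \<beta> + 4 * real q * \<sigma> ^ 4 - D ^ q - real q * D ^ (q - 1) * (\<alpha> - D)"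
    using good_link_doubling[OF v m] \<tau>_bounds q2 dens
    by (intro convexity_defect) (auto simp: \<alpha>_def \<beta>_def)
qed

lemma defect_nonneg:
  assumes v: "v \<in> good"
  shows "0 \<le> defect v"
proof (cases "root_weight v = 0")
  case True
  then show ?thesis using good_zero[OF v] by (simp add: defect_def)
next
  case False
  then have m: "0 < root_weight v" using v root_weight_nonneg by (force simp: good_def)
  have "0 \<le> D ^ (q - 2) * (ratio (hy U) v (uni e 1) / root_weight v - D)\<^sup>2"
    using dens by (intro mult_nonneg_nonneg) auto
  from order.trans[OF this defect_normalised(2)[OF v m]] show ?thesis
    unfolding defect_normalised(1)[OF v m] using m by (intro mult_nonneg_nonneg) auto
qed

lemma small_defect_regular:
  assumes v: "v \<in> good" and def: "defect v \<le> \<sigma>\<^sup>2 * root_weight v"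
  shows "\<bar>ratio (hy U) v (uni e 1) - D * ratio \<gamma> v (uni e 1)\<bar> \<le> \<eta> * ratio \<gamma> v (uni e 1)"
    and "ratio (hy U) v (uni e 2) \<le> (D ^ q + \<eta>) * ratio \<gamma> v (uni e 2)"
proof -
  let ?m = "root_weight v"
  let ?a = "ratio (hy U) v (uni e 1)" and ?b = "ratio (hy U) v (uni e 2)"
  have "?m \<ge> 0" using v root_weight_nonneg by (auto simp: good_def)
  consider "?m = 0" | "0 < ?m" using \<open>?m \<ge> 0\<close> by linarith
  then have "\<bar>?a - D * ratio \<gamma> v (uni e 1)\<bar> \<le> \<eta> * ratio \<gamma> v (uni e 1)
     \<and> ?b \<le> (D ^ q + \<eta>) * ratio \<gamma> v (uni e 2)"
  proof cases
    case 1
    then show ?thesis using good_zero[OF v] by simp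
  next
    case 2
    define \<alpha> where "\<alpha> = ?a / ?m"
    define \<beta> where "\<beta> = ?b / ?m"
    define \<theta> where "\<theta> = \<eta> / L"
    have ab: "?a = \<alpha> * ?m" "?b = \<beta> * ?m" using 2 by (auto simp: \<alpha>_def \<beta>_def)
    have \<theta>: "0 < \<theta>" "\<sigma> \<le> \<theta>" "\<sigma> \<le> \<delta> ^ 2 ^ (card e + 1) * \<theta>" "100 * real q * \<theta> \<le> \<eta>" "100 * \<theta> \<le> \<eta>"
    proof -
      show "0 < \<theta>" using \<eta> \<sigma>_bounds(6) by (simp add: \<theta>_def)
      show "\<sigma> \<le> \<theta>" using \<sigma>_bounds(1,6) by (simp add: \<theta>_def field_simps)
      show "\<sigma> \<le> \<delta> ^ 2 ^ (card e + 1) * \<theta>"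
        using small \<sigma>_bounds(6) by (simp add: \<theta>_def le_divide_eq mult.commute)
      show A: "100 * real q * \<theta> \<le> \<eta>"
        using mult_right_mono[OF L_bounds(1), of \<eta>] \<eta> \<sigma>_bounds(6) by (simp add: \<theta>_def divide_le_eq mult.commute)
      have "100 * 1 * \<theta> \<le> 100 * real q * \<theta>" using \<open>0 < \<theta>\<close> by (intro mult_right_mono) auto
      with A show "100 * \<theta> \<le> \<eta>" by linarith
    qed
    define \<psi> where "\<psi> = \<beta> + 4 * real q * \<sigma> ^ 4 - D ^ q - real q * D ^ (q - 1) * (\<alpha> - D)"
    have "\<psi> * ?m \<le> \<sigma>\<^sup>2 * ?m"
      using def unfolding defect_normalised(1)[OF v 2] \<psi>_def \<alpha>_def \<beta>_def .
    then have \<psi>: "\<psi> \<le> \<sigma>\<^sup>2" using 2 by simp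
    have "\<delta> ^ 2 ^ (card e + 1) * (\<alpha> - D)\<^sup>2 \<le> D ^ (q - 2) * (\<alpha> - D)\<^sup>2"
    proof (intro mult_right_mono)
      have "\<delta> ^ 2 ^ (card e + 1) \<le> \<delta> ^ (q - 2)"
        using dens \<delta>_le by (intro power_decreasing) auto
      also have "\<dots> \<le> D ^ (q - 2)" using dens by (intro power_mono) auto
      finally show "\<delta> ^ 2 ^ (card e + 1) \<le> D ^ (q - 2)" .
    qed auto
    also have "\<dots> \<le> \<psi>" unfolding \<psi>_def \<alpha>_def \<beta>_def by (rule defect_normalised(2)[OF v 2])
    also have "\<dots> \<le> \<sigma> * \<sigma>" using \<psi> by (simp add: power2_eq_square)
    also have "\<dots> \<le> (\<delta> ^ 2 ^ (card e + 1) * \<theta>) * \<theta>"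
      using \<theta> \<sigma>0 dens by (intro mult_mono) auto
    also have "\<dots> = \<delta> ^ 2 ^ (card e + 1) * \<theta>\<^sup>2" by (simp add: power2_eq_square)
    finally have "(\<alpha> - D)\<^sup>2 \<le> \<theta>\<^sup>2"
      by (rule mult_left_le_imp_le) (use dens in simp)
    then have aD: "\<bar>\<alpha> - D\<bar> \<le> \<theta>" using \<theta>(1) by (simp add: power2_le_iff_abs_le)
    have s\<theta>: "\<sigma> ^ 4 \<le> \<theta>" "\<sigma>\<^sup>2 \<le> \<theta>"
      using \<sigma>_pow[of 1 4] \<sigma>_pow[of 1 2] \<theta>(2) by auto
    have D01: "0 \<le> D" "D \<le> 1" using dens \<delta>_le by auto
    define y1 where "y1 = ratio \<gamma> v (uni e 1)"
    define y2 where "y2 = ratio \<gamma> v (uni e 2)"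
    have y: "\<bar>y1 - ?m\<bar> \<le> \<theta> * ?m" "\<bar>y2 - ?m\<bar> \<le> \<theta> * ?m"
    proof -
      have "\<sigma> ^ 4 * ?m \<le> \<theta> * ?m" using s\<theta>(1) 2 by (intro mult_right_mono) auto
      then show "\<bar>y1 - ?m\<bar> \<le> \<theta> * ?m" "\<bar>y2 - ?m\<bar> \<le> \<theta> * ?m"
        unfolding y1_def y2_def using good_dev[OF v] by linarith+
    qed
    have \<theta>m: "\<theta> * ?m \<le> \<eta> / 100 * ?m" using \<theta>(5) 2 by (intro mult_right_mono) auto
    have "\<eta> / 100 * ?m \<le> 1 / 100 * ?m" using \<eta> 2 by (intro mult_right_mono) auto
    then have yge: "y1 \<ge> 1/2 * ?m" "y2 \<ge> 1/2 * ?m" using y \<theta>m 2 unfolding abs_le_iff by linarith+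
    have "\<bar>?a - D * y1\<bar> \<le> \<bar>\<alpha> - D\<bar> * ?m + D * \<bar>y1 - ?m\<bar>"
    proof -
      have "?a - D * y1 = (\<alpha> - D) * ?m - D * (y1 - ?m)" unfolding ab by (simp add: algebra_simps)
      then have "\<bar>?a - D * y1\<bar> \<le> \<bar>(\<alpha> - D) * ?m\<bar> + \<bar>D * (y1 - ?m)\<bar>" by linarith
      then show ?thesis
        using 2 D01(1) by (simp only: abs_mult[of "\<alpha> - D"] abs_mult[of D] abs_of_pos[of ?m] abs_of_nonneg[of D])
    qed
    also have "\<dots> \<le> \<theta> * ?m + 1 * (\<theta> * ?m)"
      using aD y(1) D01 2 by (intro add_mono mult_mono) auto
    also have "\<dots> \<le> \<eta> * (1/2 * ?m)" using \<theta>m \<eta> 2 by simp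
    also have "\<dots> \<le> \<eta> * y1" using yge \<eta> by (intro mult_left_mono) auto
    finally have c1: "\<bar>?a - D * y1\<bar> \<le> \<eta> * y1" .
    have "real q * D ^ (q - 1) * (\<alpha> - D) \<le> real q * 1 * \<theta>"
    proof (cases "\<alpha> \<le> D")
      case True
      then have "real q * D ^ (q - 1) * (\<alpha> - D) \<le> 0"
        using D01 by (intro mult_nonneg_nonpos) auto
      then show ?thesis using \<theta>(1) by (smt (verit) mult_nonneg_nonneg of_nat_0_le_iff)
    next
      case False
      have "real q * D ^ (q - 1) * (\<alpha> - D) \<le> real q * 1 * \<theta>"
        using False aD D01 by (intro mult_mono power_le_one) auto
      then show ?thesis .
    qed
    moreover have "0 \<le> 4 * real q * \<sigma> ^ 4" using \<sigma>0 by simp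
    ultimately have "\<beta> \<le> D ^ q + real q * \<theta> + \<theta>"
      using \<psi> s\<theta>(2) unfolding \<psi>_def by linarith
    also have "\<dots> \<le> D ^ q + \<eta> / 50" using \<theta> by linarith
    finally have "?b \<le> (D ^ q + \<eta> / 50) * ?m" unfolding ab using 2 by (intro mult_right_mono) auto
    also have "\<dots> \<le> (D ^ q + \<eta>) * y2"
    proof -
      have "D ^ q * (?m - y2) \<le> D ^ q * \<bar>y2 - ?m\<bar>"
        using D01 by (intro mult_left_mono) auto
      also have "\<dots> \<le> 1 * (\<theta> * ?m)"
        using y(2) D01 by (intro mult_mono power_le_one) auto
      finally have "D ^ q * (?m - y2) \<le> 1 * (\<theta> * ?m)" .
      moreover have "\<eta> * (1/2 * ?m) \<le> \<eta> * y2" using yge \<eta> by (intro mult_left_mono) auto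
      moreover have "0 \<le> \<eta> * ?m" using \<eta> 2 by simp
      ultimately show ?thesis using \<theta>m by (simp add: algebra_simps)
    qed
    finally show ?thesis using c1 by (simp add: y1_def y2_def)
  qed
  then show "\<bar>?a - D * ratio \<gamma> v (uni e 1)\<bar> \<le> \<eta> * ratio \<gamma> v (uni e 1)"
    "?b \<le> (D ^ q + \<eta>) * ratio \<gamma> v (uni e 2)" by auto
qed

lemma sum_defect: "(\<Sum>v\<in>good. defect v) \<le> 32 * real q * \<sigma> ^ 3 * mass"
proof -
  let ?r = "\<lambda>v. root_weight v" and ?a = "\<lambda>v. ratio (hy U) v (uni e 1)" and ?b = "\<lambda>v. ratio (hy U) v (uni e 2)"
  have fV: "finite (V x)" using finV by simp
  have gV: "good \<subseteq> V x" by (auto simp: good_def)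
  have split: "(\<Sum>v\<in>V x. f v) = (\<Sum>v\<in>good. f v) + (\<Sum>v\<in>V x - good. f v)" for f :: "'v \<Rightarrow> real"
    using sum.subset_diff[OF gV fV, of f] by simp
  have notgood: "0 \<le> (\<Sum>v\<in>V x - good. ?r v)" "(\<Sum>v\<in>V x - good. ?r v) \<le> \<sigma> ^ 3 * mass"
    "0 \<le> (\<Sum>v\<in>V x - good. ?b v)"
    using sum_not_good by (auto intro!: sum_nonneg root_weight_nonneg ratio_nonneg)
  have p: "\<sigma> ^ 7 * mass \<le> \<sigma> ^ 3 / 100 * mass" "\<sigma> ^ 4 * mass \<le> \<sigma> ^ 3 * mass" "\<sigma> ^ 16 * mass \<le> \<sigma> ^ 3 * mass" "\<sigma> ^ 16 * mass \<le> mass"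
  proof -
    have "\<sigma> ^ 7 \<le> \<sigma> ^ 4" using \<sigma>_pow[of 4 7] by simp
    also have "\<dots> = \<sigma> * \<sigma> ^ 3" by (simp add: power_numeral_reduce)
    also have "\<dots> \<le> 1 / 100 * \<sigma> ^ 3" using \<sigma>_bounds(3) \<sigma>0 by (intro mult_right_mono) auto
    finally have "\<sigma> ^ 7 \<le> \<sigma> ^ 3 / 100" by simp
    then show "\<sigma> ^ 7 * mass \<le> \<sigma> ^ 3 / 100 * mass" using mass_pos by (intro mult_right_mono) auto
    show "\<sigma> ^ 4 * mass \<le> \<sigma> ^ 3 * mass" "\<sigma> ^ 16 * mass \<le> \<sigma> ^ 3 * mass"
      using mass_pos \<sigma>_pow[of 3 4] \<sigma>_pow[of 3 16] by (auto intro!: mult_right_mono)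
    have "\<sigma> ^ 16 * mass \<le> 1 * mass"
      using mass_pos \<sigma>_pow[of 0 16] by (intro mult_right_mono) auto
    then show "\<sigma> ^ 16 * mass \<le> mass" by simp
  qed
  have R: "(\<Sum>v\<in>good. ?r v) \<le> mass + \<sigma> ^ 3 * mass" "(\<Sum>v\<in>good. ?r v) \<ge> mass - 2 * (\<sigma> ^ 3 * mass)"
    "(\<Sum>v\<in>good. ?r v) \<le> 2 * mass"
    using sum_root_weight split[of ?r] notgood p unfolding abs_le_iff by linarith+
  have Bsum: "(\<Sum>v\<in>good. ?b v) \<le> D ^ q * mass + \<sigma> ^ 3 * mass"
  proof -
    have "(\<Sum>v\<in>V x. ?b v) = nrm (hy U) ((uni e 2)(x := 1)) * mass"
      by (rule sum_ratio) (rule uni_x)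
    also have "\<dots> \<le> (D ^ q + 9 * \<sigma> ^ 7) * mass"
      using mean_link[of 2] mass_pos by (intro mult_right_mono) (auto simp: abs_le_iff)
    finally show ?thesis using split[of ?b] notgood p by (simp add: algebra_simps)
  qed
  have A: "(\<Sum>v\<in>good. ?a v) \<ge> D * mass - 3 * (\<sigma> ^ 3 * mass)"
  proof -
    have "(\<Sum>v\<in>V x. ?a v) = nrm (hy U) ((uni e 1)(x := 1)) * mass"
      by (rule sum_ratio) (rule uni_x)
    moreover have "(D - 9 * \<sigma> ^ 7) * mass \<le> nrm (hy U) ((uni e 1)(x := 1)) * mass"
      using mean_link[of 1] mass_pos by (intro mult_right_mono) (auto simp: abs_le_iff)
    ultimately have all: "D * mass - 9 * (\<sigma> ^ 7 * mass) \<le> (\<Sum>v\<in>V x. ?a v)"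
      by (simp add: algebra_simps)
    have "(\<Sum>v\<in>V x - good. ?a v) \<le> (\<Sum>v\<in>V x - good. ?r v + \<bar>ratio \<gamma> v (uni e 1) - ?r v\<bar>)"
    proof (rule sum_mono)
      fix v assume "v \<in> V x - good"
      then have "?a v \<le> ratio \<gamma> v (uni e 1)" by (intro ratio_mono) auto
      then show "?a v \<le> ?r v + \<bar>ratio \<gamma> v (uni e 1) - ?r v\<bar>" by linarith
    qed
    also have "\<dots> \<le> \<sigma> ^ 3 * mass + (\<Sum>v\<in>V x. \<bar>ratio \<gamma> v (uni e 1) - ?r v\<bar>)"
      unfolding sum.distrib using notgood(2) fV by (intro add_mono sum_mono2) auto
    also have "(\<Sum>v\<in>V x. \<bar>ratio \<gamma> v (uni e 1) - ?r v\<bar>) \<le> 20 * real (card e) * \<sigma> ^ 8 * mass"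
      by (rule sum_ratio_deviation) (rule uni_le uni_x)+
    also have "20 * real (card e) * \<sigma> ^ 8 * mass \<le> \<sigma> ^ 3 * mass"
    proof (rule mult_right_mono)
      have "20 * real (card e) * 1 * \<sigma> \<le> 20 * real (card e) * 3 ^ card e * \<sigma>"
        using \<sigma>0 by (intro mult_right_mono mult_left_mono) auto
      then have "(20 * real (card e) * \<sigma>) * \<sigma> ^ 7 \<le> 1 * \<sigma> ^ 3"
        using \<sigma>_bounds(5) \<sigma>_pow[of 3 7] \<sigma>0 by (intro mult_mono) auto
      then show "20 * real (card e) * \<sigma> ^ 8 \<le> \<sigma> ^ 3"
        by (simp add: power_numeral_reduce mult_ac)
    qed (use mass_pos in simp)
    finally have "(\<Sum>v\<in>V x - good. ?a v) \<le> 2 * (\<sigma> ^ 3 * mass)" by linarith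
    moreover have "0 \<le> \<sigma> ^ 3 * mass" using \<sigma>0 mass_pos by simp
    ultimately show ?thesis using all split[of ?a] p(1) by linarith
  qed
  define c where "c = D ^ (q - 1)"
  have c: "0 \<le> c" "c \<le> 1" using dens \<delta>_le by (auto simp: c_def power_le_one)
  have sq: "1 \<le> real q" by simp
  define S3 where "S3 = \<sigma> ^ 3 * mass"
  have S3: "0 \<le> S3" using \<sigma>0 mass_pos by (simp add: S3_def)
  have Dq: "0 \<le> D ^ q" "D ^ q \<le> 1" using dens \<delta>_le by (auto simp: power_le_one)
  have "(\<Sum>v\<in>good. defect v) = (\<Sum>v\<in>good. ?b v) + 4 * real q * \<sigma> ^ 4 * (\<Sum>v\<in>good. ?r v)
      - D ^ q * (\<Sum>v\<in>good. ?r v) - real q * c * ((\<Sum>v\<in>good. ?a v) - D * (\<Sum>v\<in>good. ?r v))"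
  proof -
    have "(\<Sum>v\<in>good. real q * c * (?a v - D * ?r v)) = real q * c * ((\<Sum>v\<in>good. ?a v) - D * (\<Sum>v\<in>good. ?r v))"
      by (simp only: sum_distrib_left right_diff_distrib sum_subtractf)
    moreover have "(\<Sum>v\<in>good. 4 * real q * \<sigma> ^ 4 * ?r v) = 4 * real q * \<sigma> ^ 4 * (\<Sum>v\<in>good. ?r v)"
      "(\<Sum>v\<in>good. D ^ q * ?r v) = D ^ q * (\<Sum>v\<in>good. ?r v)"
      by (simp_all only: sum_distrib_left)
    ultimately show ?thesis
      unfolding defect_def c_def[symmetric] by (simp only: sum.distrib sum_subtractf)
  qed
  also have "\<dots> \<le> (D ^ q * mass + S3) + 4 * real q * (2 * S3) - (D ^ q * mass - 2 * S3) - real q * (- 4 * S3)"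
  proof -
    have t1: "4 * real q * \<sigma> ^ 4 * (\<Sum>v\<in>good. ?r v) \<le> 4 * real q * (2 * S3)"
    proof -
      have "\<sigma> ^ 4 * (\<Sum>v\<in>good. ?r v) \<le> \<sigma> ^ 4 * (2 * mass)"
        using R(3) \<sigma>0 by (intro mult_left_mono) auto
      also have "\<dots> \<le> 2 * S3" using p(2) by (simp add: S3_def)
      finally have "4 * real q * (\<sigma> ^ 4 * (\<Sum>v\<in>good. ?r v)) \<le> 4 * real q * (2 * S3)"
        by (intro mult_left_mono) auto
      then show ?thesis by (simp add: mult.assoc)
    qed
    have t2: "D ^ q * mass - 2 * S3 \<le> D ^ q * (\<Sum>v\<in>good. ?r v)"
    proof -
      have "D ^ q * (mass - 2 * S3) \<le> D ^ q * (\<Sum>v\<in>good. ?r v)"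
        using R(2) Dq by (intro mult_left_mono) (auto simp: S3_def)
      moreover have "D ^ q * (2 * S3) \<le> 1 * (2 * S3)" using Dq S3 by (intro mult_right_mono) auto
      ultimately show ?thesis by (simp add: right_diff_distrib)
    qed
    have t3: "real q * (- 4 * S3) \<le> real q * c * ((\<Sum>v\<in>good. ?a v) - D * (\<Sum>v\<in>good. ?r v))"
    proof -
      have "D * (\<Sum>v\<in>good. ?r v) \<le> D * (mass + S3)"
        using R(1) dens by (intro mult_left_mono) (auto simp: S3_def)
      moreover have "D * S3 \<le> 1 * S3" using \<delta>_le S3 by (intro mult_right_mono) auto
      ultimately have "- 4 * S3 \<le> (\<Sum>v\<in>good. ?a v) - D * (\<Sum>v\<in>good. ?r v)"
        using A by (simp add: S3_def algebra_simps)
      then have "c * (- 4 * S3) \<le> c * ((\<Sum>v\<in>good. ?a v) - D * (\<Sum>v\<in>good. ?r v))"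
        using c by (intro mult_left_mono) auto
      moreover have "c * (4 * S3) \<le> 1 * (4 * S3)" using c S3 by (intro mult_right_mono) auto
      ultimately have "- 4 * S3 \<le> c * ((\<Sum>v\<in>good. ?a v) - D * (\<Sum>v\<in>good. ?r v))" by simp
      then have "real q * (- 4 * S3) \<le> real q * (c * ((\<Sum>v\<in>good. ?a v) - D * (\<Sum>v\<in>good. ?r v)))"
        by (intro mult_left_mono) auto
      then show ?thesis by (simp only: mult.assoc)
    qed
    show ?thesis using Bsum t1 t2 t3 unfolding S3_def by linarith
  qed
  also have "\<dots> = 3 * S3 + 12 * (real q * S3)" by (simp add: algebra_simps)
  also have "\<dots> \<le> 32 * (real q * S3)"
    using mult_right_mono[OF sq S3] S3 by linarith
  finally show ?thesis by (simp add: S3_def mult_ac)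
qed

lemma link_inheritance:
  "(\<Sum>v\<in>{v \<in> V x. \<not> (\<bar>ratio (hy U) v (uni e 1) - D * ratio \<gamma> v (uni e 1)\<bar> \<le> \<eta> * ratio \<gamma> v (uni e 1)
       \<and> ratio (hy U) v (uni e 2) \<le> (D ^ q + \<eta>) * ratio \<gamma> v (uni e 2))}. root_weight v)
    \<le> \<eta> * (\<Sum>v\<in>V x. root_weight v)" (is "sum _ ?Bad \<le> _")
proof -
  have fV: "finite (V x)" using finV by simp
  have gV: "good \<subseteq> V x" by (auto simp: good_def)
  define W where "W = {v \<in> good. \<sigma>\<^sup>2 * root_weight v < defect v}"
  have W: "W \<subseteq> good" "finite good" using finite_subset[OF gV fV] by (auto simp: W_def)
  then have finW: "finite W" using finite_subset by blast
  have "\<sigma>\<^sup>2 * (\<Sum>v\<in>W. root_weight v) \<le> (\<Sum>v\<in>W. defect v)"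
    unfolding sum_distrib_left by (rule sum_mono) (auto simp: W_def)
  also have "\<dots> \<le> (\<Sum>v\<in>good. defect v)"
    using W defect_nonneg by (intro sum_mono2) auto
  also have "\<dots> \<le> \<sigma>\<^sup>2 * (32 * real q * \<sigma> * mass)"
    using sum_defect by (simp add: power_numeral_reduce mult_ac)
  finally have sW: "(\<Sum>v\<in>W. root_weight v) \<le> 32 * real q * \<sigma> * mass"
    by (rule mult_left_le_imp_le) (use \<sigma>0 in simp)
  have "?Bad \<subseteq> (V x - good) \<union> W"
  proof
    fix v assume v: "v \<in> ?Bad"
    have "\<not> (v \<in> good \<and> defect v \<le> \<sigma>\<^sup>2 * root_weight v)"
      using small_defect_regular[of v] v by blast
    then show "v \<in> (V x - good) \<union> W" using v by (auto simp: W_def)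
  qed
  moreover have "0 \<le> root_weight v" if "v \<in> (V x - good) \<union> W" for v
    using that W gV by (intro root_weight_nonneg) blast
  moreover have "finite ((V x - good) \<union> W)" using fV finW by simp
  ultimately have "sum root_weight ?Bad \<le> sum root_weight ((V x - good) \<union> W)"
    by (intro sum_mono2) (simp_all only: Diff_iff)
  also have "\<dots> = sum root_weight (V x - good) + sum root_weight W"
    using fV W finW by (intro sum.union_disjoint) auto
  also have "\<dots> \<le> \<sigma> ^ 3 * mass + 32 * real q * \<sigma> * mass"
    using sum_not_good sW by (rule add_mono)
  also have "\<dots> \<le> 1 * (real q * \<sigma>) * mass + 32 * real q * \<sigma> * mass"
  proof -
    have "\<sigma> ^ 3 \<le> \<sigma>" using \<sigma>_pow[of 1 3] by simp
    also have "\<dots> \<le> real q * \<sigma>" using \<sigma>0 mult_right_mono[of 1 "real q" \<sigma>] by simp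
    finally have "\<sigma> ^ 3 * mass \<le> (1 * (real q * \<sigma>)) * mass"
      using mass_pos by (intro mult_right_mono) auto
    then show ?thesis by (rule add_right_mono)
  qed
  also have "\<dots> = (33 * real q * \<sigma>) * mass" by (simp add: algebra_simps)
  also have "\<dots> \<le> (\<eta> / 2) * mass"
  proof (rule mult_right_mono)
    have "100 * real q * \<sigma> \<le> \<eta>"
      using mult_right_mono[OF L_bounds(1), of \<sigma>] \<sigma>0 \<sigma>_bounds(1) by linarith
    moreover have "0 \<le> real q * \<sigma>" using \<sigma>0 by simp
    ultimately show "33 * real q * \<sigma> \<le> \<eta> / 2" by linarith
  qed (use mass_pos in simp)
  also have "\<dots> = \<eta> * (mass / 2)" by simp
  also have "\<dots> \<le> \<eta> * (\<Sum>v\<in>V x. root_weight v)"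
  proof (rule mult_left_mono)
    have "\<sigma> ^ 16 * mass \<le> 1 / 100 * mass"
      using \<sigma>_pow[of 1 16] \<sigma>_bounds(3) mass_pos by (intro mult_right_mono) auto
    then show "mass / 2 \<le> (\<Sum>v\<in>V x. root_weight v)"
      using sum_root_weight mass_pos unfolding abs_le_iff by linarith
  qed (use \<eta> in simp)
  finally show ?thesis .
qed

end

end

section \<open>From one level of the stack to the next\<close>

context parts
begin

lemma tuple_inj_on:
  assumes "t \<in> tuples V X" "fst ` X \<subseteq> J" "e \<in> faces X"
  shows "inj_on t e"
proof (rule inj_onI)
  fix z z' assume z: "z \<in> e" "z' \<in> e" "t z = t z'"
  have X: "z \<in> X" "z' \<in> X" and inj: "inj_on fst e" using z assms(3) by (auto simp: faces_def)
  have "fst z = fst z'"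
  proof (rule V_unique)
    show "t z \<in> V (fst z)" by (rule tuple_mem[OF assms(1) X(1)])
    show "t z \<in> V (fst z')" unfolding z(3) by (rule tuple_mem[OF assms(1) X(2)])
  qed (use X assms(2) in auto)
  then show "z = z'" using inj z by (auto dest: inj_onD)
qed

lemma card_faces_type:
  assumes "f \<subseteq> K" "finite K"
  shows "card {e \<in> faces (positions K a). fst ` e = f} = mon a f"
proof -
  have finf: "finite f" using assms finite_subset by auto
  let ?g = "\<lambda>s. (\<lambda>i. (i, s i)) ` f"
  have "inj_on ?g (PiE f (\<lambda>i. {..<a i}))"
  proof (rule inj_onI)
    fix s s' assume s: "s \<in> PiE f (\<lambda>i. {..<a i})" "s' \<in> PiE f (\<lambda>i. {..<a i})" "?g s = ?g s'"
    have "s i = s' i" if "i \<in> f" for i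
    proof -
      have "(i, s i) \<in> ?g s'" using that s(3) by (metis (no_types, lifting) imageI)
      then show ?thesis by auto
    qed
    then show "s = s'" using s by (intro PiE_ext)
  qed
  moreover have "?g ` PiE f (\<lambda>i. {..<a i}) = {e \<in> faces (positions K a). fst ` e = f}"
  proof (intro set_eqI iffI)
    fix e assume "e \<in> ?g ` PiE f (\<lambda>i. {..<a i})"
    then obtain s where "s \<in> PiE f (\<lambda>i. {..<a i})" "e = ?g s" by auto
    then show "e \<in> {e \<in> faces (positions K a). fst ` e = f}"
      using assms(1) by (auto simp: faces_def positions_def inj_on_def image_image)
  next
    fix e assume "e \<in> {e \<in> faces (positions K a). fst ` e = f}"
    then have e: "e \<subseteq> positions K a" "inj_on fst e" "fst ` e = f" by (auto simp: faces_def)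
    define s where "s = restrict (\<lambda>i. snd (the_inv_into e fst i)) f"
    have inv: "(i, s i) \<in> e" if i: "i \<in> f" for i
    proof -
      have "the_inv_into e fst i \<in> e" "fst (the_inv_into e fst i) = i"
        using e i by (auto intro: the_inv_into_into f_the_inv_into_f)
      then show ?thesis using i by (simp add: s_def) (metis prod.collapse)
    qed
    have "e = ?g s"
    proof (intro set_eqI iffI)
      fix z assume z: "z \<in> e"
      then have "fst z \<in> f" using e by auto
      then have "(fst z, s (fst z)) = z"
        using inj_onD[OF e(2), of "(fst z, s (fst z))" z] inv[of "fst z"] z by simp
      then show "z \<in> ?g s" using \<open>fst z \<in> f\<close> by (metis imageI)
    qed (use inv in auto)
    moreover have "s \<in> PiE f (\<lambda>i. {..<a i})"
      using inv e(1) by (fastforce simp: s_def positions_def)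
    ultimately show "e \<in> ?g ` PiE f (\<lambda>i. {..<a i})" by blast
  qed
  ultimately have "card {e \<in> faces (positions K a). fst ` e = f} = card (PiE f (\<lambda>i. {..<a i}))"
    by (metis card_image)
  then show ?thesis using finf by (simp add: card_PiE mon_def)
qed

lemma prod_faces:
  assumes "finite K"
  shows "(\<Prod>e\<in>faces (positions K a). p (fst ` e)) = dens_prod p (Pow K) a"
proof -
  have fin: "finite (faces (positions K a))"
    using assms by (intro finite_faces finite_positions)
  have sub: "(\<lambda>e. fst ` e) ` faces (positions K a) \<subseteq> Pow K"
    by (auto simp: faces_def positions_def)
  have "(\<Prod>e\<in>faces (positions K a). p (fst ` e))
      = (\<Prod>f\<in>Pow K. \<Prod>e\<in>{e \<in> faces (positions K a). fst ` e = f}. p (fst ` e))"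
    by (rule prod.group[symmetric]) (use fin sub assms in auto)
  also have "\<dots> = (\<Prod>f\<in>Pow K. p f ^ mon a f)"
  proof (intro prod.cong refl)
    fix f assume "f \<in> Pow K"
    then have c: "card {e \<in> faces (positions K a). fst ` e = f} = mon a f"
      using assms by (intro card_faces_type) auto
    have "(\<Prod>e\<in>{e \<in> faces (positions K a). fst ` e = f}. p (fst ` e))
        = (\<Prod>e\<in>{e \<in> faces (positions K a). fst ` e = f}. p f)"
      by (intro prod.cong) auto
    then show "(\<Prod>e\<in>{e \<in> faces (positions K a). fst ` e = f}. p (fst ` e)) = p f ^ mon a f"
      by (simp add: c)
  qed
  finally show ?thesis by (simp add: dens_prod_def)
qed

text \<open>Sets with more than \<open>k\<close> elements have weight \<open>1\<close>, so dropping the edges of size \<open>k + 1\<close> and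
  more makes the full complex on the positions a \<open>k\<close>-complex without changing its count.\<close>

lemma counts_like_cnt:
  assumes cl: "counts_like k \<eta> c V J \<gamma> p" and kg: "partite_k_graph k J V \<gamma>" and kd: "density_k_graph k J p"
    and K: "K \<subseteq> J" and a: "\<And>i. a i \<le> 2" and c: "card (positions K a) \<le> c"
  defines "M \<equiv> \<gamma> {} / p {} * dens_prod p (Pow K) a"
  shows "(1 - real (card (positions K a)) * \<eta>) * M \<le> cnt V \<gamma> (positions K a)"
    and "cnt V \<gamma> (positions K a) \<le> (1 + real (card (positions K a)) * \<eta>) * M"
proof -
  define X where "X = positions K a"
  have finK: "finite K" using K finJ finite_subset by auto
  have X: "finite X" "fst ` X \<subseteq> J" using finK K by (auto simp: X_def finite_positions positions_def)
  define n where "n = card X"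
  obtain \<phi> where \<phi>: "bij_betw \<phi> {0..<n} X"
    using ex_bij_betw_nat_finite[OF X(1)] unfolding n_def by blast
  have inj: "inj_on \<phi> {0..<n}" and img: "\<phi> ` {0..<n} = X" using \<phi> by (auto simp: bij_betw_def)
  define \<pi> where "\<pi> = fst \<circ> \<phi>"
  define R where "R = \<lparr>verts = {0..<n}, edges = {e. e \<subseteq> {0..<n} \<and> inj_on \<pi> e \<and> card e \<le> k}\<rparr>"
  have vR: "verts R = {0..<n}" and eR: "edges R = {e. e \<subseteq> {0..<n} \<and> inj_on \<pi> e \<and> card e \<le> k}"
    by (simp_all add: R_def)
  let ?F = "{e \<in> faces X. card e \<le> k}"
  have bijE: "bij_betw (image \<phi>) (edges R) ?F"
  proof (rule bij_betw_imageI)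
    show "inj_on (image \<phi>) (edges R)"
      by (rule inj_on_subset[OF inj_on_image_Pow[OF inj]]) (auto simp: eR)
    show "image \<phi> ` edges R = ?F"
    proof (intro set_eqI iffI)
      fix e assume "e \<in> image \<phi> ` edges R"
      then obtain u where u: "e = \<phi> ` u" "u \<subseteq> {0..<n}" "inj_on \<pi> u" "card u \<le> k" by (auto simp: eR)
      then have "inj_on fst (\<phi> ` u)" unfolding \<pi>_def by (meson inj_on_imageI)
      moreover have "card (\<phi> ` u) \<le> k" using u(4) finite_subset[OF u(2)] card_image_le[of u \<phi>] by simp
      ultimately show "e \<in> ?F" using u img by (auto simp: faces_def)
    next
      fix e assume e: "e \<in> ?F"
      define u where "u = {i \<in> {0..<n}. \<phi> i \<in> e}"
      have eu: "e = \<phi> ` u" using e img by (force simp: faces_def u_def)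
      have iu: "inj_on \<phi> u" using inj by (rule inj_on_subset) (auto simp: u_def)
      have "inj_on \<pi> u"
        unfolding \<pi>_def using iu e eu by (intro comp_inj_on) (auto simp: faces_def)
      moreover have "card u \<le> k"
      proof -
        have "card u = card e" unfolding eu by (rule card_image[OF iu, symmetric])
        then show ?thesis using e by simp
      qed
      moreover have "u \<subseteq> {0..<n}" by (auto simp: u_def)
      ultimately have "u \<in> edges R" by (simp add: eR)
      then show "e \<in> image \<phi> ` edges R" unfolding eu by (rule imageI)
    qed
  qed
  have pc: "partite_complex k J \<pi> R"
  proof -
    have "\<pi> ` verts R \<subseteq> J" using img X by (auto simp: vR \<pi>_def)
    moreover have "card e' \<le> k" if "e' \<subseteq> e" "e \<subseteq> {0..<n}" "card e \<le> k" for e e' :: "nat set"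
      using that card_mono[of e e'] finite_subset[of e "{0..<n}"] by auto
    ultimately show ?thesis
      unfolding partite_complex_def k_complex_def vR eR by (auto intro: inj_on_subset)
  qed
  have parts4: "card {z \<in> verts R. \<pi> z = j} \<le> 4" if "j \<in> J" for j
  proof -
    have "card {z \<in> verts R. \<pi> z = j} = card (\<phi> ` {z \<in> verts R. \<pi> z = j})"
      using inj by (intro card_image[symmetric] inj_on_subset[OF inj]) (auto simp: vR)
    also have "\<dots> \<le> card ({j} \<times> {..<a j})"
    proof (rule card_mono)
      show "\<phi> ` {z \<in> verts R. \<pi> z = j} \<subseteq> {j} \<times> {..<a j}"
      proof
        fix y assume "y \<in> \<phi> ` {z \<in> verts R. \<pi> z = j}"
        then have "y \<in> X" "fst y = j" using img by (auto simp: vR \<pi>_def)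
        then show "y \<in> {j} \<times> {..<a j}" by (auto simp: X_def positions_def)
      qed
    qed auto
    also have "\<dots> \<le> 4" using a[of j] by (simp add: card_cartesian_product)
    finally show ?thesis .
  qed
  have hom: "hom_density V \<gamma> \<pi> R = cnt V \<gamma> X"
  proof -
    let ?P = "\<Pi>\<^sub>E z\<in>verts R. V (\<pi> z)"
    let ?f = "\<lambda>t. restrict (t \<circ> \<phi>) {0..<n}"
    have bij: "bij_betw ?f (tuples V X) ?P"
    proof (rule bij_betw_byWitness[where f' = "\<lambda>\<psi>. restrict (\<psi> \<circ> the_inv_into {0..<n} \<phi>) X"])
      have inv: "the_inv_into {0..<n} \<phi> z \<in> {0..<n}" "\<phi> (the_inv_into {0..<n} \<phi> z) = z" if "z \<in> X" for z
        using that unfolding img[symmetric]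
        by (rule the_inv_into_into[OF inj _ order.refl], rule f_the_inv_into_f[OF inj])
      show "\<forall>t\<in>tuples V X. restrict (?f t \<circ> the_inv_into {0..<n} \<phi>) X = t"
      proof
        fix t assume t: "t \<in> tuples V X"
        show "restrict (?f t \<circ> the_inv_into {0..<n} \<phi>) X = t"
        proof
          fix z show "restrict (?f t \<circ> the_inv_into {0..<n} \<phi>) X z = t z"
            using inv[of z] PiE_arb[OF t[unfolded tuples_def], of z] by (cases "z \<in> X") auto
        qed
      qed
      show "\<forall>\<psi>\<in>?P. ?f (restrict (\<psi> \<circ> the_inv_into {0..<n} \<phi>) X) = \<psi>"
      proof
        fix \<psi> assume \<psi>: "\<psi> \<in> ?P"
        show "?f (restrict (\<psi> \<circ> the_inv_into {0..<n} \<phi>) X) = \<psi>"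
        proof
          fix i show "?f (restrict (\<psi> \<circ> the_inv_into {0..<n} \<phi>) X) i = \<psi> i"
            using img the_inv_into_f_f[OF inj, of i] PiE_arb[OF \<psi>, of i] by (cases "i \<in> {0..<n}") (auto simp: vR)
        qed
      qed
      show "?f ` tuples V X \<subseteq> ?P"
        using img by (auto simp: tuples_def vR \<pi>_def)
      show "(\<lambda>\<psi>. restrict (\<psi> \<circ> the_inv_into {0..<n} \<phi>) X) ` ?P \<subseteq> tuples V X"
      proof
        fix t assume "t \<in> (\<lambda>\<psi>. restrict (\<psi> \<circ> the_inv_into {0..<n} \<phi>) X) ` ?P"
        then obtain \<psi> where \<psi>: "\<psi> \<in> ?P" "t = restrict (\<psi> \<circ> the_inv_into {0..<n} \<phi>) X" by blast
        have "\<psi> (the_inv_into {0..<n} \<phi> z) \<in> V (fst z)" if "z \<in> X" for z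
          using PiE_mem[OF \<psi>(1), of "the_inv_into {0..<n} \<phi> z"] inv[OF that] by (simp add: vR \<pi>_def)
        then show "t \<in> tuples V X" using \<psi>(2) by (auto simp: tuples_def)
      qed
    qed
    have w: "(\<Prod>e\<in>edges R. \<gamma> (?f t ` e)) = weight \<gamma> X t" if t: "t \<in> tuples V X" for t
    proof -
      have "(\<Prod>e\<in>edges R. \<gamma> (?f t ` e)) = (\<Prod>e\<in>edges R. \<gamma> (t ` (\<phi> ` e)))"
      proof (intro prod.cong refl)
        fix e assume "e \<in> edges R"
        then have "?f t ` e = t ` (\<phi> ` e)"
          unfolding image_image by (intro image_cong) (auto simp: eR)
        then show "\<gamma> (?f t ` e) = \<gamma> (t ` (\<phi> ` e))" by simp
      qed
      also have "\<dots> = (\<Prod>e\<in>?F. \<gamma> (t ` e))"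
        by (rule prod.reindex_bij_betw[OF bijE])
      also have "\<dots> = weight \<gamma> X t"
        unfolding weight_def
      proof (rule prod.mono_neutral_left)
        show "\<forall>e\<in>faces X - ?F. \<gamma> (t ` e) = 1"
        proof
          fix e assume e: "e \<in> faces X - ?F"
          have "card (t ` e) = card e"
            using tuple_inj_on[OF t X(2)] e by (intro card_image) auto
          then show "\<gamma> (t ` e) = 1"
            using image_crossing[OF X(1) t X(2)] e kg by (auto simp: partite_k_graph_def k_graph_def)
        qed
      qed (use X finite_faces in auto)
      finally show ?thesis .
    qed
    have "(\<Sum>\<psi>\<in>?P. \<Prod>e\<in>edges R. \<gamma> (\<psi> ` e)) = (\<Sum>t\<in>tuples V X. \<Prod>e\<in>edges R. \<gamma> (?f t ` e))"
      by (rule sum.reindex_bij_betw[OF bij, symmetric])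
    also have "\<dots> = (\<Sum>t\<in>tuples V X. weight \<gamma> X t)" using w by (intro sum.cong) auto
    finally show ?thesis
      unfolding hom_density_def cnt_def by (simp add: bij_betw_same_card[OF bij])
  qed
  have dv: "density_value p \<pi> R = dens_prod p (Pow K) a"
  proof -
    have "density_value p \<pi> R = (\<Prod>e\<in>edges R. p (fst ` (\<phi> ` e)))"
      by (simp add: density_value_def \<pi>_def image_comp)
    also have "\<dots> = (\<Prod>e\<in>?F. p (fst ` e))" by (rule prod.reindex_bij_betw[OF bijE])
    also have "\<dots> = (\<Prod>e\<in>faces X. p (fst ` e))"
    proof (rule prod.mono_neutral_left)
      show "\<forall>e\<in>faces X - ?F. p (fst ` e) = 1"
      proof
        fix e assume e: "e \<in> faces X - ?F"
        then have "card (fst ` e) = card e" "fst ` e \<subseteq> J"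
          using X by (auto simp: faces_def card_image)
        then show "p (fst ` e) = 1" using e kd by (auto simp: density_k_graph_def k_graph_def)
      qed
    qed (use X finite_faces in auto)
    also have "\<dots> = dens_prod p (Pow K) a"
      unfolding X_def using finK by (rule prod_faces)
    finally show ?thesis .
  qed
  have cR: "card (verts R) = card X" by (simp add: vR n_def)
  have "card (verts R) \<le> c" using c by (simp add: vR n_def X_def)
  with pc parts4
  have "partite_complex k J \<pi> R \<and> (\<forall>j\<in>J. card {z \<in> verts R. \<pi> z = j} \<le> 4) \<and> card (verts R) \<le> c"
    by blast
  from cl[unfolded counts_like_def, rule_format, OF this]
  show "(1 - real (card (positions K a)) * \<eta>) * M \<le> cnt V \<gamma> (positions K a)"
    and "cnt V \<gamma> (positions K a) \<le> (1 + real (card (positions K a)) * \<eta>) * M"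
    unfolding M_def X_def[symmetric] hom dv cR by blast+
qed

end

lemma dens_prod_Pow:
  assumes "finite K"
  shows "dens_prod p (Pow K) a = p {} * dens_prod p (Pow K - {{}}) a"
  unfolding dens_prod_def using assms by (subst prod.remove[of _ "{}"]) (auto simp: mon_def)

context weighted_pair
begin

lemma cnt_all_types:
  assumes "\<gamma> {} \<noteq> 0"
  shows "cnt V g (positions J a) = g {} / \<gamma> {} * cnt V (hy types) (positions J a)"
proof -
  let ?X = "positions J a"
  have X: "finite ?X" "fst ` ?X \<subseteq> J" using finJ by (auto simp: finite_positions positions_def)
  have "weight g ?X t = g {} / \<gamma> {} * weight (hy types) ?X t" if t: "t \<in> tuples V ?X" for t
  proof -
    have e0: "{} \<in> faces ?X" by (simp add: faces_def)
    have split: "weight h ?X t = h {} * (\<Prod>e\<in>faces ?X - {{}}. h (t ` e))" for h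
      unfolding weight_def using finite_faces[OF X(1)] e0 by (subst prod.remove[of _ "{}"]) auto
    have "(\<Prod>e\<in>faces ?X - {{}}. hy types (t ` e)) = (\<Prod>e\<in>faces ?X - {{}}. g (t ` e))"
    proof (intro prod.cong refl)
      fix e assume e: "e \<in> faces ?X - {{}}"
      then have "type_of (t ` e) = fst ` e" using type_of_image[OF t X(2)] by (auto simp: faces_def)
      then have "type_of (t ` e) \<in> types" using e X(2) by (auto simp: types_def faces_def)
      then show "hy types (t ` e) = g (t ` e)" by (simp add: hyb_def)
    qed
    moreover have "hy types {} = \<gamma> {}" by (simp add: hyb_def type_of_def types_def)
    ultimately show ?thesis using assms unfolding split[of g] split[of "hy types"] by simp
  qed
  then show ?thesis by (simp add: cnt_def sum_distrib_left)
qed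

lemma level_step:
  fixes d :: "'j set \<Rightarrow> real" and \<theta> \<delta> L :: real and k :: nat
  assumes cardJ: "card J \<le> k + 1" and \<kappa>: "\<kappa> = \<gamma> {}" and g0: "0 < g {}"
    and d: "\<And>f. f \<in> types \<Longrightarrow> \<delta> \<le> d f \<and> d f \<le> 1" and \<delta>: "0 < \<delta>" "\<delta> \<le> 1"
    and reg: "\<And>f. f \<in> types \<Longrightarrow> \<exists>\<epsilon>. 0 \<le> \<epsilon> \<and> \<epsilon> \<le> \<zeta>
        \<and> (d f - \<epsilon>) * nrm \<gamma> (uni f 1) \<le> nrm (hy {f}) (uni f 1)
        \<and> nrm (hy {f}) (uni f 2) \<le> (d f ^ 2 ^ card f + \<epsilon>) * nrm \<gamma> (uni f 2)"
    and \<gamma>1: "\<And>a. (\<And>i. a i \<le> 2) \<Longrightarrow> \<bar>nrm \<gamma> a - 1\<bar> \<le> \<zeta>"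
    and \<theta>: "0 < \<theta>" "L * \<theta> \<le> \<delta> ^ 2 ^ (k + 1)" "100 * 2 ^ (k + 1) \<le> L"
    and \<zeta>: "\<zeta> \<le> \<theta> ^ (4 ^ (2 * k + 3) + 1)"
    and a: "\<And>i. a i \<le> 2"
  shows "\<bar>cnt V g (positions J a) / (g {} * dens_prod (\<lambda>f. p f * d f) types a) - 1\<bar> \<le> \<theta>"
proof -
  define Q where "Q = (2::nat) ^ (k + 1)"
  have Q: "1 \<le> Q" "k + 1 \<le> Q"
    using less_exp[of "k + 1"] by (simp_all add: Q_def)
  have L: "100 * real Q \<le> L" using \<theta>(3) by (simp add: Q_def)
  have \<theta>Q: "L * \<theta> \<le> \<delta> ^ Q" using \<theta>(2) by (simp add: Q_def)
  have dQ: "\<delta> ^ Q \<le> 1" using \<delta> by (intro power_le_one) auto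
  have small: "100 * real Q * \<theta> \<le> \<delta> ^ Q"
    using mult_right_mono[OF L, of \<theta>] \<theta> \<theta>Q by linarith
  have \<theta>1: "100 * \<theta> \<le> \<delta> ^ Q" "\<theta> \<le> 1" "\<theta> \<le> \<delta> ^ Q"
  proof -
    have "100 * 1 * \<theta> \<le> 100 * real Q * \<theta>" using Q \<theta> by (intro mult_right_mono) auto
    then show "100 * \<theta> \<le> \<delta> ^ Q" "\<theta> \<le> 1" "\<theta> \<le> \<delta> ^ Q" using small \<theta> dQ by linarith+
  qed
  have pow: "i \<le> j \<Longrightarrow> \<theta> ^ j \<le> \<theta> ^ i" for i j using \<theta> \<theta>1 by (intro power_decreasing) auto
  have \<zeta>0: "0 \<le> \<zeta>" using \<gamma>1[of "\<lambda>_. 0"] by force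
  define n where "n = card J"
  define E where "E s = \<theta> ^ 4 ^ (n - s + k + 2)" for s
  define Eb where "Eb = \<theta> ^ 4 ^ (n + k + 2)"
  have nk: "n \<le> k + 1" using cardJ by (simp add: n_def)
  have \<zeta>E: "\<zeta> \<le> \<theta> * Eb"
  proof -
    have "(4::nat) ^ (n + k + 2) \<le> 4 ^ (2 * k + 3)" using nk by (intro power_increasing) auto
    then have "\<theta> ^ (4 ^ (2 * k + 3) + 1) \<le> \<theta> ^ (4 ^ (n + k + 2) + 1)" by (intro pow) simp
    then show ?thesis using \<zeta> by (simp add: Eb_def mult.commute)
  qed
  have Eb0: "0 < Eb" using \<theta> by (simp add: Eb_def)
  have \<zeta>Eb: "\<zeta> \<le> Eb" "\<zeta> \<le> \<theta>"
  proof -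
    have "\<theta> * Eb \<le> 1 * Eb" using \<theta>1 Eb0 by (intro mult_right_mono) auto
    then show "\<zeta> \<le> Eb" using \<zeta>E by simp
    have "\<theta> * Eb \<le> \<theta> * 1" using pow[of 0] \<theta> by (intro mult_left_mono) (auto simp: Eb_def)
    then show "\<zeta> \<le> \<theta>" using \<zeta>E by simp
  qed
  have Q\<zeta>: "real Q * \<zeta> \<le> 1"
  proof -
    have "real Q * \<zeta> \<le> real Q * \<theta>" using \<zeta>Eb by (intro mult_left_mono) auto
    moreover have "real Q * \<theta> \<le> 100 * real Q * \<theta>" using \<theta> by (intro mult_right_mono) auto
    ultimately show ?thesis using small dQ by linarith
  qed
  have base: "7 * real Q * \<zeta> / \<delta> ^ Q \<le> Eb"
  proof -
    have "7 * real Q * \<zeta> \<le> 7 * real Q * (\<theta> * Eb)" using \<zeta>E by (intro mult_left_mono) auto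
    also have "\<dots> = (7 * real Q * \<theta>) * Eb" by simp
    also have "\<dots> \<le> \<delta> ^ Q * Eb"
    proof (rule mult_right_mono)
      have "7 * real Q * \<theta> \<le> 100 * real Q * \<theta>" using \<theta> by (intro mult_right_mono) auto
      then show "7 * real Q * \<theta> \<le> \<delta> ^ Q" using small by linarith
    qed (use Eb0 in simp)
    finally show ?thesis using \<delta> by (simp add: divide_le_eq mult.commute)
  qed
  define b where "b = (\<lambda>i. if i \<in> J then a i else 0)"
  have all: "\<bar>nrm (hy types) b - dens_prod d types b\<bar> \<le> E (card (J - {}))"
  proof (rule nrm_all_types[where Eb = Eb and \<xi> = \<zeta>])
    fix f and a' :: "'j \<Rightarrow> nat" assume f: "f \<in> types" and a': "\<And>i. i \<in> f \<Longrightarrow> a' i = 1 \<or> a' i = 2" "\<And>i. i \<notin> f \<Longrightarrow> a' i = 0"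
    obtain \<epsilon> where \<epsilon>: "0 \<le> \<epsilon>" "\<epsilon> \<le> \<zeta>"
        "(d f - \<epsilon>) * nrm \<gamma> (uni f 1) \<le> nrm (hy {f}) (uni f 1)"
        "nrm (hy {f}) (uni f 2) \<le> (d f ^ 2 ^ card f + \<epsilon>) * nrm \<gamma> (uni f 2)"
      using reg[OF f] by blast
    have "card f \<le> k + 1" using f cardJ card_mono[OF finJ, of f] by (auto simp: types_def)
    then have "2 ^ card f \<le> Q" unfolding Q_def by (intro power_increasing) auto
    from nrm_single_type[OF f this \<epsilon>(3,4) \<gamma>1 \<epsilon>(1,2) \<delta>(1) _ _ Q\<zeta> a'] d[OF f] base
    show "\<bar>nrm (hy {f}) a' - d f ^ mon a' f\<bar> \<le> Eb" by force
  next
    show "\<bar>nrm \<gamma> a' - 1\<bar> \<le> \<zeta>" if "\<And>i. a' i \<le> 2" for a' using \<gamma>1 that .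
    show "0 \<le> d f \<and> d f \<le> 1" if "f \<in> types" for f using d[OF that] \<delta> by linarith
    show "0 \<le> \<zeta>" "\<zeta> \<le> 1" "\<zeta> \<le> Eb" using \<zeta>0 \<zeta>Eb \<theta>1 by auto
    show "0 \<le> E s" for s using \<theta> by (simp add: E_def)
    show "E s \<le> 1" for s using pow[of 0] by (simp add: E_def)
    show "Eb \<le> E 0" by (simp add: Eb_def E_def)
    show "Eb + real (card J) * (5 * sqrt (E s + \<zeta>)) \<le> E (Suc s)" if s: "s < card J" for s
    proof -
      define m where "m = (4::nat) ^ (n - Suc s + k + 2)"
      have "n - s = Suc (n - Suc s)" using s by (simp add: n_def)
      then have Es: "E s = \<theta> ^ (4 * m)" by (simp add: E_def m_def)
      have Es': "E (Suc s) = \<theta> ^ m" by (simp add: E_def m_def)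
      have m1: "1 \<le> m" by (simp add: m_def)
      have EbE: "Eb \<le> \<theta> ^ (4 * m)"
        unfolding Es[symmetric] E_def Eb_def by (intro pow power_increasing) auto
      have "sqrt (E s + \<zeta>) \<le> 2 * \<theta> ^ (2 * m)"
      proof (rule real_le_lsqrt)
        have "E s + \<zeta> \<le> 2 * \<theta> ^ (4 * m)" using EbE \<zeta>Eb by (simp add: Es)
        also have "\<dots> \<le> 4 * \<theta> ^ (4 * m)" using \<theta> by simp
        also have "\<dots> = (2 * \<theta> ^ (2 * m))\<^sup>2" by (simp add: power_mult_distrib power_mult[symmetric])
        finally show "E s + \<zeta> \<le> (2 * \<theta> ^ (2 * m))\<^sup>2" .
      qed (use \<theta> in auto)
      then have "real (card J) * (5 * sqrt (E s + \<zeta>)) \<le> real Q * (5 * (2 * \<theta> ^ (2 * m)))"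
        using nk Q \<theta> \<zeta>0 by (intro mult_mono) (auto simp: n_def Es)
      moreover have "Eb \<le> real Q * \<theta> ^ (2 * m)"
      proof -
        have "Eb \<le> 1 * \<theta> ^ (2 * m)" using EbE pow[of "2 * m" "4 * m"] by simp
        also have "\<dots> \<le> real Q * \<theta> ^ (2 * m)" using Q \<theta> by (intro mult_right_mono) auto
        finally show ?thesis .
      qed
      ultimately have "Eb + real (card J) * (5 * sqrt (E s + \<zeta>)) \<le> 11 * real Q * \<theta> ^ (2 * m)" by simp
      also have "\<dots> \<le> 11 * real Q * \<theta> ^ (m + 1)"
        using m1 by (intro mult_left_mono pow) auto
      also have "\<dots> = (11 * real Q * \<theta>) * \<theta> ^ m" by simp
      also have "\<dots> \<le> 1 * \<theta> ^ m"
      proof (rule mult_right_mono)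
        have "11 * real Q * \<theta> \<le> 100 * real Q * \<theta>" using \<theta> by (intro mult_right_mono) auto
        then show "11 * real Q * \<theta> \<le> 1" using small dQ by linarith
      qed (use \<theta> in simp)
      finally show ?thesis by (simp add: Es')
    qed
  qed (use a in \<open>auto simp: b_def\<close>)
  have pb: "positions J a = positions J b" by (auto simp: positions_def b_def)
  have db: "dens_prod h types a = dens_prod h types b" for h
    unfolding dens_prod_def mon_def
    by (intro prod.cong refl arg_cong2[of _ _ _ _ power]) (auto simp: types_def b_def)
  have Dlow: "\<theta> ^ Q \<le> dens_prod d types b"
  proof -
    have "card types \<le> Q"
    proof -
      have "card types \<le> card (Pow J)" using finJ by (intro card_mono) (auto simp: types_def)
      also have "\<dots> = 2 ^ card J" using finJ by (simp add: card_Pow)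
      also have "\<dots> \<le> Q" unfolding Q_def using cardJ by (intro power_increasing) auto
      finally show ?thesis .
    qed
    then have "\<theta> ^ Q \<le> \<theta> ^ card types" by (rule pow)
    also have "\<dots> \<le> (\<delta> ^ Q) ^ card types" using \<theta> \<theta>1 by (intro power_mono) auto
    also have "\<dots> = (\<Prod>f\<in>types. \<delta> ^ Q)" by simp
    also have "\<dots> \<le> dens_prod d types b"
      unfolding dens_prod_def
    proof (rule prod_mono)
      fix f assume f: "f \<in> types"
      have "mon b f \<le> (\<Prod>i\<in>f. 2)" unfolding mon_def using a by (intro prod_mono) (auto simp: b_def)
      also have "\<dots> = 2 ^ card f" by simp
      also have "\<dots> \<le> Q"
        unfolding Q_def
      proof (rule power_increasing)
        show "card f \<le> k + 1" using f cardJ card_mono[OF finJ, of f] by (auto simp: types_def)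
      qed simp
      finally have "\<delta> ^ Q \<le> \<delta> ^ mon b f" using \<delta> by (intro power_decreasing) auto
      also have "\<dots> \<le> d f ^ mon b f" using d[OF f] \<delta> by (intro power_mono) auto
      finally show "0 \<le> \<delta> ^ Q \<and> \<delta> ^ Q \<le> d f ^ mon b f" using \<delta> by simp
    qed
    finally show ?thesis .
  qed
  have Dpos: "0 < dens_prod d types b" using Dlow \<theta> by (smt (verit) zero_less_power)
  have E_end: "\<bar>nrm (hy types) b - dens_prod d types b\<bar> \<le> \<theta> * dens_prod d types b"
  proof -
    have "E (card (J - {})) = \<theta> ^ 4 ^ (k + 2)" by (simp add: E_def n_def)
    moreover have "\<theta> ^ 4 ^ (k + 2) \<le> \<theta> ^ (1 + Q)"
    proof (rule pow)
      have "(2::nat) ^ (k + 2) \<le> 4 ^ (k + 2)" by (intro power_mono) auto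
      then show "1 + Q \<le> 4 ^ (k + 2)" using Q by (simp add: Q_def)
    qed
    moreover have "\<theta> ^ (1 + Q) \<le> \<theta> * dens_prod d types b" using Dlow \<theta> by simp
    ultimately show ?thesis using all by linarith
  qed
  have "cnt V g (positions J a) / (g {} * dens_prod (\<lambda>f. p f * d f) types a)
      = nrm (hy types) b / dens_prod d types b"
  proof -
    have "dens_prod (\<lambda>f. p f * d f) types b = dens_prod p types b * dens_prod d types b"
      by (simp add: dens_prod_def power_mult_distrib prod.distrib)
    then show ?thesis
      using g0 kappa_pos \<kappa> unfolding pb db nrm_def model_def
      by (simp add: cnt_all_types)
  qed
  also have "\<bar>nrm (hy types) b / dens_prod d types b - 1\<bar> = \<bar>nrm (hy types) b - dens_prod d types b\<bar> / dens_prod d types b"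
    by (rule abs_divide_minus[OF Dpos])
  also have "\<dots> \<le> \<theta>" using E_end Dpos by (simp add: divide_le_eq)
  finally show ?thesis .
qed

end

section \<open>Parameters\<close>

lemma crossing_mono:
  assumes "K \<subseteq> J" "disjoint_family_on V J" "u \<in> crossing K V"
  shows "u \<in> crossing J V"
proof -
  have u: "u \<subseteq> (\<Union>j\<in>K. V j)" "finite u" "\<And>j. j \<in> K \<Longrightarrow> card (u \<inter> V j) \<le> 1"
    using assms(3) by (auto simp: crossing_def)
  have "card (u \<inter> V j) \<le> 1" if j: "j \<in> J" for j
  proof (cases "j \<in> K")
    case False
    have "V i \<inter> V j = {}" if "i \<in> K" for i
      using assms(1,2) that j False by (metis disjoint_family_onD subsetD)
    then have "u \<inter> V j = {}" using u(1) by blast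
    then show ?thesis by simp
  qed (use u in auto)
  moreover have "u \<subseteq> (\<Union>j\<in>J. V j)" using u(1) assms(1) by blast
  ultimately show ?thesis using u(2) by (simp add: crossing_def)
qed

lemma prod_subset_le:
  fixes f :: "'b \<Rightarrow> real"
  assumes "finite A" "B \<subseteq> A" "\<And>z. z \<in> A \<Longrightarrow> 0 \<le> f z \<and> f z \<le> 1"
  shows "prod f A \<le> prod f B"
proof -
  have "prod f A = prod f (A - B) * prod f B" using assms(1,2) by (rule prod.subset_diff[rotated])
  also have "\<dots> \<le> 1 * prod f B"
    using assms by (intro mult_right_mono prod_le_1 prod_nonneg) auto
  finally show ?thesis by simp
qed

context parts
begin

lemma image_crossing_exact:
  assumes "finite X" "t \<in> tuples V X" "fst ` X \<subseteq> f" "f \<subseteq> J" "e \<in> faces X"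
  shows "t ` e \<in> crossing_exact f V \<longleftrightarrow> fst ` e = f"
proof -
  have fX: "fst ` X \<subseteq> J" using assms by auto
  have e: "e \<subseteq> X" "finite e" using assms finite_subset by (auto simp: faces_def)
  have ty: "type_of (t ` e) = fst ` e" using type_of_image[OF assms(2) fX e(1)] .
  have cr: "t ` e \<in> crossing J V" using image_crossing[OF assms(1,2) fX assms(5)] .
  show ?thesis
  proof
    assume ex: "t ` e \<in> crossing_exact f V"
    have "j \<in> fst ` e" if j: "j \<in> f" for j
    proof -
      have "card (t ` e \<inter> V j) = 1" using ex j by (simp add: crossing_exact_def)
      then have "t ` e \<inter> V j \<noteq> {}" by force
      then have "j \<in> type_of (t ` e)" using j assms(4) by (auto simp: type_of_def)
      then show ?thesis using ty by simp
    qed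
    then show "fst ` e = f" using e(1) assms(3) by blast
  next
    assume eq: "fst ` e = f"
    have "card (t ` e \<inter> V j) = 1" if j: "j \<in> f" for j
    proof -
      have "t ` e \<inter> V j \<noteq> {}" using j ty eq by (auto simp: type_of_def)
      moreover have "card (t ` e \<inter> V j) \<le> 1" using cr j assms(4) by (auto simp: crossing_def)
      moreover have "finite (t ` e \<inter> V j)" using e(2) by simp
      ultimately show ?thesis by (metis card_0_eq le_neq_implies_less less_one)
    qed
    moreover have "t ` e \<subseteq> (\<Union>j\<in>f. V j)" using e(1) assms(3) tuple_mem[OF assms(2)] by blast
    ultimately show "t ` e \<in> crossing_exact f V" using e(2) by (auto simp: crossing_exact_def)
  qed
qed

end

lemma card_crossing_exact:
  assumes "disjoint_family_on V f" "finite f" "u \<in> crossing_exact f V"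
  shows "card u = card f"
proof -
  have u: "u \<subseteq> (\<Union>j\<in>f. V j)" "finite u" "\<And>j. j \<in> f \<Longrightarrow> card (u \<inter> V j) = 1"
    using assms(3) by (auto simp: crossing_exact_def)
  have "u = (\<Union>j\<in>f. u \<inter> V j)" using u(1) by blast
  then have "card u = card (\<Union>j\<in>f. u \<inter> V j)" by simp
  also have "\<dots> = (\<Sum>j\<in>f. card (u \<inter> V j))"
    using assms(1,2) u(2) by (intro card_UN_disjoint) (auto simp: disjoint_family_on_def)
  also have "\<dots> = card f" using u(3) by simp
  finally show ?thesis .
qed

locale ensemble_params =
  fixes k c h \<Delta> :: nat and P :: ensemble
  assumes k1: "1 \<le> k" and valid: "valid_ensemble k c h \<Delta> P"
begin

definition big :: real where "big = 2 ^ 2 ^ (k + 6)"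

lemma big_bounds: "1 \<le> big" "100 * 2 ^ (k + 1) \<le> big"
  "r \<le> k \<Longrightarrow> 100 * (real r + 1) * 6 ^ r \<le> big"
proof -
  have e: "4 * k + 7 \<le> (2::nat) ^ (k + 6)"
  proof -
    have "k + 1 \<le> 2 ^ k" unfolding Suc_eq_plus1[symmetric] by (rule Suc_leI[OF less_exp])
    then have "64 * (k + 1) \<le> 2 ^ k * 64" by simp
    then show ?thesis by (simp add: power_add)
  qed
  show "1 \<le> big" by (simp add: big_def)
  show A: "100 * (real r + 1) * 6 ^ r \<le> big" if "r \<le> k" for r
  proof -
    have "r < 2 ^ r" by (rule less_exp)
    then have "real r + 1 \<le> 2 ^ r" by (metis Suc_leI of_nat_Suc of_nat_le_iff of_nat_numeral of_nat_power add.commute)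
    then have "100 * (real r + 1) * 6 ^ r \<le> 2 ^ 7 * 2 ^ r * 8 ^ r"
      by (intro mult_mono power_mono) auto
    also have "(8::real) ^ r = 2 ^ (3 * r)" by (simp add: power_mult)
    also have "2 ^ 7 * 2 ^ r * 2 ^ (3 * r) = (2::real) ^ (4 * r + 7)"
    proof -
      have "4 * r + 7 = 7 + r + 3 * r" by simp
      then show ?thesis by (simp only: power_add)
    qed
    also have "\<dots> \<le> 2 ^ 2 ^ (k + 6)"
      using e that by (intro power_increasing) auto
    finally show ?thesis by (simp add: big_def)
  qed
  have "100 * (2::real) ^ (k + 1) = 100 * 2 * 2 ^ k" by simp
  also have "\<dots> \<le> 100 * (real k + 1) * 6 ^ k"
    using k1 by (intro mult_mono power_mono) auto
  finally show "100 * 2 ^ (k + 1) \<le> big" using A[of k] by simp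
qed

lemma min_dens_bounds: "l \<in> {1..k} \<Longrightarrow> 0 < min_dens P l" "l \<in> {1..k} \<Longrightarrow> min_dens P l < 1"
  and accuracy_bounds: "l \<le> k \<Longrightarrow> 0 < accuracy P l" "l \<le> k \<Longrightarrow> accuracy P l < 1"
  and reg_bounds: "l \<in> {1..k} \<Longrightarrow> r \<in> {1..k} \<Longrightarrow> i \<le> h \<Longrightarrow> 0 < reg P l r i"
    "l \<in> {1..k} \<Longrightarrow> r \<in> {1..k} \<Longrightarrow> i \<le> h \<Longrightarrow> reg P l r i < 1"
  using valid by (auto simp: valid_ensemble_def)

definition sigma :: "nat \<Rightarrow> nat \<Rightarrow> nat \<Rightarrow> real" where
  "sigma l r i = reg P l r i powr (1 / 16) + ((4 * real k + 1) * accuracy P (l - 1)) powr (1 / 32)"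

lemma sigma_bounds:
  assumes l: "l \<in> {1..k}" and r: "r \<in> {1..k}" and i: "i < h"
  shows "0 < sigma l r i" "big * sigma l r i \<le> min_dens P l ^ 2 ^ (k + 1) * reg P l r (i + 1)"
    "sigma l r i \<le> 1" "reg P l r i \<le> sigma l r i ^ 16" "(4 * real k + 1) * accuracy P (l - 1) \<le> sigma l r i ^ 32"
proof -
  have r0: "0 < reg P l r i" "0 < reg P l r (i + 1)" "reg P l r (i + 1) < 1"
    using reg_bounds[OF l r] i by auto
  have a0: "0 < accuracy P (l - 1)" using l by (intro accuracy_bounds) auto
  have d: "0 < min_dens P l" "min_dens P l < 1" using min_dens_bounds[OF l] by auto
  show s0: "0 < sigma l r i" using r0 by (simp add: sigma_def add_pos_nonneg)
  have ve: "2 ^ (2 ^ (k + 6)) * real k ^ 3 * sigma l r i / min_dens P l ^ (2 ^ (k + 1)) \<le> reg P l r (i + 1)"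
    using valid l r i unfolding valid_ensemble_def sigma_def by auto
  have "1 \<le> real k ^ 3" using k1 by simp
  then have "big * 1 * sigma l r i \<le> big * real k ^ 3 * sigma l r i"
    using s0 big_bounds(1) by (intro mult_right_mono mult_left_mono) auto
  also have "\<dots> \<le> min_dens P l ^ 2 ^ (k + 1) * reg P l r (i + 1)"
    using ve d by (simp add: big_def divide_le_eq mult.commute)
  finally show b: "big * sigma l r i \<le> min_dens P l ^ 2 ^ (k + 1) * reg P l r (i + 1)" by simp
  have "1 * sigma l r i \<le> big * sigma l r i" using s0 big_bounds(1) by (intro mult_right_mono) auto
  also have "\<dots> \<le> 1 * 1"
    by (rule order.trans[OF b]) (use d r0 in \<open>intro mult_mono power_le_one; auto\<close>)
  finally show "sigma l r i \<le> 1" by simp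
  have "reg P l r i = (reg P l r i powr (1 / 16)) ^ 16"
    using r0 by (simp add: powr_power)
  also have "\<dots> \<le> sigma l r i ^ 16" by (intro power_mono) (auto simp: sigma_def)
  finally show "reg P l r i \<le> sigma l r i ^ 16" .
  have "(4 * real k + 1) * accuracy P (l - 1) = (((4 * real k + 1) * accuracy P (l - 1)) powr (1 / 32)) ^ 32"
    using a0 by (simp add: powr_power)
  also have "\<dots> \<le> sigma l r i ^ 32" by (intro power_mono) (auto simp: sigma_def)
  finally show "(4 * real k + 1) * accuracy P (l - 1) \<le> sigma l r i ^ 32" .
qed

lemma sigma_le_reg:
  assumes "l \<in> {1..k}" "r \<in> {1..k}" "i < h"
  shows "sigma l r i \<le> reg P l r (i + 1)"
proof -
  note s = sigma_bounds[OF assms] and d = min_dens_bounds[OF assms(1)]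
  have "1 * sigma l r i \<le> big * sigma l r i" using s(1) big_bounds(1) by (intro mult_right_mono) auto
  also have "\<dots> \<le> 1 * reg P l r (i + 1)"
    by (rule order.trans[OF s(2)]) (use d reg_bounds(1)[OF assms(1,2), of "i + 1"] assms(3) in
      \<open>intro mult_right_mono power_le_one; auto\<close>)
  finally show ?thesis by simp
qed

lemma reg_mono:
  assumes "l \<in> {1..k}" "r \<in> {1..k}" "i \<le> j" "j \<le> h"
  shows "reg P l r i \<le> reg P l r j"
  using assms(3,4)
proof (induction j rule: dec_induct)
  case (step j)
  note s = sigma_bounds[OF assms(1,2), of j]
  have "reg P l r j \<le> sigma l r j ^ 16" using s step by auto
  also have "\<dots> \<le> sigma l r j ^ 1" using s step by (intro power_decreasing) auto
  also have "\<dots> \<le> reg P l r (j + 1)" using sigma_le_reg[OF assms(1,2), of j] step by simp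
  finally show ?case using step by simp
qed simp

lemma reg_le_max:
  assumes "r \<in> {1..k}" "i \<le> h"
  shows "reg P l r i \<le> reg_max k h P l"
proof -
  have "reg P l r i \<in> (\<lambda>(r, i). reg P l r i) ` ({1..k} \<times> {0..h})" using assms by force
  then show ?thesis unfolding reg_max_def by (intro Max_ge) auto
qed

lemma reg_max_le_accuracy:
  assumes "l \<in> {1..k}" "1 \<le> \<Delta>"
  shows "reg_max k h P l \<le> accuracy P l"
proof -
  have m0: "0 \<le> reg_max k h P l"
    using reg_le_max[of 1 0 l] reg_bounds(1)[OF assms(1), of 1 0] k1 by simp
  have ve: "reg_max k h P l * (72 * real k * (real k + 1) * real \<Delta> ^ 2)
      \<le> accuracy P l * min_dens P l * (\<Prod>l''\<in>{l<..l}. min_dens P l'' ^ c)"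
    using valid assms(1) unfolding valid_ensemble_def by (metis atLeastAtMost_iff order.refl)
  have "reg_max k h P l * 1 \<le> reg_max k h P l * (72 * real k * (real k + 1) * real \<Delta> ^ 2)"
  proof (rule mult_left_mono)
    have "1 * 1 * 1 * 1 \<le> 72 * real k * (real k + 1) * real \<Delta> ^ 2"
      using k1 assms(2) by (intro mult_mono) auto
    then show "1 \<le> 72 * real k * (real k + 1) * real \<Delta> ^ 2" by simp
  qed (rule m0)
  also have "\<dots> \<le> accuracy P l * min_dens P l" using ve by simp
  also have "\<dots> \<le> accuracy P l * 1"
    using min_dens_bounds[OF assms(1)] accuracy_bounds[of l] assms(1) by (intro mult_left_mono) auto
  finally show ?thesis by simp
qed

text \<open>By iterating (VE2) and (VE4), all regularity and accuracy parameters that enter the counts of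
  level \<open>l\<close> are large powers of \<open>theta l\<close>.\<close>

definition theta :: "nat \<Rightarrow> real" where
  "theta l = reg_max k h P l * min_dens P l ^ 2 ^ (k + 1) / big"

lemma theta_bounds:
  assumes "l \<in> {1..k}" "1 \<le> \<Delta>"
  shows "0 < theta l" "big * theta l \<le> min_dens P l ^ 2 ^ (k + 1)" "theta l \<le> accuracy P l" "theta l \<le> 1"
proof -
  have d: "0 < min_dens P l" "min_dens P l < 1" using min_dens_bounds[OF assms(1)] by auto
  have m: "0 < reg_max k h P l"
    using reg_le_max[of 1 0 l] reg_bounds(1)[OF assms(1), of 1 0] k1 by simp
  have a: "reg_max k h P l \<le> accuracy P l" "accuracy P l < 1"
    using reg_max_le_accuracy[OF assms] accuracy_bounds[of l] assms(1) by auto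
  show "0 < theta l" using m d big_bounds(1) by (simp add: theta_def)
  have "big * theta l = reg_max k h P l * min_dens P l ^ 2 ^ (k + 1)"
    using big_bounds(1) by (simp add: theta_def)
  also have "\<dots> \<le> 1 * min_dens P l ^ 2 ^ (k + 1)" using a d by (intro mult_right_mono) auto
  finally show "big * theta l \<le> min_dens P l ^ 2 ^ (k + 1)" by simp
  have "theta l \<le> reg_max k h P l * 1 / 1"
    unfolding theta_def using m d big_bounds(1)
    by (intro frac_le mult_mono power_le_one) auto
  then show "theta l \<le> accuracy P l" "theta l \<le> 1" using a by auto
qed

lemma reg_le_theta:
  assumes l: "l \<in> {1..k}" and r: "r \<in> {1..k}" and \<Delta>: "1 \<le> \<Delta>" and s: "s < h"
  shows "reg P l r (h - Suc s) \<le> theta l ^ 16 ^ Suc s"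
  using s
proof (induction s)
  case 0
  note sb = sigma_bounds[OF l r, of "h - 1"]
  have "big * sigma l r (h - 1) \<le> min_dens P l ^ 2 ^ (k + 1) * reg_max k h P l"
    using sb(2) 0 reg_le_max[OF r, of h l] min_dens_bounds[OF l]
    by (auto intro: order.trans mult_left_mono)
  then have "sigma l r (h - 1) \<le> theta l"
    using big_bounds(1) by (simp add: theta_def le_divide_eq mult.commute)
  then have "sigma l r (h - 1) ^ 16 \<le> theta l ^ 16"
    using sb 0 by (intro power_mono) auto
  then show ?case using sb(4) 0 by simp
next
  case (Suc s)
  note sb = sigma_bounds[OF l r, of "h - Suc (Suc s)"]
  have i: "h - Suc (Suc s) < h" "h - Suc (Suc s) + 1 = h - Suc s" using Suc by auto
  have "reg P l r (h - Suc (Suc s)) \<le> sigma l r (h - Suc (Suc s)) ^ 16" using sb(4) i by simp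
  also have "\<dots> \<le> reg P l r (h - Suc s) ^ 16"
    using sigma_le_reg[OF l r i(1)] sb(1) i by (intro power_mono) auto
  also have "\<dots> \<le> (theta l ^ 16 ^ Suc s) ^ 16"
    using Suc reg_bounds(1)[OF l r, of "h - Suc s"] by (intro power_mono) auto
  also have "\<dots> = theta l ^ 16 ^ Suc (Suc s)" by (simp add: power_mult[symmetric] mult.commute)
  finally show ?case .
qed

lemma level_inputs_small:
  assumes l: "l \<in> {1..k}" and \<Delta>: "1 \<le> \<Delta>"
  defines "\<zeta> \<equiv> theta l ^ (4 ^ (2 * k + 3) + 1)"
  shows "r \<in> {1..k} \<Longrightarrow> i + (k + 2) \<le> h \<Longrightarrow> reg P l r i \<le> \<zeta>"
    and "1 + (k + 2) \<le> h \<Longrightarrow> (4 * real k + 1) * accuracy P (l - 1) \<le> \<zeta>"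
proof -
  note th = theta_bounds[OF l \<Delta>]
  have main: "reg P l r i \<le> \<zeta>" if r: "r \<in> {1..k}" and i: "i + (k + 2) \<le> h" for r i
  proof -
    define s where "s = h - Suc i"
    have s: "s < h" "h - Suc s = i" "k + 1 \<le> s" using i by (auto simp: s_def)
    have "reg P l r i \<le> theta l ^ 16 ^ Suc s" using reg_le_theta[OF l r \<Delta> s(1)] s(2) by simp
    also have "\<dots> \<le> \<zeta>"
      unfolding \<zeta>_def
    proof (rule power_decreasing)
      have "(4::nat) ^ (2 * k + 3) + 1 \<le> 4 ^ (2 * k + 3) * 4" by simp
      also have "\<dots> = 4 ^ (2 * (k + 2))" by (simp add: power_add)
      also have "\<dots> = 16 ^ (k + 2)" by (simp add: power_mult)
      also have "\<dots> \<le> 16 ^ Suc s" using s(3) by (intro power_increasing) auto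
      finally show "(4::nat) ^ (2 * k + 3) + 1 \<le> 16 ^ Suc s" .
    qed (use th in auto)
    finally show ?thesis .
  qed
  then show "r \<in> {1..k} \<Longrightarrow> i + (k + 2) \<le> h \<Longrightarrow> reg P l r i \<le> \<zeta>" .
  show "(4 * real k + 1) * accuracy P (l - 1) \<le> \<zeta>" if hh: "1 + (k + 2) \<le> h"
  proof -
    have r: "1 \<in> {1..k}" using k1 by simp
    have i: "0 < h" using hh by simp
    note sb = sigma_bounds[OF l r i]
    have "(4 * real k + 1) * accuracy P (l - 1) \<le> sigma l 1 0 ^ 32" by (rule sb(5))
    also have "\<dots> \<le> sigma l 1 0 ^ 1" using sb by (intro power_decreasing) auto
    also have "\<dots> \<le> reg P l 1 1" using sigma_le_reg[OF l r i] by simp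
    also have "\<dots> \<le> \<zeta>" using main[OF r hh] .
    finally show ?thesis .
  qed
qed

end

section \<open>Bad vertices of a good partial embedding\<close>

locale good_embedding = ensemble_params k c h \<Delta> P
  for k c h \<Delta> :: nat and P :: ensemble +
  fixes H :: "'a::linorder set_system" and D :: "nat \<Rightarrow> 'a set \<Rightarrow> real"
    and V :: "'a \<Rightarrow> 'v set" and \<phi> :: "'a \<rightharpoonup> 'v" and C :: "nat \<Rightarrow> 'v set \<Rightarrow> real"
    and \<Delta>' l :: nat
  assumes complex: "k_complex k H" and degree: "max_degree H = \<Delta>" and vdeg: "vdeg H \<le> \<Delta>'"
    and dstack: "density_stack k H D" and emb: "partial_embedding H \<phi>"
    and cstack: "candidate_stack k H \<phi> V C" and gpe: "gpe k c H P D V \<phi> C k"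
    and l: "1 \<le> l" "l \<le> k"
    and c_ge: "l * (4 * k + 1) \<le> c" and h_ge: "l * (4 * k + 1) + k * \<Delta>' \<le> h"
begin

definition J :: "'a set" where "J = verts H - dom \<phi>"

definition dens :: "nat \<Rightarrow> 'a set \<Rightarrow> real" where "dens i f = density_after H (dom \<phi>) (D i) f"

lemma finH: "finite (verts H)" "finite (edges H)"
proof -
  show v: "finite (verts H)" using complex by (simp add: k_complex_def)
  have "edges H \<subseteq> Pow (verts H)" using complex by (auto simp: k_complex_def)
  then show "finite (edges H)" using v finite_subset by blast
qed

lemma edge_props: "f \<in> edges H \<Longrightarrow> f \<subseteq> verts H" "f \<in> edges H \<Longrightarrow> card f \<le> k"
  "f \<in> edges H \<Longrightarrow> f' \<subseteq> f \<Longrightarrow> f' \<in> edges H"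
  using complex by (auto simp: k_complex_def)

lemma candidate:
  "\<And>x. x \<in> J \<Longrightarrow> finite (V x)" "\<And>x. x \<in> J \<Longrightarrow> V x \<noteq> {}" "disjoint_family_on V J"
  "\<And>i. i \<le> k \<Longrightarrow> partite_k_graph k J V (C i)"
  "\<And>i e. Suc i \<le> k \<Longrightarrow> e \<in> crossing J V \<Longrightarrow> C (Suc i) e \<le> C i e"
  "\<And>i f e. i \<le> k \<Longrightarrow> f \<subseteq> J \<Longrightarrow> f \<notin> edges H \<Longrightarrow> e \<in> crossing_exact f V \<Longrightarrow> C i e = 1"
  using cstack by (auto simp: candidate_stack_def J_def Let_def)

lemma C_nonneg: "i \<le> k \<Longrightarrow> u \<in> crossing J V \<Longrightarrow> 0 \<le> C i u"
  using candidate(4)[of i] by (auto simp: partite_k_graph_def k_graph_def)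

lemma finite_sub: "K \<subseteq> J \<Longrightarrow> finite K"
  using finH(1) by (rule rev_finite_subset) (auto simp: J_def)

lemma parts_sub:
  assumes "K \<subseteq> J"
  shows "parts K V"
proof unfold_locales
  show "finite K" using finite_sub[OF assms] .
  show "finite (V j)" "V j \<noteq> {}" if "j \<in> K" for j using candidate(1,2) assms that by blast+
  show "disjoint_family_on V K" using disjoint_family_on_mono[OF assms candidate(3)] .
qed

lemma crossing_sub: "K \<subseteq> J \<Longrightarrow> u \<in> crossing K V \<Longrightarrow> u \<in> crossing J V"
  using crossing_mono candidate(3) by blast

lemma empty_crossing: "{} \<in> crossing K V"
  by (simp add: crossing_def)

lemma C_decreasing: "i \<le> j \<Longrightarrow> j \<le> k \<Longrightarrow> u \<in> crossing J V \<Longrightarrow> C j u \<le> C i u"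
proof (induction j rule: dec_induct)
  case (step j)
  then show ?case using candidate(5)[of j u] by force
qed simp

lemma D_props: "i \<in> {1..k} \<Longrightarrow> f \<subseteq> verts H \<Longrightarrow> 0 \<le> D i f \<and> D i f \<le> 1"
  "i \<le> k \<Longrightarrow> f \<subseteq> verts H \<Longrightarrow> f \<notin> edges H \<Longrightarrow> D i f = 1"
  using dstack by (auto simp: density_stack_def)

lemma gpe_thc: "thc k (accuracy P 0) c V J (C 0) (dens 0)"
  and gpe_reg: "\<And>i e. i \<in> {1..k} \<Longrightarrow> e \<in> edges H \<Longrightarrow> e \<noteq> {} \<Longrightarrow> e \<subseteq> J \<Longrightarrow>
     regular_wrt e V (reg P i (card e) (hit_count H (dom \<phi>) e)) (dens i e)
       (replace_top V e (C i) (C (i - 1))) (C (i - 1))"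
  and gpe_min: "\<And>i e. i \<in> {1..k} \<Longrightarrow> e \<noteq> {} \<Longrightarrow> e \<subseteq> J \<Longrightarrow>
     min_dens P i \<le> (\<Prod>f\<in>{f. f \<subseteq> verts H \<and> e \<subseteq> f}. D i f)"
  using gpe unfolding gpe_def Let_def J_def dens_def[abs_def] by blast+

lemma thc_props: "counts_like k (accuracy P 0) c V J (C 0) (dens 0)" "density_k_graph k J (dens 0)"
  using gpe_thc by (auto elim: thc.cases)

lemma density_after_bounds:
  assumes "i \<in> {1..k}" "e \<subseteq> verts H"
  shows "density_after H S (D i) e \<le> 1"
    and "(\<Prod>f\<in>{f. f \<subseteq> verts H \<and> e \<subseteq> f}. D i f) \<le> density_after H S (D i) e"
proof -
  have fin: "finite {f. f \<subseteq> verts H \<and> e \<subseteq> f}"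
    by (rule finite_subset[of _ "Pow (verts H)"]) (use finH in auto)
  show "density_after H S (D i) e \<le> 1"
    unfolding density_after_def using D_props(1)[OF assms(1)] by (intro prod_le_1) auto
  show "(\<Prod>f\<in>{f. f \<subseteq> verts H \<and> e \<subseteq> f}. D i f) \<le> density_after H S (D i) e"
    unfolding density_after_def using D_props(1)[OF assms(1)] by (intro prod_subset_le fin) auto
qed

lemma dens_bounds:
  assumes "i \<in> {1..k}" "e \<noteq> {}" "e \<subseteq> J"
  shows "min_dens P i \<le> dens i e" "dens i e \<le> 1"
proof -
  have "e \<subseteq> verts H" using assms by (auto simp: J_def)
  from density_after_bounds[OF assms(1) this] gpe_min[OF assms]
  show "min_dens P i \<le> dens i e" "dens i e \<le> 1" by (auto simp: dens_def intro: order.trans)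
qed

lemma density_after_nonedge:
  assumes "i \<le> k" "e \<subseteq> verts H" "e \<notin> edges H"
  shows "density_after H S (D i) e = 1"
  unfolding density_after_def
proof (rule prod.neutral, rule ballI)
  fix f assume f: "f \<in> {f. f \<subseteq> verts H \<and> e \<subseteq> f \<and> f - e \<subseteq> S}"
  then have "f \<notin> edges H" using edge_props(3)[of f e] assms(3) by auto
  then show "D i f = 1" using D_props(2)[OF assms(1)] f by auto
qed

lemma dens0_nonneg: "f \<subseteq> J \<Longrightarrow> 0 \<le> dens 0 f"
  using thc_props(2) by (auto simp: density_k_graph_def k_graph_def)

lemma hit_count_le: "e \<in> edges H \<Longrightarrow> e \<subseteq> J \<Longrightarrow> hit_count H (dom \<phi>) e \<le> \<Delta>'"
proof -
  assume e: "e \<in> edges H" "e \<subseteq> J"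
  let ?S = "{x \<in> verts H. (\<forall>y\<in>e. x \<le> y) \<and> hits H x e}"
  have "{x \<in> dom \<phi>. hits H x e} \<subseteq> ?S"
  proof
    fix x assume x: "x \<in> {x \<in> dom \<phi>. hits H x e}"
    have "x \<le> y" if "y \<in> e" for y
    proof (rule ccontr)
      assume "\<not> x \<le> y"
      then have "y \<le> x" by simp
      moreover have "y \<in> verts H" "y \<notin> dom \<phi>" using e that by (auto simp: J_def)
      ultimately show False using emb x unfolding partial_embedding_def by blast
    qed
    then show "x \<in> ?S" using x emb by (auto simp: partial_embedding_def)
  qed
  then have "hit_count H (dom \<phi>) e \<le> card ?S"
    unfolding hit_count_def using finH by (intro card_mono) auto
  also have "\<dots> \<le> vdeg H"
    unfolding vdeg_def using finH e by (intro Max_ge) auto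
  finally show ?thesis using vdeg by simp
qed

lemma h_ge_degeneracy: "\<Delta>' + 4 * k + 1 \<le> h" "2 \<le> l \<Longrightarrow> \<Delta>' + 8 * k + 2 \<le> h"
proof -
  define A where "A = l * (4 * k + 1)"
  define B where "B = k * \<Delta>'"
  have h: "A + B \<le> h" using h_ge by (simp only: A_def B_def)
  have B: "\<Delta>' \<le> B" unfolding B_def using k1 mult_le_mono1[of 1 k \<Delta>'] by simp
  have "4 * k + 1 \<le> A" unfolding A_def using l mult_le_mono1[of 1 l "4 * k + 1"] by simp
  then show "\<Delta>' + 4 * k + 1 \<le> h" using h B by linarith
  assume "2 \<le> l"
  then have "8 * k + 2 \<le> A" unfolding A_def using mult_le_mono1[of 2 l "4 * k + 1"] by simp
  then show "\<Delta>' + 8 * k + 2 \<le> h" using h B by linarith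
qed

lemma c_le: "4 * k + 1 \<le> c"
proof (rule order.trans[OF _ c_ge])
  show "4 * k + 1 \<le> l * (4 * k + 1)" using l mult_le_mono1[of 1 l "4 * k + 1"] by simp
qed

definition reg_error :: "nat \<Rightarrow> 'a set \<Rightarrow> real" where
  "reg_error i f = (if f \<in> edges H then reg P i (card f) (hit_count H (dom \<phi>) f) else 0)"

definition dens_upto :: "nat \<Rightarrow> 'a set \<Rightarrow> real" where
  "dens_upto j f = (\<Prod>i\<le>j. dens i f)"

lemma dens_upto_Suc: "dens_upto (Suc j) f = dens_upto j f * dens (Suc j) f"
  by (simp add: dens_upto_def)

lemma dens_upto_pos:
  assumes "j \<le> k" "0 < dens 0 f" "f \<noteq> {}" "f \<subseteq> J"
  shows "0 < dens_upto j f"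
proof -
  have "0 < dens i f" if "i \<le> j" for i
  proof (cases "i = 0")
    case False
    then have "i \<in> {1..k}" using that assms(1) by auto
    then show ?thesis using dens_bounds(1)[of i f] min_dens_bounds(1)[of i] assms by force
  qed (use assms in auto)
  then show ?thesis unfolding dens_upto_def by (intro prod_pos) auto
qed

lemma pair_step:
  assumes "Suc i \<le> k" "K \<subseteq> J" "0 < C i {}" "\<And>f. f \<subseteq> K \<Longrightarrow> f \<noteq> {} \<Longrightarrow> 0 < dens 0 f"
  shows "weighted_pair K V (C i {}) (dens_upto i) (C (Suc i)) (C i)"
proof -
  interpret parts K V by (rule parts_sub[OF assms(2)])
  show ?thesis
  proof unfold_locales
    show "0 < C i {}" by fact
    show "0 < dens_upto i f" if "f \<subseteq> K" "f \<noteq> {}" for f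
      using that assms by (intro dens_upto_pos) auto
    show "0 \<le> C (Suc i) u \<and> C (Suc i) u \<le> C i u" if "u \<in> crossing K V" for u
      using crossing_sub[OF assms(2) that] C_nonneg candidate(5) assms(1) by auto
  qed
qed

lemma type_regular:
  assumes i: "Suc i \<le> k" and K: "K \<subseteq> J" and f: "f \<subseteq> K" "f \<noteq> {}"
    and pair: "weighted_pair K V \<kappa> p (C (Suc i)) (C i)"
  shows "(dens (Suc i) f - reg_error (Suc i) f) * modelled.nrm K V \<kappa> p (C i) (weighted_pair.uni f 1)
        \<le> modelled.nrm K V \<kappa> p (parts.hyb K V {f} (C (Suc i)) (C i)) (weighted_pair.uni f 1)"
    and "modelled.nrm K V \<kappa> p (parts.hyb K V {f} (C (Suc i)) (C i)) (weighted_pair.uni f 2)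
        \<le> (dens (Suc i) f ^ 2 ^ card f + reg_error (Suc i) f) * modelled.nrm K V \<kappa> p (C i) (weighted_pair.uni f 2)"
proof -
  interpret W: weighted_pair K V \<kappa> p "C (Suc i)" "C i" by (rule pair)
  have fJ: "f \<subseteq> J" "f \<subseteq> verts H" using f K by (auto simp: J_def)
  let ?rt = "replace_top V f (C (Suc i)) (C i)"
  let ?F = "\<lambda>n. full_partite f (\<lambda>_. n)"
  have X: "finite (positions f (\<lambda>_. n))" "fst ` positions f (\<lambda>_. n) \<subseteq> f" "fst ` positions f (\<lambda>_. n) \<subseteq> K" for n
    using f W.finJ finite_subset[of f K] by (auto simp: finite_positions positions_def)
  have pos: "positions K (W.uni f n) = positions f (\<lambda>_. n)" for n
    using f by (auto simp: positions_def W.uni_def split: if_splits)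
  have img: "t ` e \<in> crossing_exact f V \<longleftrightarrow> fst ` e = f" "W.type_of (t ` e) = fst ` e"
    if "t \<in> tuples V (positions f (\<lambda>_. n))" "e \<in> faces (positions f (\<lambda>_. n))" for t e n
    using W.image_crossing_exact[OF X(1) that(1) X(2) f(1) that(2)] W.type_of_image[OF that(1) X(3)] that(2)
    by (auto simp: faces_def)
  have nrm_g: "W.nrm (W.hy {f}) (W.uni f n) = hom_density V ?rt fst (?F n) / W.model (W.uni f n)" for n
  proof -
    have "cnt V (W.hy {f}) (positions f (\<lambda>_. n)) = cnt V ?rt (positions f (\<lambda>_. n))"
      unfolding cnt_def weight_def
      by (intro arg_cong2[of _ _ _ _ "(/)"] sum.cong prod.cong refl)
        (simp add: W.hyb_def replace_top_def img)
    then show ?thesis by (simp add: W.nrm_def pos hom_density_full_partite)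
  qed
  have nrm_\<gamma>: "W.nrm (C i) (W.uni f n) = hom_density V (C i) fst (?F n) / W.model (W.uni f n)" for n
    by (simp add: W.nrm_def pos hom_density_full_partite)
  have "(dens (Suc i) f - reg_error (Suc i) f) * hom_density V (C i) fst (?F 1) \<le> hom_density V ?rt fst (?F 1)
    \<and> hom_density V ?rt fst (?F 2) \<le> (dens (Suc i) f ^ 2 ^ card f + reg_error (Suc i) f) * hom_density V (C i) fst (?F 2)"
  proof (cases "f \<in> edges H")
    case True
    then show ?thesis
      using gpe_reg[of "Suc i" f] i f fJ by (auto simp: regular_wrt_def reg_error_def)
  next
    case False
    have "cnt V ?rt (positions f (\<lambda>_. n)) = cnt V (C i) (positions f (\<lambda>_. n))" for n
    proof -
      have "?rt u = C i u" for u
        using candidate(6)[OF i fJ(1) False, of u] candidate(6)[of i f u] i fJ False by (simp add: replace_top_def)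
      then show ?thesis by (metis ext)
    qed
    then show ?thesis
      using False density_after_nonedge[OF i fJ(2) False]
      by (simp add: reg_error_def dens_def hom_density_full_partite)
  qed
  then show "(dens (Suc i) f - reg_error (Suc i) f) * W.nrm (C i) (W.uni f 1) \<le> W.nrm (W.hy {f}) (W.uni f 1)"
    "W.nrm (W.hy {f}) (W.uni f 2) \<le> (dens (Suc i) f ^ 2 ^ card f + reg_error (Suc i) f) * W.nrm (C i) (W.uni f 2)"
    unfolding nrm_g nrm_\<gamma> using W.model_pos
    by (auto simp: divide_right_mono less_imp_le)
qed

lemma card_positions_le:
  assumes "finite K" "card K \<le> k + 1" "\<And>i. a i \<le> 2"
  shows "card (positions K a) \<le> 4 * k + 1"
proof -
  have "card (positions K a) = (\<Sum>i\<in>K. a i)" using assms(1) by (simp add: positions_def)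
  also have "\<dots> \<le> (\<Sum>i\<in>K. 2)" using assms(3) by (intro sum_mono)
  also have "\<dots> \<le> 4 * k + 1" using assms(2) k1 by simp
  finally show ?thesis .
qed

lemma level0_counts:
  assumes K: "K \<subseteq> J" "card K \<le> k + 1" and a: "\<And>i. a i \<le> 2"
  defines "M \<equiv> C 0 {} / dens 0 {} * dens_prod (dens 0) (Pow K) a"
  shows "\<bar>cnt V (C 0) (positions K a) - M\<bar> \<le> (4 * real k + 1) * accuracy P 0 * M" "0 \<le> M"
proof -
  interpret J: parts J V by (rule parts_sub) simp
  have finK: "finite K" using K J.finJ finite_subset by auto
  have cp: "card (positions K a) \<le> 4 * k + 1" by (rule card_positions_le[OF finK K(2) a])
  have c: "card (positions K a) \<le> c" using cp c_le by linarith
  have kg: "partite_k_graph k J V (C 0)" using candidate(4)[of 0] by simp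
  note b = J.counts_like_cnt[OF thc_props(1) kg thc_props(2) K(1) a c, folded M_def]
  show M: "0 \<le> M"
    unfolding M_def dens_prod_def
    using C_nonneg[of 0 "{}"] dens0_nonneg K empty_crossing
    by (intro mult_nonneg_nonneg divide_nonneg_nonneg prod_nonneg) auto
  have "real (card (positions K a)) * accuracy P 0 * M \<le> (4 * real k + 1) * accuracy P 0 * M"
    using cp accuracy_bounds(1)[of 0] M by (intro mult_right_mono) auto
  then show "\<bar>cnt V (C 0) (positions K a) - M\<bar> \<le> (4 * real k + 1) * accuracy P 0 * M"
    using b by (simp add: abs_le_iff algebra_simps)
qed

lemma level_counts:
  assumes K: "K \<subseteq> J" "card K \<le> k + 1" and pos: "\<And>f. f \<subseteq> K \<Longrightarrow> f \<noteq> {} \<Longrightarrow> 0 < dens 0 f"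
    and \<Delta>: "1 \<le> \<Delta>" and j: "j \<le> l - 1" and C: "0 < C j {}" and a: "\<And>i. a i \<le> 2"
  shows "\<bar>cnt V (C j) (positions K a) / (C j {} * dens_prod (dens_upto j) (Pow K - {{}}) a) - 1\<bar>
      \<le> (4 * real k + 1) * accuracy P j"
  using j C a
proof (induction j arbitrary: a)
  case 0
  have finK: "finite K" using K finite_sub by blast
  let ?N = "cnt V (C 0) (positions K a)" and ?M = "C 0 {} / dens 0 {} * dens_prod (dens 0) (Pow K) a"
  note b = level0_counts[OF K 0(3)]
  have p0: "dens 0 {} \<noteq> 0"
  proof
    assume z: "dens 0 {} = 0"
    have "\<bar>cnt V (C 0) (positions K (\<lambda>_. 0))\<bar> \<le> 0"
      using level0_counts(1)[of K "\<lambda>_. 0"] K z by simp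
    moreover have "positions K (\<lambda>_. 0) = {}" by (auto simp: positions_def)
    moreover have "faces ({} :: ('a \<times> nat) set) = {{}}" by (auto simp: faces_def)
    ultimately show False using 0(2) by (simp add: cnt_def tuples_def weight_def)
  qed
  have M: "?M = C 0 {} * dens_prod (dens_upto 0) (Pow K - {{}}) a"
    unfolding dens_prod_Pow[OF finK] using p0 by (simp add: dens_upto_def[abs_def])
  have "0 < C 0 {} * dens_prod (dens_upto 0) (Pow K - {{}}) a"
    unfolding dens_prod_def using 0(2) pos
    by (intro mult_pos_pos prod_pos) (auto simp: dens_upto_def)
  then have Mpos: "0 < ?M" unfolding M .
  have "\<bar>?N / ?M - 1\<bar> = \<bar>?N - ?M\<bar> / ?M" by (rule abs_divide_minus[OF Mpos])
  also have "\<dots> \<le> (4 * real k + 1) * accuracy P 0"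
    using b(1) by (simp only: pos_divide_le_eq[OF Mpos])
  finally show ?case unfolding M .
next
  case (Suc j)
  have finK: "finite K" using K finite_sub by blast
  have jk: "Suc j \<le> k" "Suc j \<in> {1..k}" using Suc.prems(1) l by auto
  have l2: "2 \<le> l" using Suc.prems(1) by linarith
  have Cj: "0 < C j {}" using candidate(5)[OF jk(1) empty_crossing] Suc.prems(2) by linarith
  interpret W: weighted_pair K V "C j {}" "dens_upto j" "C (Suc j)" "C j"
    by (rule pair_step[OF jk(1) K(1) Cj pos])
  let ?\<zeta> = "theta (Suc j) ^ (4 ^ (2 * k + 3) + 1)"
  have th: "0 < theta (Suc j)" "big * theta (Suc j) \<le> min_dens P (Suc j) ^ 2 ^ (k + 1)"
      "theta (Suc j) \<le> accuracy P (Suc j)"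
    using theta_bounds[OF jk(2) \<Delta>] by auto
  have hit: "hit_count H (dom \<phi>) f + (k + 2) \<le> h" if "f \<in> edges H" "f \<subseteq> J" for f
    using hit_count_le[OF that] h_ge_degeneracy(2)[OF l2] k1 by linarith
  have IH: "\<bar>W.nrm (C j) a - 1\<bar> \<le> ?\<zeta>" if "\<And>i. a i \<le> 2" for a
  proof -
    have "\<bar>W.nrm (C j) a - 1\<bar> \<le> (4 * real k + 1) * accuracy P j"
      unfolding W.nrm_def W.model_def W.types_def using Suc.prems(1) Cj that by (intro Suc.IH) auto
    also have "\<dots> \<le> ?\<zeta>"
      using level_inputs_small(2)[OF jk(2) \<Delta>] h_ge_degeneracy(2)[OF l2] k1 by simp
    finally show ?thesis .
  qed
  have "\<bar>cnt V (C (Suc j)) (positions K a)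
      / (C (Suc j) {} * dens_prod (\<lambda>f. dens_upto j f * dens (Suc j) f) W.types a) - 1\<bar> \<le> theta (Suc j)"
  proof (rule W.level_step[where k = k and \<delta> = "min_dens P (Suc j)" and L = big and \<zeta> = ?\<zeta>])
    show "card K \<le> k + 1" "C j {} = C j {}" "0 < C (Suc j) {}" using K Suc.prems by auto
    show "min_dens P (Suc j) \<le> dens (Suc j) f \<and> dens (Suc j) f \<le> 1" if "f \<in> W.types" for f
      using that K dens_bounds[OF jk(2), of f] by (auto simp: W.types_def)
    show "0 < min_dens P (Suc j)" "min_dens P (Suc j) \<le> 1" using min_dens_bounds[OF jk(2)] by auto
    show "\<exists>\<epsilon>. 0 \<le> \<epsilon> \<and> \<epsilon> \<le> ?\<zeta>
        \<and> (dens (Suc j) f - \<epsilon>) * W.nrm (C j) (W.uni f 1) \<le> W.nrm (W.hy {f}) (W.uni f 1)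
        \<and> W.nrm (W.hy {f}) (W.uni f 2) \<le> (dens (Suc j) f ^ 2 ^ card f + \<epsilon>) * W.nrm (C j) (W.uni f 2)"
      if f: "f \<in> W.types" for f
    proof (intro exI[of _ "reg_error (Suc j) f"] conjI)
      have fK: "f \<subseteq> K" "f \<noteq> {}" using f by (auto simp: W.types_def)
      have "0 \<le> reg_error (Suc j) f \<and> reg_error (Suc j) f \<le> ?\<zeta>"
      proof (cases "f \<in> edges H")
        case True
        have "1 \<le> card f" using fK finK finite_subset by (simp add: Suc_le_eq card_gt_0_iff)
        then have r: "card f \<in> {1..k}" using edge_props(2)[OF True] by simp
        have hh: "hit_count H (dom \<phi>) f + (k + 2) \<le> h" using hit[OF True] fK K by auto
        show ?thesis
          using True level_inputs_small(1)[OF jk(2) \<Delta> r hh] reg_bounds(1)[OF jk(2) r, of "hit_count H (dom \<phi>) f"] hh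
          by (simp add: reg_error_def)
      next
        case False
        then show ?thesis using th(1) by (simp add: reg_error_def)
      qed
      then show "0 \<le> reg_error (Suc j) f" "reg_error (Suc j) f \<le> ?\<zeta>" by auto
      note tr = type_regular[OF jk(1) K(1) fK W.weighted_pair_axioms]
      show "(dens (Suc j) f - reg_error (Suc j) f) * W.nrm (C j) (W.uni f 1) \<le> W.nrm (W.hy {f}) (W.uni f 1)"
        "W.nrm (W.hy {f}) (W.uni f 2) \<le> (dens (Suc j) f ^ 2 ^ card f + reg_error (Suc j) f) * W.nrm (C j) (W.uni f 2)"
        using tr by auto
    qed
  qed (use IH th big_bounds(2) Suc.prems(3) in auto)
  moreover have "theta (Suc j) \<le> (4 * real k + 1) * accuracy P (Suc j)"
  proof -
    have "1 * accuracy P (Suc j) \<le> (4 * real k + 1) * accuracy P (Suc j)"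
      using accuracy_bounds(1)[OF jk(1)] by (intro mult_right_mono) auto
    then show ?thesis using th(3) by simp
  qed
  moreover have "(\<lambda>f. dens_upto j f * dens (Suc j) f) = dens_upto (Suc j)"
    by (simp add: dens_upto_Suc fun_eq_iff)
  ultimately show ?case by (simp add: W.types_def)
qed

end

context good_embedding
begin

lemma reg_next: "i \<in> {1..k} \<Longrightarrow> r \<in> {1..k - 1} \<Longrightarrow> reg P i (r + 1) h \<le> reg P i r 0"
  using valid by (auto simp: valid_ensemble_def)

text \<open>For facts about links that do not involve densities the constant model suffices; it is also
  available when some density of level \<open>0\<close> vanishes.\<close>

lemma vertex_link_trivial_model:
  assumes "x \<in> J" "e \<subseteq> J - {x}" "e \<noteq> {}" "Suc i \<le> k"
  shows "vertex_link x e V 1 (\<lambda>_. 1) (C (Suc i)) (C i)"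
proof -
  have K: "insert x e \<subseteq> J" using assms by auto
  interpret parts "insert x e" V by (rule parts_sub[OF K])
  show ?thesis
    by unfold_locales (use crossing_sub[OF K] C_nonneg candidate(5) assms in auto)
qed

definition update_regular :: "'a \<Rightarrow> 'a set \<Rightarrow> 'v \<Rightarrow> bool" where
  "update_regular x e v \<longleftrightarrow>
     regular_wrt e V (reg P l (card e) (hit_count H (insert x (dom \<phi>)) e))
       (density_after H (insert x (dom \<phi>)) (D l) e)
       (replace_top V e (link v (C l)) (link v (C (l - 1)))) (link v (C (l - 1)))"

definition link_cnt :: "'a \<Rightarrow> 'a set \<Rightarrow> nat \<Rightarrow> 'v \<Rightarrow> real" where
  "link_cnt x e n v = cnt V (link v (parts.hyb (insert x e) V {e, insert x e} (C l) (C (l - 1)))) (positions e (\<lambda>_. n))"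

definition link_base :: "'a set \<Rightarrow> nat \<Rightarrow> 'v \<Rightarrow> real" where
  "link_base e n v = cnt V (link v (C (l - 1))) (positions e (\<lambda>_. n))"

lemma update_regularI:
  assumes x: "x \<in> J" and e: "e \<subseteq> J - {x}" "e \<noteq> {}" and v: "v \<in> V x"
  defines "d \<equiv> density_after H (insert x (dom \<phi>)) (D l) e"
    and "\<epsilon> \<equiv> reg P l (card e) (hit_count H (insert x (dom \<phi>)) e)"
  assumes r: "\<bar>link_cnt x e 1 v - d * link_base e 1 v\<bar> \<le> \<epsilon> * link_base e 1 v"
    "link_cnt x e 2 v \<le> (d ^ 2 ^ card e + \<epsilon>) * link_base e 2 v"
  shows "update_regular x e v"
proof -
  have Sl: "Suc (l - 1) = l" "Suc (l - 1) \<le> k" using l by auto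
  interpret L: vertex_link x e V 1 "\<lambda>_. 1" "C l" "C (l - 1)"
    using vertex_link_trivial_model[OF x e Sl(2)] Sl by simp
  have eJ: "e \<subseteq> J" using e by auto
  interpret E: parts e V by (rule parts_sub[OF eJ])
  let ?rt = "replace_top V e (link v (C l)) (link v (C (l - 1)))"
  have ex: "card u = card e" if "u \<in> crossing_exact e V" for u
    using card_crossing_exact[OF E.disjV E.finJ that] .
  have lower: "?rt u = link v (C (l - 1)) u" if "card u < card e" for u
    using ex[of u] that by (auto simp: replace_top_def)
  have top: "?rt u \<le> link v (C (l - 1)) u" if "u \<in> crossing e V" for u
    using L.link_hy(2)[OF v that, of UNIV] by (simp add: replace_top_def L.hyb_def[abs_def])
  have hd: "hom_density V ?rt fst (full_partite e (\<lambda>_. n)) = link_cnt x e n v" for n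
  proof -
    let ?X = "positions e (\<lambda>_. n)"
    have X: "finite ?X" "fst ` ?X \<subseteq> e" "fst ` ?X \<subseteq> insert x e"
      using E.finJ by (auto simp: finite_positions positions_def)
    have "weight ?rt ?X t = weight (link v (L.hy {e, insert x e})) ?X t" if t: "t \<in> tuples V ?X" for t
      unfolding weight_def
    proof (intro prod.cong refl)
      fix e' assume e': "e' \<in> faces ?X"
      then have sub: "e' \<subseteq> ?X" by (simp add: faces_def)
      have ty: "L.type_of (t ` e') = fst ` e'" by (rule L.type_of_image[OF t X(3) sub])
      have ty': "L.type_of (insert v (t ` e')) = insert x (fst ` e')"
        using L.type_of_insert[OF v] ty by simp
      have xn: "x \<notin> fst ` e'" using sub X(2) L.x_notin by auto
      have iff: "insert x (fst ` e') = insert x e \<longleftrightarrow> fst ` e' = e" "fst ` e' \<noteq> insert x e" "insert x (fst ` e') \<noteq> e"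
        using xn L.x_notin by (auto simp: insert_ident)
      have "t ` e' \<in> crossing_exact e V \<longleftrightarrow> fst ` e' = e"
        by (rule E.image_crossing_exact[OF X(1) t X(2) order.refl e'])
      then show "?rt (t ` e') = link v (L.hy {e, insert x e}) (t ` e')"
        using iff by (simp add: replace_top_def link_def L.hyb_def ty ty')
    qed
    then show ?thesis by (simp add: hom_density_full_partite link_cnt_def cnt_def)
  qed
  have hb: "hom_density V (link v (C (l - 1))) fst (full_partite e (\<lambda>_. n)) = link_base e n v" for n
    by (simp add: hom_density_full_partite link_base_def)
  show ?thesis
    unfolding update_regular_def regular_wrt_def hd hb d_def[symmetric] \<epsilon>_def[symmetric]
    using lower top r by (auto simp: abs_le_iff algebra_simps)
qed

lemma link_vanishes:
  assumes x: "x \<in> J" and e: "e \<subseteq> J - {x}" "e \<noteq> {}" and ce: "card e \<le> k" and v: "v \<in> V x"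
    and z: "C (l - 1) {} = 0 \<or> (\<exists>f. f \<subseteq> insert x e \<and> f \<noteq> {} \<and> dens 0 f \<le> 0)" and n: "n = 1 \<or> n = 2"
  shows "link_base e n v = 0" "link_cnt x e n v = 0"
proof -
  have Sl: "Suc (l - 1) = l" "Suc (l - 1) \<le> k" using l by auto
  interpret L: vertex_link x e V 1 "\<lambda>_. 1" "C l" "C (l - 1)"
    using vertex_link_trivial_model[OF x e Sl(2)] Sl by simp
  have K: "insert x e \<subseteq> J" "card (insert x e) \<le> k + 1" using x e ce L.fin_e L.x_notin by auto
  let ?b = "L.uni e n"
  let ?a = "?b(x := 1)"
  have b: "?b x = 0" using L.x_notin by (simp add: L.uni_def)
  have a2: "?a i \<le> 2" for i using n by (auto simp: L.uni_def)
  have apos: "0 < ?a i" if "i \<in> insert x e" for i using that n by (auto simp: L.uni_def)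
  have X: "finite (positions (insert x e) ?a)" "fst ` positions (insert x e) ?a \<subseteq> insert x e"
    using L.finJ by (auto simp: finite_positions positions_def)
  have "cnt V (C (l - 1)) (positions (insert x e) ?a) \<le> 0"
  proof (cases "C (l - 1) {} = 0")
    case True
    have e0: "{} \<in> faces (positions (insert x e) ?a)" by (simp add: faces_def)
    have "weight (C (l - 1)) (positions (insert x e) ?a) t = 0" for t
      unfolding weight_def
      by (rule prod_zero[OF finite_faces[OF X(1)] bexI[OF _ e0]]) (simp only: True image_empty)
    then show ?thesis by (simp add: cnt_def)
  next
    case False
    then obtain f where f: "f \<subseteq> insert x e" "f \<noteq> {}" "dens 0 f \<le> 0" using z by auto
    then have d0: "dens 0 f = 0" using dens0_nonneg[of f] K by auto
    have "0 < mon ?a f"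
      unfolding mon_def
    proof (rule prod_pos)
      show "0 < ?a i" if "i \<in> f" for i using apos that f(1) by blast
    qed
    then have mon: "mon ?a f \<noteq> 0" by simp
    have "dens_prod (dens 0) (Pow (insert x e)) ?a = 0"
      unfolding dens_prod_def
    proof (rule prod_zero[OF _ bexI[of _ f]])
      show "dens 0 f ^ mon ?a f = 0" using d0 mon by (simp only: power_0_left if_False)
    qed (use f L.finJ in auto)
    then have "cnt V (C 0) (positions (insert x e) ?a) \<le> 0"
      using level0_counts(1)[OF K, of ?a, OF a2] by (simp del: fun_upd_apply)
    moreover have "cnt V (C (l - 1)) (positions (insert x e) ?a) \<le> cnt V (C 0) (positions (insert x e) ?a)"
      using crossing_sub[OF K(1)] C_nonneg C_decreasing[of 0 "l - 1"] l by (intro L.count_mono X) auto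
    ultimately show ?thesis by simp
  qed
  then have le0: "(\<Sum>v\<in>V x. cnt V (link v (C (l - 1))) (positions e ?b)) \<le> 0"
    unfolding L.cnt_root[of ?b, OF b] using L.card_V_pos[of x] by (simp add: divide_le_0_iff)
  have pe: "positions e (\<lambda>_. n) = positions e ?b" by (auto simp: positions_def L.uni_def)
  have base: "link_base e n v' = cnt V (link v' (C (l - 1))) (positions e ?b)" for v'
    by (simp only: link_base_def pe)
  have eJ: "e \<subseteq> J" using e by auto
  interpret E: parts e V by (rule parts_sub[OF eJ])
  have Xe: "finite (positions e ?b)" "fst ` positions e ?b \<subseteq> e"
    using E.finJ by (auto simp: finite_positions positions_def)
  have nn: "0 \<le> cnt V (link v' (L.hy U)) (positions e ?b)" if "v' \<in> V x" for v' U
    using L.link_hy(1)[OF that] by (intro E.count_nonneg Xe)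
  have nn0: "0 \<le> cnt V (link v' (C (l - 1))) (positions e ?b)" if "v' \<in> V x" for v'
    using nn[OF that, of "{}"] by (simp only: L.hyb_empty)
  have "(\<Sum>v\<in>V x. cnt V (link v (C (l - 1))) (positions e ?b)) = 0"
    using le0 sum_nonneg[OF nn0] by (rule order_antisym)
  then have "\<forall>v\<in>V x. cnt V (link v (C (l - 1))) (positions e ?b) = 0"
    by (rule iffD1[OF sum_nonneg_eq_0_iff, rotated -1]) (rule candidate(1)[OF x], rule nn0)
  then have "cnt V (link v (C (l - 1))) (positions e ?b) = 0" using v by (rule bspec)
  then show z0: "link_base e n v = 0" by (simp add: base)
  have "cnt V (link v (L.hy {e, insert x e})) (positions e ?b) \<le> cnt V (link v (C (l - 1))) (positions e ?b)"
    using L.link_hy[OF v] by (intro E.count_mono Xe) auto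
  then show "link_cnt x e n v = 0"
    using nn[OF v, of "{e, insert x e}"] z0 unfolding link_cnt_def pe base by linarith
qed

lemma density_after_update:
  assumes "x \<in> J" "e \<subseteq> J - {x}"
  shows "density_after H (insert x (dom \<phi>)) (D l) e = dens l e * dens l (insert x e)"
  using density_after_insert[OF finH(1), of x "dom \<phi>" e "D l"] assms by (auto simp: J_def link_def dens_def)

lemma hit_count_insert:
  assumes "x \<in> J"
  shows "hit_count H (insert x (dom \<phi>)) e = (if hits H x e then Suc (hit_count H (dom \<phi>) e) else hit_count H (dom \<phi>) e)"
proof -
  have fin: "finite {y \<in> dom \<phi>. hits H y e}"
    using emb finH by (auto simp: partial_embedding_def intro: finite_subset)
  have "x \<notin> dom \<phi>" using assms by (simp add: J_def)
  moreover have "{y \<in> insert x (dom \<phi>). hits H y e} =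
      (if hits H x e then insert x {y \<in> dom \<phi>. hits H y e} else {y \<in> dom \<phi>. hits H y e})" by auto
  ultimately show ?thesis using fin by (simp add: hit_count_def)
qed

lemma singleton_nonneg:
  assumes "x \<in> J" "v \<in> V x" "i \<le> k"
  shows "0 \<le> C i {v}"
proof (rule C_nonneg[OF assms(3)])
  have "card ({v} \<inter> V j) \<le> 1" for j
    using card_mono[of "{v}" "{v} \<inter> V j"] by simp
  then show "{v} \<in> crossing J V" using assms(1,2) by (auto simp: crossing_def)
qed

lemma not_hit_regular:
  assumes x: "x \<in> J" and e: "e \<subseteq> J - {x}" "e \<noteq> {}" "e \<in> edges H" and v: "v \<in> V x" and nh: "\<not> hits H x e"
  shows "update_regular x e v"
proof -
  have Sl: "Suc (l - 1) = l" "Suc (l - 1) \<le> k" "l - 1 \<le> k" "l \<in> {1..k}" using l by auto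
  have eJ: "e \<subseteq> J" using e by auto
  have K: "insert x e \<subseteq> J" using e x by auto
  interpret L: vertex_link x e V 1 "\<lambda>_. 1" "C l" "C (l - 1)"
    using vertex_link_trivial_model[OF x e(1,2) Sl(2)] Sl by simp
  interpret E: parts e V by (rule parts_sub[OF eJ])
  let ?h = "L.hy {e, insert x e}"
  have one: "?h (insert v u) = 1 \<and> C (l - 1) (insert v u) = 1"
    if t: "t \<in> tuples V (positions e (\<lambda>_. n))" and f: "f \<in> faces (positions e (\<lambda>_. n))" "f \<noteq> {}" "u = t ` f" for t f u n
  proof -
    have X: "finite (positions e (\<lambda>_. n))" "fst ` positions e (\<lambda>_. n) \<subseteq> e" "x \<notin> fst ` positions e (\<lambda>_. n)"
      using E.finJ L.x_notin by (auto simp: finite_positions positions_def)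
    let ?f = "fst ` f"
    have fe: "?f \<subseteq> e" "?f \<noteq> {}" "f \<subseteq> positions e (\<lambda>_. n)" using f X by (auto simp: faces_def)
    have ne: "insert x ?f \<notin> edges H" using nh fe by (auto simp: hits_def)
    let ?X = "insert (x, 0) (positions e (\<lambda>_. n))"
    have y: "(x, 0) \<notin> positions e (\<lambda>_. n)" using X(3) by force
    have t': "t((x, 0) := v) \<in> tuples V ?X" using t v by (simp add: tuples_def PiE_fun_upd)
    have f': "insert (x, 0) f \<in> faces {z \<in> ?X. fst z \<in> insert x ?f}"
      using f fe X(3) by (auto simp: faces_def inj_on_def)
    have "(t((x, 0) := v)) ` insert (x, 0) f = insert v u"
      using y fe(3) f(3) by auto
    moreover have "(t((x, 0) := v)) ` insert (x, 0) f \<in> crossing_exact (insert x ?f) V"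
    proof -
      let ?Z = "{z \<in> ?X. fst z \<in> insert x ?f}"
      have "restrict (t((x, 0) := v)) ?Z \<in> tuples V ?Z"
        unfolding tuples_def restrict_PiE_iff using PiE_mem[OF t'[unfolded tuples_def]] by blast
      then have "restrict (t((x, 0) := v)) ?Z ` insert (x, 0) f \<in> crossing_exact (insert x ?f) V \<longleftrightarrow>
          fst ` insert (x, 0) f = insert x ?f"
      proof (rule L.image_crossing_exact[OF _ _ _ _ f', rotated])
        show "fst ` ?Z \<subseteq> insert x ?f" by blast
        show "insert x ?f \<subseteq> insert x e" using fe(1) by blast
        show "finite ?Z" using X(1) by simp
      qed
      then have "restrict (t((x, 0) := v)) ?Z ` insert (x, 0) f \<in> crossing_exact (insert x ?f) V" by simp
      moreover have "restrict (t((x, 0) := v)) ?Z ` insert (x, 0) f = (t((x, 0) := v)) ` insert (x, 0) f"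
        using f' by (intro image_cong) (auto simp: faces_def)
      ultimately show ?thesis by simp
    qed
    ultimately have ce: "insert v u \<in> crossing_exact (insert x ?f) V" by simp
    have sub: "insert x ?f \<subseteq> J" using K fe by auto
    have "C i (insert v u) = 1" if "i \<le> k" for i using candidate(6)[OF that sub ne ce] .
    then show ?thesis using Sl l by (simp add: L.hyb_def)
  qed
  define m where "m = C (l - 1) {v}"
  have h0: "?h {} = C (l - 1) {}" "?h {v} = m"
  proof -
    have "L.type_of {} = {}" "L.type_of {v} = {x}"
      using L.type_of_insert[OF v, of "{}"] by (auto simp: L.type_of_def)
    then show "?h {} = C (l - 1) {}" "?h {v} = m" using e(2) L.x_notin by (auto simp: L.hyb_def m_def)
  qed
  have scale: "cnt V (link v g) (positions e (\<lambda>_. n)) = m * cnt V g (positions e (\<lambda>_. n))"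
    if g: "g = ?h \<or> g = C (l - 1)" for g n
  proof -
    let ?X = "positions e (\<lambda>_. n)"
    have finX: "finite ?X" using E.finJ by (simp add: finite_positions)
    have gv: "g {v} = m" using g h0 by (auto simp: m_def)
    have "weight (link v g) ?X t = m * weight g ?X t" if t: "t \<in> tuples V ?X" for t
    proof -
      have e0: "{} \<in> faces ?X" by (simp add: faces_def)
      have split: "weight h' ?X t = h' {} * (\<Prod>f\<in>faces ?X - {{}}. h' (t ` f))" for h'
        unfolding weight_def using finite_faces[OF finX] e0 by (subst prod.remove[of _ "{}"]) auto
      have "(\<Prod>f\<in>faces ?X - {{}}. link v g (t ` f)) = (\<Prod>f\<in>faces ?X - {{}}. g (t ` f))"
      proof (intro prod.cong refl)
        fix f assume "f \<in> faces ?X - {{}}"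
        then have "g (insert v (t ` f)) = 1" using one[OF t, of f] g by auto
        then show "link v g (t ` f) = g (t ` f)" by (simp add: link_def)
      qed
      then show ?thesis unfolding split[of "link v g"] split[of g] by (simp add: link_def gv)
    qed
    then show ?thesis by (simp add: cnt_def sum_distrib_left)
  qed
  have xe: "insert x e \<notin> edges H" using nh e(2) by (auto simp: hits_def)
  then have d: "density_after H (insert x (dom \<phi>)) (D l) e = dens l e"
    using density_after_update[OF x e(1)] density_after_nonedge[of l "insert x e"] l K
    by (auto simp: dens_def J_def)
  have \<epsilon>: "hit_count H (insert x (dom \<phi>)) e = hit_count H (dom \<phi>) e"
    using hit_count_insert[OF x] nh by simp
  have rt: "cnt V (replace_top V e (C l) (C (l - 1))) (positions e (\<lambda>_. n)) = cnt V ?h (positions e (\<lambda>_. n))" for n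
  proof -
    let ?X = "positions e (\<lambda>_. n)"
    have X: "finite ?X" "fst ` ?X \<subseteq> e" "fst ` ?X \<subseteq> insert x e"
      using E.finJ by (auto simp: finite_positions positions_def)
    have "weight (replace_top V e (C l) (C (l - 1))) ?X t = weight ?h ?X t" if t: "t \<in> tuples V ?X" for t
      unfolding weight_def
    proof (intro prod.cong refl)
      fix e' assume e': "e' \<in> faces ?X"
      then have sub: "e' \<subseteq> ?X" by (simp add: faces_def)
      have ty: "L.type_of (t ` e') = fst ` e'" by (rule L.type_of_image[OF t X(3) sub])
      have "fst ` e' \<noteq> insert x e" using sub X(2) L.x_notin by blast
      then show "replace_top V e (C l) (C (l - 1)) (t ` e') = ?h (t ` e')"
        using E.image_crossing_exact[OF X(1) t X(2) order.refl e'] by (simp add: replace_top_def L.hyb_def ty)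
    qed
    then show ?thesis by (simp add: cnt_def)
  qed
  note r = gpe_reg[OF Sl(4) e(3,2) eJ, unfolded regular_wrt_def hom_density_full_partite rt]
  have m0: "0 \<le> m" unfolding m_def using singleton_nonneg[OF x v Sl(3)] .
  let ?d = "dens l e" and ?\<epsilon> = "reg P l (card e) (hit_count H (dom \<phi>) e)"
  show ?thesis
  proof (rule update_regularI[OF x e(1,2) v]; unfold d \<epsilon> link_cnt_def link_base_def)
    let ?g = "cnt V ?h (positions e (\<lambda>_. 1))" and ?b = "cnt V (C (l - 1)) (positions e (\<lambda>_. 1))"
    have "\<bar>?g - ?d * ?b\<bar> \<le> ?\<epsilon> * ?b" using r by (auto simp: abs_le_iff algebra_simps)
    then have "m * \<bar>?g - ?d * ?b\<bar> \<le> m * (?\<epsilon> * ?b)" using m0 by (intro mult_left_mono)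
    moreover have "\<bar>m * ?g - ?d * (m * ?b)\<bar> = m * \<bar>?g - ?d * ?b\<bar>"
    proof -
      have "m * ?g - ?d * (m * ?b) = m * (?g - ?d * ?b)" by (simp add: algebra_simps)
      then show ?thesis using m0 by (simp only: abs_mult abs_of_nonneg)
    qed
    ultimately show "\<bar>cnt V (link v ?h) (positions e (\<lambda>_. 1)) - ?d * cnt V (link v (C (l - 1))) (positions e (\<lambda>_. 1))\<bar>
        \<le> ?\<epsilon> * cnt V (link v (C (l - 1))) (positions e (\<lambda>_. 1))"
      by (simp add: scale mult.left_commute)
    let ?g2 = "cnt V ?h (positions e (\<lambda>_. 2))" and ?b2 = "cnt V (C (l - 1)) (positions e (\<lambda>_. 2))"
    have "?g2 \<le> (?d ^ 2 ^ card e + ?\<epsilon>) * ?b2" using r by auto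
    then have "m * ?g2 \<le> m * ((?d ^ 2 ^ card e + ?\<epsilon>) * ?b2)" using m0 by (intro mult_left_mono)
    then show "cnt V (link v ?h) (positions e (\<lambda>_. 2))
        \<le> (?d ^ 2 ^ card e + ?\<epsilon>) * cnt V (link v (C (l - 1))) (positions e (\<lambda>_. 2))"
      by (simp add: scale mult.left_commute)
  qed
qed

lemma degree_le: "e \<in> edges H \<Longrightarrow> x \<in> e \<Longrightarrow> card {e \<in> edges H. x \<in> e} \<le> \<Delta>"
  and \<Delta>_pos: "e \<in> edges H \<Longrightarrow> x \<in> e \<Longrightarrow> 1 \<le> \<Delta>"
proof -
  assume e: "e \<in> edges H" "x \<in> e"
  then have "x \<in> verts H" using edge_props(1) by blast
  then have "card {e \<in> edges H. x \<in> e} \<le> max_degree H"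
    unfolding max_degree_def using finH by (intro Max_ge) auto
  then show deg: "card {e \<in> edges H. x \<in> e} \<le> \<Delta>" using degree by simp
  have "card {e} \<le> card {e \<in> edges H. x \<in> e}" using e finH by (intro card_mono) auto
  then show "1 \<le> \<Delta>" using deg by simp
qed

definition hit_edges :: "'a \<Rightarrow> 'a set set" where
  "hit_edges x = {e \<in> edges H. e \<noteq> {} \<and> e \<subseteq> J - {x} \<and> hits H x e}"

lemma card_hit_edges: "card (hit_edges x) \<le> \<Delta>\<^sup>2"
proof -
  define N where "N = {y \<in> verts H. y \<noteq> x \<and> {x, y} \<in> edges H}"
  have finN: "finite N" using finH by (simp add: N_def)
  have sub: "hit_edges x \<subseteq> (\<Union>y\<in>N. {e \<in> edges H. y \<in> e})"
  proof
    fix e assume "e \<in> hit_edges x"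
    then obtain e' where e: "e \<in> edges H" "e \<subseteq> J - {x}" and e': "e' \<noteq> {}" "e' \<subseteq> e" "insert x e' \<in> edges H"
      by (auto simp: hit_edges_def hits_def)
    then obtain y where y: "y \<in> e'" by auto
    have "{x, y} \<in> edges H" using edge_props(3)[OF e'(3), of "{x, y}"] y by auto
    then have "y \<in> N" using y e e' edge_props(1)[OF e(1)] by (auto simp: N_def)
    then show "e \<in> (\<Union>y\<in>N. {e \<in> edges H. y \<in> e})" using e e' y by auto
  qed
  have cN: "card N \<le> \<Delta>"
  proof (cases "N = {}")
    case False
    then obtain y where y: "y \<in> N" by auto
    have "card N = card ((\<lambda>y. {x, y}) ` N)"
      by (rule card_image[symmetric]) (auto simp: inj_on_def doubleton_eq_iff)
    also have "\<dots> \<le> card {e \<in> edges H. x \<in> e}"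
      using finH by (intro card_mono) (auto simp: N_def)
    also have "\<dots> \<le> \<Delta>" using y degree_le[of "{x, y}" x] by (simp add: N_def)
    finally show ?thesis .
  qed simp
  have "card (hit_edges x) \<le> card (\<Union>y\<in>N. {e \<in> edges H. y \<in> e})"
    using sub finN finH by (intro card_mono) auto
  also have "\<dots> \<le> (\<Sum>y\<in>N. card {e \<in> edges H. y \<in> e})" by (rule card_UN_le[OF finN])
  also have "\<dots> \<le> (\<Sum>y\<in>N. \<Delta>)"
    by (rule sum_mono) (auto simp: N_def intro: degree_le)
  also have "\<dots> \<le> \<Delta>\<^sup>2" using cN by (simp add: power2_eq_square)
  finally show ?thesis .
qed

lemma hit_edge_bad_mass:
  assumes x: "x \<in> J" and e: "e \<in> hit_edges x"
  shows "(\<Sum>v\<in>{v \<in> V x. \<not> update_regular x e v}. C (l - 1) {v}) \<le> reg_max k h P l * (\<Sum>v\<in>V x. C (l - 1) {v})"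
proof -
  have eH: "e \<in> edges H" "e \<noteq> {}" "e \<subseteq> J - {x}" "hits H x e" using e by (auto simp: hit_edges_def)
  have eJ: "e \<subseteq> J" using eH by auto
  have K: "insert x e \<subseteq> J" using x eH by auto
  have fine: "finite e" using finite_sub[OF eJ] .
  have Sl: "Suc (l - 1) = l" "Suc (l - 1) \<le> k" "l - 1 \<le> k" "l \<in> {1..k}" using l by auto
  have r: "card e \<in> {1..k}" using edge_props(2)[OF eH(1)] eH(2) fine by (simp add: Suc_le_eq card_gt_0_iff)
  define i where "i = hit_count H (dom \<phi>) e"
  have i: "i < h" using hit_count_le[OF eH(1) eJ] h_ge_degeneracy(1) by (simp add: i_def)
  have hc: "hit_count H (insert x (dom \<phi>)) e = i + 1" using hit_count_insert[OF x] eH(4) by (simp add: i_def)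
  have sing: "0 \<le> C (l - 1) {v}" if "v \<in> V x" for v using singleton_nonneg[OF x that Sl(3)] .
  have rm: "reg P l (card e) (i + 1) \<le> reg_max k h P l" using reg_le_max[OF r, of "i + 1" l] i by simp
  have r0: "0 < reg P l (card e) (i + 1)" using reg_bounds(1)[OF Sl(4) r, of "i + 1"] i by simp
  show ?thesis
  proof (cases "C (l - 1) {} = 0 \<or> (\<exists>f. f \<subseteq> insert x e \<and> f \<noteq> {} \<and> dens 0 f \<le> 0)")
    case True
    have "update_regular x e v" if v: "v \<in> V x" for v
      using link_vanishes[OF x eH(3,2) edge_props(2)[OF eH(1)] v True] by (intro update_regularI[OF x eH(3,2) v]) auto
    then have none: "{v \<in> V x. \<not> update_regular x e v} = {}" by auto
    have "0 \<le> reg_max k h P l * (\<Sum>v\<in>V x. C (l - 1) {v})"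
      using rm r0 sing by (intro mult_nonneg_nonneg sum_nonneg) auto
    then show ?thesis unfolding none by simp
  next
    case False
    have C0: "0 < C (l - 1) {}" using C_nonneg[OF Sl(3) empty_crossing] False by auto
    have pos: "0 < dens 0 f" if "f \<subseteq> insert x e" "f \<noteq> {}" for f using False that by (auto simp: not_le)
    have xe: "x \<notin> e" using eH by auto
    interpret W: weighted_pair "insert x e" V "C (l - 1) {}" "dens_upto (l - 1)" "C l" "C (l - 1)"
      using pair_step[OF Sl(2) K C0 pos] Sl(1) by simp
    interpret W: vertex_link x e V "C (l - 1) {}" "dens_upto (l - 1)" "C l" "C (l - 1)"
      by unfold_locales (use xe eH(2) in auto)
    obtain e' where e': "insert x e' \<in> edges H" using eH(4) by (auto simp: hits_def)
    have \<Delta>: "1 \<le> \<Delta>" by (rule \<Delta>_pos[OF e', of x]) simp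
    have cK: "card (insert x e) \<le> k + 1" using r fine xe by simp
    define \<sigma> where "\<sigma> = sigma l (card e) i"
    note sb = sigma_bounds[OF Sl(4) r i, folded \<sigma>_def]
    have s1632: "\<sigma> ^ 32 \<le> \<sigma> ^ 16" using sb by (intro power_decreasing) auto
    have \<gamma>1: "\<bar>W.nrm (C (l - 1)) a - 1\<bar> \<le> \<sigma> ^ 16" if "\<And>i. a i \<le> 2" for a
    proof -
      have "\<bar>W.nrm (C (l - 1)) a - 1\<bar> \<le> (4 * real k + 1) * accuracy P (l - 1)"
        unfolding W.nrm_def W.model_def W.types_def
        using that by (intro level_counts[OF K cK pos \<Delta> _ C0]) auto
      then show ?thesis using sb(5) s1632 by linarith
    qed
    have dK: "insert x e \<noteq> {}" by simp
    have eK: "e \<subseteq> insert x e" by blast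
    note te = type_regular[OF Sl(2) K eK eH(2), of "C (l - 1) {}" "dens_upto (l - 1)", unfolded Sl(1), OF W.weighted_pair_axioms]
    note tx = type_regular[OF Sl(2) K order.refl dK, of "C (l - 1) {}" "dens_upto (l - 1)", unfolded Sl(1), OF W.weighted_pair_axioms]
    have err_e: "0 \<le> reg_error l e" "reg_error l e \<le> \<sigma> ^ 16"
      using eH(1) reg_bounds(1)[OF Sl(4) r, of i] i sb(4) by (auto simp: reg_error_def i_def)
    have err_x: "0 \<le> reg_error l (insert x e) \<and> reg_error l (insert x e) \<le> \<sigma> ^ 16"
    proof (cases "insert x e \<in> edges H")
      case True
      let ?i = "hit_count H (dom \<phi>) (insert x e)"
      have ck: "card e + 1 \<le> k" using edge_props(2)[OF True] fine xe by simp
      then have r1: "card e + 1 \<in> {1..k}" "card e \<in> {1..k - 1}" using r by auto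
      have ih: "?i \<le> h" using hit_count_le[OF True K] h_ge_degeneracy(1) by simp
      have "reg P l (card e + 1) ?i \<le> reg P l (card e + 1) h" using reg_mono[OF Sl(4) r1(1) ih order.refl] .
      also have "\<dots> \<le> reg P l (card e) 0"
        using reg_next[OF Sl(4) r1(2)] .
      also have "\<dots> \<le> reg P l (card e) i" using reg_mono[OF Sl(4) r, of 0 i] i by simp
      also have "\<dots> \<le> \<sigma> ^ 16" by (rule sb(4))
      finally show ?thesis
        using True reg_bounds(1)[OF Sl(4) r1(1) ih] fine xe by (simp add: reg_error_def)
    next
      case False
      then show ?thesis using sb(1) by (simp add: reg_error_def)
    qed
    have md: "min_dens P l \<le> dens l e * dens l (insert x e)"
      unfolding density_after_update[OF x eH(3), symmetric]
      using gpe_min[OF Sl(4) eH(2) eJ] density_after_bounds(2)[OF Sl(4) edge_props(1)[OF eH(1)], of "insert x (dom \<phi>)"]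
      by linarith
    have db: "0 < min_dens P l" "min_dens P l < 1" using min_dens_bounds[OF Sl(4)] by auto
    have de: "0 \<le> dens l e" "dens l e \<le> 1" "0 \<le> dens l (insert x e)" "dens l (insert x e) \<le> 1"
      using dens_bounds[OF Sl(4) eH(2) eJ] dens_bounds[OF Sl(4) dK K] db by auto
    have small: "big * \<sigma> \<le> min_dens P l ^ 2 ^ (card e + 1) * reg P l (card e) (i + 1)"
    proof -
      have "min_dens P l ^ 2 ^ (k + 1) \<le> min_dens P l ^ 2 ^ (card e + 1)"
        using r db by (intro power_decreasing power_increasing) auto
      then have "min_dens P l ^ 2 ^ (k + 1) * reg P l (card e) (i + 1) \<le> min_dens P l ^ 2 ^ (card e + 1) * reg P l (card e) (i + 1)"
        using r0 by (intro mult_right_mono) auto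
      then show ?thesis using sb(2) by linarith
    qed
    have r1: "reg P l (card e) (i + 1) \<le> 1" using reg_bounds(2)[OF Sl(4) r, of "i + 1"] i by simp
    have L: "100 * (real (card e) + 1) * 6 ^ card e \<le> big" using big_bounds(3)[of "card e"] r by simp
    let ?d = "dens l e * dens l (insert x e)" and ?\<eta> = "reg P l (card e) (i + 1)"
    define ok where "ok v \<longleftrightarrow>
        \<bar>W.ratio (W.hy {e, insert x e}) v (W.uni e 1) - ?d * W.ratio (C (l - 1)) v (W.uni e 1)\<bar>
          \<le> ?\<eta> * W.ratio (C (l - 1)) v (W.uni e 1)
        \<and> W.ratio (W.hy {e, insert x e}) v (W.uni e 2) \<le> (?d ^ 2 ^ card e + ?\<eta>) * W.ratio (C (l - 1)) v (W.uni e 2)" for v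
    let ?Bad = "{v \<in> V x. \<not> ok v}"
    have inh: "(\<Sum>v\<in>?Bad. W.root_weight v) \<le> ?\<eta> * (\<Sum>v\<in>V x. W.root_weight v)"
      unfolding ok_def
      by (rule W.link_inheritance[OF \<gamma>1 te(1) te(2) tx(1) tx(2) err_e conjunct1[OF err_x] conjunct2[OF err_x]
            db(1) md de sb(1) r0 r1 small L])
    have sub: "{v \<in> V x. \<not> update_regular x e v} \<subseteq> ?Bad"
    proof
      fix v assume v: "v \<in> {v \<in> V x. \<not> update_regular x e v}"
      then have vV: "v \<in> V x" by simp
      have pe: "positions e (W.uni e n) = positions e (\<lambda>_. n)" for n by (auto simp: positions_def W.uni_def)
      have ra: "W.ratio (C (l - 1)) v (W.uni e n) = link_base e n v / W.link_model (W.uni e n)"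
        "W.ratio (W.hy {e, insert x e}) v (W.uni e n) = link_cnt x e n v / W.link_model (W.uni e n)" for n
        by (simp_all only: W.ratio_def pe link_base_def link_cnt_def)
      show "v \<in> ?Bad"
      proof (rule ccontr)
        assume "v \<notin> ?Bad"
        then have "ok v" using vV by blast
        note c = conjunct1[OF this[unfolded ok_def ra]] conjunct2[OF this[unfolded ok_def ra]]
        have m: "0 < W.link_model (W.uni e n)" for n by (rule W.link_model_pos)
        have cancel: "y \<le> z" if "y / w \<le> z / w" "0 < w" for y z w :: real
          using that by (simp add: divide_le_cancel)
        have c1: "\<bar>link_cnt x e 1 v - ?d * link_base e 1 v\<bar> \<le> ?\<eta> * link_base e 1 v"
        proof -
          have "link_cnt x e 1 v / W.link_model (W.uni e 1) - ?d * (link_base e 1 v / W.link_model (W.uni e 1))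
              = (link_cnt x e 1 v - ?d * link_base e 1 v) / W.link_model (W.uni e 1)"
            by (simp add: diff_divide_distrib)
          then have "\<bar>link_cnt x e 1 v - ?d * link_base e 1 v\<bar> / W.link_model (W.uni e 1)
              \<le> (?\<eta> * link_base e 1 v) / W.link_model (W.uni e 1)"
            using c(1) m[of 1] by (simp only: abs_divide abs_of_pos times_divide_eq_right)
          then show ?thesis by (rule cancel[OF _ m])
        qed
        have "link_cnt x e 2 v / W.link_model (W.uni e 2) \<le> ((?d ^ 2 ^ card e + ?\<eta>) * link_base e 2 v) / W.link_model (W.uni e 2)"
          using c(2) by (simp only: times_divide_eq_right)
        then have c2: "link_cnt x e 2 v \<le> (?d ^ 2 ^ card e + ?\<eta>) * link_base e 2 v"
          by (rule cancel[OF _ m])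
        have "update_regular x e v"
          by (rule update_regularI[OF x eH(3,2) vV]; unfold density_after_update[OF x eH(3)] hc; rule c1 c2)
        then show False using v by simp
      qed
    qed
    have fV: "finite (V x)" using candidate(1)[OF x] .
    have rw: "W.root_weight v = C (l - 1) {} * C (l - 1) {v}" for v by (simp only: W.root_weight_def)
    have "C (l - 1) {} * (\<Sum>v\<in>?Bad. C (l - 1) {v}) \<le> C (l - 1) {} * (?\<eta> * (\<Sum>v\<in>V x. C (l - 1) {v}))"
      using inh unfolding rw sum_distrib_left[symmetric] by (simp only: mult.left_commute)
    then have "(\<Sum>v\<in>?Bad. C (l - 1) {v}) \<le> ?\<eta> * (\<Sum>v\<in>V x. C (l - 1) {v})"
      using C0 by (rule mult_left_le_imp_le)
    moreover have "(\<Sum>v\<in>{v \<in> V x. \<not> update_regular x e v}. C (l - 1) {v}) \<le> (\<Sum>v\<in>?Bad. C (l - 1) {v})"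
    proof (rule sum_mono2[OF _ sub])
      show "finite ?Bad" using fV by simp
      show "0 \<le> C (l - 1) {v}" if "v \<in> ?Bad - {v \<in> V x. \<not> update_regular x e v}" for v
        using that by (intro sing) blast
    qed
    moreover have "?\<eta> * (\<Sum>v\<in>V x. C (l - 1) {v}) \<le> reg_max k h P l * (\<Sum>v\<in>V x. C (l - 1) {v})"
      using rm sing by (intro mult_right_mono sum_nonneg) auto
    ultimately show ?thesis by linarith
  qed
qed

lemma bad_vertices_step:
  assumes x: "x \<in> J" and v: "v \<in> bad_vertices k c H P D V \<phi> C x l - bad_vertices k c H P D V \<phi> C x (l - 1)"
  shows "v \<in> V x \<and> (\<exists>e\<in>hit_edges x. \<not> update_regular x e v)"
proof -
  have vV: "v \<in> V x" using v by (simp add: bad_vertices_def)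
  let ?\<phi> = "\<phi>(x \<mapsto> v)" and ?C = "\<lambda>i. link v (C i)"
  have good: "Defs.gpe k c H P D V ?\<phi> ?C (l - 1)" and bad: "\<not> Defs.gpe k c H P D V ?\<phi> ?C l"
    using v by (auto simp: bad_vertices_def)
  have J': "verts H - insert x (dom \<phi>) = J - {x}" "dom ?\<phi> = insert x (dom \<phi>)" by (auto simp: J_def)
  obtain e where e: "e \<in> edges H" "e \<noteq> {}" "e \<subseteq> J - {x}" "\<not> update_regular x e v"
  proof (rule ccontr)
    assume neg: "\<not> thesis"
    have "update_regular x e v" if "e \<in> edges H" "e \<noteq> {}" "e \<subseteq> J - {x}" for e
      using neg that \<open>\<And>e. \<lbrakk>e \<in> edges H; e \<noteq> {}; e \<subseteq> J - {x}; \<not> update_regular x e v\<rbrakk> \<Longrightarrow> thesis\<close> by blast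
    then have top: "\<forall>e\<in>edges H. e \<noteq> {} \<and> e \<subseteq> J - {x} \<longrightarrow>
       regular_wrt e V (reg P l (card e) (hit_count H (insert x (dom \<phi>)) e))
         (density_after H (insert x (dom \<phi>)) (D l) e) (replace_top V e (?C l) (?C (l - 1))) (?C (l - 1))"
      by (simp add: update_regular_def)
    have min: "min_dens P l' \<le> (\<Prod>f\<in>{f. f \<subseteq> verts H \<and> e \<subseteq> f}. D l' f)"
      if "l' \<in> {1..l}" "e \<noteq> {}" "e \<subseteq> J - {x}" for l' e
      using gpe_min[of l' e] that l by auto
    note g = good[unfolded gpe_def Let_def J']
    note g1 = conjunct1[OF g] and g2 = conjunct1[OF conjunct2[OF g]]
    have "Defs.gpe k c H P D V ?\<phi> ?C l"
      unfolding gpe_def Let_def J'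
    proof (intro conjI ballI allI impI)
      show "thc k (accuracy P 0) c V (J - {x}) (?C 0) (density_after H (insert x (dom \<phi>)) (D 0))"
        by (rule g1)
      fix l' assume l': "l' \<in> {1..l}"
      show "min_dens P l' \<le> (\<Prod>f\<in>{f. f \<subseteq> verts H \<and> e \<subseteq> f}. D l' f)" if "e \<noteq> {} \<and> e \<subseteq> J - {x}" for e
        using min[OF l'] that by blast
      fix e assume e: "e \<in> edges H" "e \<noteq> {} \<and> e \<subseteq> J - {x}"
      show "regular_wrt e V (reg P l' (card e) (hit_count H (insert x (dom \<phi>)) e))
         (density_after H (insert x (dom \<phi>)) (D l') e) (replace_top V e (?C l') (?C (l' - 1))) (?C (l' - 1))"
      proof (cases "l' = l")
        case True
        show ?thesis unfolding True by (rule top[rule_format, OF e])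
      next
        case False
        then have "l' \<in> {1..l - 1}" using l' by auto
        then show ?thesis by (rule g2[rule_format, OF _ e])
      qed
    qed
    then show False using bad by simp
  qed
  have "hits H x e" using not_hit_regular[OF x e(3,2,1) vV] e(4) by blast
  then show ?thesis using vV e by (auto simp: hit_edges_def)
qed

lemma bad_vertices_norm:
  assumes x: "x \<in> J"
  shows "wnorm (C (l - 1)) (V x)
           (bad_vertices k c H P D V \<phi> C x l - bad_vertices k c H P D V \<phi> C x (l - 1))
         \<le> real k * real \<Delta> ^ 2 * reg_max k h P l * wnorm (C (l - 1)) (V x) (V x)"
proof -
  let ?B = "bad_vertices k c H P D V \<phi> C x l - bad_vertices k c H P D V \<phi> C x (l - 1)"
  let ?g = "\<lambda>v. C (l - 1) {v}" and ?S = "\<Sum>v\<in>V x. C (l - 1) {v}"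
  let ?Bad = "\<lambda>e. {v \<in> V x. \<not> update_regular x e v}"
  have fV: "finite (V x)" using candidate(1)[OF x] .
  have lk: "l - 1 \<le> k" "l \<in> {1..k}" "1 \<in> {1..k}" using l k1 by auto
  have sing: "0 \<le> ?g v" if "v \<in> V x" for v using singleton_nonneg[OF x that lk(1)] .
  have fin: "finite (hit_edges x)" using finH by (simp add: hit_edges_def)
  have m0: "0 \<le> reg_max k h P l"
    using reg_le_max[OF lk(3), of 0 l] reg_bounds(1)[OF lk(2,3), of 0] by simp
  have S0: "0 \<le> ?S" using sing by (rule sum_nonneg)
  have "(\<Sum>v\<in>V x. indicator ?B v * ?g v) \<le> (\<Sum>v\<in>V x. \<Sum>e\<in>hit_edges x. indicator (?Bad e) v * ?g v)"
  proof (rule sum_mono)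
    fix v assume v: "v \<in> V x"
    show "indicator ?B v * ?g v \<le> (\<Sum>e\<in>hit_edges x. indicator (?Bad e) v * ?g v)"
    proof (cases "v \<in> ?B")
      case True
      then obtain e where e: "e \<in> hit_edges x" "v \<in> ?Bad e" using bad_vertices_step[OF x True] by auto
      have "indicator ?B v * ?g v = indicator (?Bad e) v * ?g v" using True e by simp
      also have "\<dots> \<le> (\<Sum>e\<in>hit_edges x. indicator (?Bad e) v * ?g v)"
        using sing[OF v] fin by (intro member_le_sum[OF e(1)]) auto
      finally show ?thesis .
    next
      case False
      then show ?thesis using sing[OF v] by (auto intro!: sum_nonneg)
    qed
  qed
  also have "\<dots> = (\<Sum>e\<in>hit_edges x. \<Sum>v\<in>?Bad e. ?g v)"
  proof -
    have "(\<Sum>v\<in>V x. indicator (?Bad e) v * ?g v) = (\<Sum>v\<in>?Bad e. ?g v)" for e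
    proof -
      have "(\<Sum>v\<in>V x. indicator (?Bad e) v * ?g v) = (\<Sum>v\<in>V x. if \<not> update_regular x e v then ?g v else 0)"
        by (intro sum.cong) (auto simp: indicator_def)
      also have "\<dots> = (\<Sum>v\<in>?Bad e. ?g v)" by (rule sum.inter_filter[OF fV, symmetric])
      finally show ?thesis .
    qed
    then show ?thesis by (subst sum.swap) simp
  qed
  also have "\<dots> \<le> (\<Sum>e\<in>hit_edges x. reg_max k h P l * ?S)"
    by (rule sum_mono) (rule hit_edge_bad_mass[OF x])
  also have "\<dots> = real (card (hit_edges x)) * (reg_max k h P l * ?S)" by simp
  also have "\<dots> \<le> (real k * real \<Delta> ^ 2) * (reg_max k h P l * ?S)"
  proof (rule mult_right_mono)
    have "real (card (hit_edges x)) \<le> real (\<Delta>\<^sup>2)" using card_hit_edges by (rule of_nat_mono)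
    also have "\<dots> \<le> real k * real \<Delta> ^ 2" using k1 mult_right_mono[of 1 "real k" "real \<Delta> ^ 2"] by simp
    finally show "real (card (hit_edges x)) \<le> real k * real \<Delta> ^ 2" .
  qed (use m0 S0 in simp)
  finally have main: "(\<Sum>v\<in>V x. indicator ?B v * ?g v) \<le> real k * real \<Delta> ^ 2 * reg_max k h P l * ?S"
    by (simp only: mult.assoc)
  have "(\<Sum>v\<in>V x. indicator (V x) v * ?g v) = ?S" by (intro sum.cong) auto
  then show ?thesis
    unfolding wnorm_def using divide_right_mono[OF main, of "real (card (V x))"] by simp
qed

end

theorem lemma12:
  fixes k c h \<Delta> \<Delta>' l :: nat
    and H :: "'a::linorder set_system"
    and P :: ensemble
    and D :: "nat \<Rightarrow> 'a set \<Rightarrow> real"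
    and V :: "'a \<Rightarrow> 'v set"
    and \<phi> :: "'a \<rightharpoonup> 'v"
    and C :: "nat \<Rightarrow> 'v set \<Rightarrow> real"
    and x :: 'a
  assumes "k \<ge> 2" and "k_complex k H" and "max_degree H = \<Delta>" and "vdeg H \<le> \<Delta>'"
    and "c > 0" and "h > 0"
    and "valid_ensemble k c h \<Delta> P"
    and "density_stack k H D"
    and "partial_embedding H \<phi>"
    and "candidate_stack k H \<phi> V C"
    and "gpe k c H P D V \<phi> C k"
    and "x \<in> verts H - dom \<phi>"
    and "1 \<le> l" and "l \<le> k"
    and "l * (4 * k + 1) \<le> c"
    and "l * (4 * k + 1) + k * \<Delta>' \<le> h"
  shows "wnorm (C (l - 1)) (V x)
           (bad_vertices k c H P D V \<phi> C x l - bad_vertices k c H P D V \<phi> C x (l - 1))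
         \<le> real k * real \<Delta> ^ 2 * reg_max k h P l * wnorm (C (l - 1)) (V x) (V x)"
proof -
  interpret good_embedding k c h \<Delta> P H D V \<phi> C \<Delta>' l
    by unfold_locales (use assms in auto)
  show ?thesis
    by (rule bad_vertices_norm) (use assms(12) in \<open>simp add: J_def\<close>)
qed

end
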